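(* Let $n\ge 2$, $1<p<\infty$, let $\Omega\subset\mathbb{R}^n$ be open and bounded, and let $\sigma\in L^\infty_+(\Omega)$. Suppose that either $\sigma(x)\ge 1$ holds almost everywhere in $\Omega$ or $\sigma(x)\le 1$ holds almost everywhere in $\Omega$. Then $$\mathrm{conv}(\mathrm{supp}(|\sigma-1|))=\mathrm{conv}\left(\bigcup_{B\in\mathcal{B}}B^\circ\right),$$ where $\mathcal{B}$ is the family of all measurable sets $B\subseteq\Omega$ for which there exists an $\alpha>0$ such that either $\Lambda_0+\alpha\Lambda_B\le\Lambda_\sigma$ or $\Lambda_0-\alpha\Lambda_B\ge\Lambda_\sigma$, and $B^\circ$ denotes the measure theoretic interior of $B$.
   Context: $m$ denotes $n$-dimensional Lebesgue measure. $L^\infty_+(\Omega)=\{f\in L^\infty(\Omega;\mathbb{R}) : \operatorname{ess\,inf} f>0\}$. Dirichlet-Neumann map: let $X=W^{1,p}(\Omega)/W^{1,p}_0(\Omega)$ with dual $X'$. For $\sigma\in L^\infty_+(\Omega)$ and $f\in X$ let $u_\sigma^f$ be the unique minimizer of $E_\sigma(u)=\int_\Omega \sigma|\nabla u|^p\,dx$ over $f+W^{1,p}_0(\Omega)$. Then $\Lambda_\sigma:X\to X'$ is the (nonlinear) map $$(\Lambda_\sigma(f),g)=\int_\Omega \sigma|\nabla u_\sigma^f|^{p-2}\nabla u_\sigma^f\cdot\nabla v^g\,dx,\qquad f,g\in X,$$ where $v^g\in W^{1,p}(\Omega)$ is any representative of $g$. $\Lambda_0$ denotes the Dirichlet-Neumann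 map for the homogeneous conductivity $\sigma_0=1$. For a measurable set $B\subseteq\Omega$, $\Lambda_B:X\to X'$ is defined by $$(\Lambda_B(f),g)=\int_B|\nabla u_0^f|^{p-2}\nabla u_0^f\cdot\nabla u_0^g\,dx,\qquad f,g\in X,$$ where $u_0^h$ is the unique minimizer of $\int_\Omega|\nabla u|^p\,dx$ over $h+W^{1,p}_0(\Omega)$. Order: for (possibly nonlinear) maps $\Lambda_1,\Lambda_2:X\to X'$, $\Lambda_1\ge\Lambda_2$ (equivalently $\Lambda_2\le\Lambda_1$) means $(\Lambda_1(f)-\Lambda_2(f),f)\ge 0$ for all $f\in X$. Essential support: for measurable $f:\Omega\to\mathbb{R}$, $\mathrm{supp} f$ is the complement in $\Omega$ of the union of all open sets $O\subseteq\Omega$ with $f|_O=0$ almost everywhere. Measure theoretic interior: for measurable $A$, $A^\circ$ is the set of all $x\in A$ with $\lim_{\epsilon\to 0} m(A\cap B_\epsilon(x))/m(B_\epsilon(x))=1$, where $B_\epsilon(x)$ is the ball of radius $\epsilon$ centred at $x$. (Closed) essential convex hull: for measurable $A\subset\mathbb{R}^n$, $\mathrm{conv}\,A$ is the intersection of all closed half-spaces $H_{\rho,t}=\{x\in\mathbb{R}^n : x\cdot\rho\le t\}$ ($\rho\in\mathbb{R}^n$, $t\in\mathbb{R}$) such that $m(A\setminus H_{\rho,t})=0$. *)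

theory Defs
  imports "HOL-Probability.Essential_Supremum"
begin

section \<open>Test functions\<close>

definition partial_deriv :: "'n::finite \<Rightarrow> (real^'n \<Rightarrow> real) \<Rightarrow> real^'n \<Rightarrow> real" where
  "partial_deriv i f x = frechet_derivative f (at x) (axis i 1)"

primrec C_k :: "nat \<Rightarrow> (real^'n::finite \<Rightarrow> real) \<Rightarrow> bool" where
  "C_k 0 f \<longleftrightarrow> continuous_on UNIV f"
| "C_k (Suc k) f \<longleftrightarrow> (\<forall>x. f differentiable (at x)) \<and> (\<forall>i. C_k k (partial_deriv i f))"

definition test_functions :: "(real^'n::finite) set \<Rightarrow> (real^'n \<Rightarrow> real) set" where
  "test_functions \<Omega> =
     {\<phi>. (\<forall>k. C_k k \<phi>) \<and> compact (closure {x. \<phi> x \<noteq> 0}) \<and> closure {x. \<phi> x \<noteq> 0} \<subseteq> \<Omega>}"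

section \<open>Sobolev spaces\<close>

text \<open>Elements of the function spaces below are represented by functions on the whole space;
  only their values on \<open>\<Omega>\<close> (up to null sets) are relevant.\<close>

definition Lp_fun :: "real \<Rightarrow> (real^'n::finite) set \<Rightarrow> (real^'n \<Rightarrow> 'b::euclidean_space) set" where
  "Lp_fun p \<Omega> = {f \<in> borel_measurable (lebesgue_on \<Omega>).
     integrable (lebesgue_on \<Omega>) (\<lambda>x. norm (f x) powr p)}"

definition locally_integrable :: "(real^'n::finite) set \<Rightarrow> (real^'n \<Rightarrow> 'b::euclidean_space) \<Rightarrow> bool" where
  "locally_integrable \<Omega> f \<longleftrightarrow> (\<forall>K. compact K \<and> K \<subseteq> \<Omega> \<longrightarrow> integrable (lebesgue_on K) f)"

definition has_weak_gradient ::
    "(real^'n::finite) set \<Rightarrow> (real^'n \<Rightarrow> real) \<Rightarrow> (real^'n \<Rightarrow> real^'n) \<Rightarrow> bool" where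
  "has_weak_gradient \<Omega> u G \<longleftrightarrow>
     locally_integrable \<Omega> u \<and> locally_integrable \<Omega> G \<and>
     (\<forall>\<phi>\<in>test_functions \<Omega>. \<forall>i.
        (LINT x|lebesgue_on \<Omega>. u x * partial_deriv i \<phi> x) =
        - (LINT x|lebesgue_on \<Omega>. G x $ i * \<phi> x))"

text \<open>The weak gradient is unique up to null sets; the choice of a version is immaterial because it
  is only used under integrals over subsets of \<open>\<Omega>\<close>.\<close>

definition weak_gradient :: "(real^'n::finite) set \<Rightarrow> (real^'n \<Rightarrow> real) \<Rightarrow> real^'n \<Rightarrow> real^'n" where
  "weak_gradient \<Omega> u = (SOME G. has_weak_gradient \<Omega> u G)"

definition sobolev :: "real \<Rightarrow> (real^'n::finite) set \<Rightarrow> (real^'n \<Rightarrow> real) set" where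
  "sobolev p \<Omega> = {u \<in> Lp_fun p \<Omega>. \<exists>G \<in> Lp_fun p \<Omega>. has_weak_gradient \<Omega> u G}"

definition sobolev_norm :: "real \<Rightarrow> (real^'n::finite) set \<Rightarrow> (real^'n \<Rightarrow> real) \<Rightarrow> real" where
  "sobolev_norm p \<Omega> u =
     ((LINT x|lebesgue_on \<Omega>. \<bar>u x\<bar> powr p) +
      (LINT x|lebesgue_on \<Omega>. norm (weak_gradient \<Omega> u x) powr p)) powr (1 / p)"

definition sobolev_0 :: "real \<Rightarrow> (real^'n::finite) set \<Rightarrow> (real^'n \<Rightarrow> real) set" where
  "sobolev_0 p \<Omega> = {u \<in> sobolev p \<Omega>.
     \<forall>\<epsilon>>0. \<exists>\<phi>\<in>test_functions \<Omega>. sobolev_norm p \<Omega> (\<lambda>x. u x - \<phi> x) < \<epsilon>}"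

text \<open>The space \<open>X\<close>. Its elements are the cosets \<open>f + W\<^sub>0\<close> themselves; since \<open>W\<^sub>0\<close> contains
  every function vanishing almost everywhere on \<open>\<Omega>\<close>, this quotient also identifies functions
  that agree almost everywhere.\<close>

definition boundary_space :: "real \<Rightarrow> (real^'n::finite) set \<Rightarrow> (real^'n \<Rightarrow> real) set set" where
  "boundary_space p \<Omega> = sobolev p \<Omega> //
     {(u, v). u \<in> sobolev p \<Omega> \<and> v \<in> sobolev p \<Omega> \<and> (\<lambda>x. v x - u x) \<in> sobolev_0 p \<Omega>}"

section \<open>Conductivities and Dirichlet-Neumann maps\<close>

definition ess_inf :: "'a measure \<Rightarrow> ('a \<Rightarrow> ereal) \<Rightarrow> ereal" where
  "ess_inf M f = - esssup M (\<lambda>x. - f x)"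

definition L_infinity_plus :: "(real^'n::finite) set \<Rightarrow> (real^'n \<Rightarrow> real) set" where
  "L_infinity_plus \<Omega> = {\<sigma> \<in> borel_measurable (lebesgue_on \<Omega>).
     esssup (lebesgue_on \<Omega>) (\<lambda>x. ereal \<bar>\<sigma> x\<bar>) < \<infinity> \<and>
     ess_inf (lebesgue_on \<Omega>) (\<lambda>x. ereal (\<sigma> x)) > 0}"

definition p_energy ::
    "real \<Rightarrow> (real^'n::finite) set \<Rightarrow> (real^'n \<Rightarrow> real) \<Rightarrow> (real^'n \<Rightarrow> real) \<Rightarrow> real" where
  "p_energy p \<Omega> \<sigma> u = (LINT x|lebesgue_on \<Omega>. \<sigma> x * norm (weak_gradient \<Omega> u x) powr p)"

text \<open>The minimizer over a coset is unique only up to null sets, hence a choice of representative.\<close>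

definition dirichlet_solution ::
    "real \<Rightarrow> (real^'n::finite) set \<Rightarrow> (real^'n \<Rightarrow> real) \<Rightarrow> (real^'n \<Rightarrow> real) set \<Rightarrow> real^'n \<Rightarrow> real" where
  "dirichlet_solution p \<Omega> \<sigma> f = arg_min_on (p_energy p \<Omega> \<sigma>) f"

text \<open>A map \<open>\<Lambda>\<close> from \<open>X\<close> to its dual is represented by its pairing: \<open>\<Lambda> f g\<close> stands for
  \<open>(\<Lambda>(f), g)\<close> with \<open>f\<close>, \<open>g\<close> in \<open>X\<close>. In \<open>norm 0 powr (p - 2)\<close> the value \<open>0 powr a = 0\<close> is
  harmless, as that factor multiplies the zero vector.\<close>

type_synonym 'n boundary_map =
  "(real^'n \<Rightarrow> real) set \<Rightarrow> (real^'n \<Rightarrow> real) set \<Rightarrow> real"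

definition DN_map ::
    "real \<Rightarrow> (real^'n::finite) set \<Rightarrow> (real^'n \<Rightarrow> real) \<Rightarrow> 'n boundary_map" where
  "DN_map p \<Omega> \<sigma> f g =
     (let Du = weak_gradient \<Omega> (dirichlet_solution p \<Omega> \<sigma> f);
          Dv = weak_gradient \<Omega> (SOME v. v \<in> g)
      in LINT x|lebesgue_on \<Omega>. \<sigma> x * norm (Du x) powr (p - 2) * (Du x \<bullet> Dv x))"

definition DN_map_0 :: "real \<Rightarrow> (real^'n::finite) set \<Rightarrow> 'n boundary_map" where
  "DN_map_0 p \<Omega> = DN_map p \<Omega> (\<lambda>x. 1)"

definition DN_map_set ::
    "real \<Rightarrow> (real^'n::finite) set \<Rightarrow> (real^'n) set \<Rightarrow> 'n boundary_map" where
  "DN_map_set p \<Omega> B f g =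
     (let Du = weak_gradient \<Omega> (dirichlet_solution p \<Omega> (\<lambda>x. 1) f);
          Dv = weak_gradient \<Omega> (dirichlet_solution p \<Omega> (\<lambda>x. 1) g)
      in LINT x|lebesgue_on B. norm (Du x) powr (p - 2) * (Du x \<bullet> Dv x))"

definition boundary_map_le ::
    "real \<Rightarrow> (real^'n::finite) set \<Rightarrow> 'n boundary_map \<Rightarrow> 'n boundary_map \<Rightarrow> bool" where
  "boundary_map_le p \<Omega> \<Lambda>2 \<Lambda>1 \<longleftrightarrow> (\<forall>f\<in>boundary_space p \<Omega>. \<Lambda>1 f f - \<Lambda>2 f f \<ge> 0)"

definition test_sets ::
    "real \<Rightarrow> (real^'n::finite) set \<Rightarrow> (real^'n \<Rightarrow> real) \<Rightarrow> (real^'n) set set" where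
  "test_sets p \<Omega> \<sigma> = {B. B \<in> sets lebesgue \<and> B \<subseteq> \<Omega> \<and> (\<exists>\<alpha>>0.
     boundary_map_le p \<Omega> (\<lambda>f g. DN_map_0 p \<Omega> f g + \<alpha> * DN_map_set p \<Omega> B f g) (DN_map p \<Omega> \<sigma>) \<or>
     boundary_map_le p \<Omega> (DN_map p \<Omega> \<sigma>) (\<lambda>f g. DN_map_0 p \<Omega> f g - \<alpha> * DN_map_set p \<Omega> B f g))}"

section \<open>Essential support, measure theoretic interior, essential convex hull\<close>

definition ess_support :: "(real^'n::finite) set \<Rightarrow> (real^'n \<Rightarrow> real) \<Rightarrow> (real^'n) set" where
  "ess_support \<Omega> f = \<Omega> - \<Union>{U. open U \<and> U \<subseteq> \<Omega> \<and> (AE x in lebesgue_on U. f x = 0)}"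

definition measure_interior :: "(real^'n::finite) set \<Rightarrow> (real^'n) set" where
  "measure_interior A = {x \<in> A.
     ((\<lambda>\<epsilon>. measure lebesgue (A \<inter> ball x \<epsilon>) / measure lebesgue (ball x \<epsilon>)) \<longlongrightarrow> 1) (at_right 0)}"

text \<open>The direction \<open>\<rho> = 0\<close> is admitted, so the hull of a null set is empty.\<close>

definition ess_convex_hull :: "(real^'n::finite) set \<Rightarrow> (real^'n) set" where
  "ess_convex_hull A =
     \<Inter>{{x. x \<bullet> \<rho> \<le> t} | \<rho> t. A - {x. x \<bullet> \<rho> \<le> t} \<in> null_sets lebesgue}"

end

theory Submission
  imports Defs "HOL-Computational_Algebra.Polynomial"
begin

text \<open>
  Let \<open>u\<close> be the \<open>p\<close>-harmonic function with boundary values \<open>f\<close>. The proof rests on two monotonicity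
  bounds, \<open>DN_map_diff_le\<close> and \<open>DN_map_diff_ge\<close>, for the difference of \<open>(\<Lambda>\<^sub>\<sigma>(f), f)\<close> and \<open>(\<Lambda>\<^sub>0(f), f)\<close>:
  it is at most the integral of \<open>(\<sigma> - 1) |\<nabla>u|^p\<close> and at least \<open>p - 1\<close> times the integral of
  \<open>(1 - \<sigma> powr (- 1 / (p - 1))) |\<nabla>u|^p\<close>.

  By the lower bound if \<open>\<sigma> \<ge> 1\<close>, and by the upper bound if \<open>\<sigma> \<le> 1\<close>, the sets where \<open>\<sigma>\<close> differs from \<open>1\<close>
  by at least \<open>\<delta> > 0\<close> are test sets (\<open>superlevel_test_set\<close>, \<open>sublevel_test_set\<close>). They agree with their
  measure theoretic interiors up to null sets by Lebesgue's density theorem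
  (\<open>negligible_diff_measure_interior\<close>), and they exhaust the set where \<open>\<sigma> \<noteq> 1\<close> as \<open>\<delta>\<close> tends to zero.
  So a half-space that contains almost all of the interiors contains the support of \<open>|\<sigma> - 1|\<close>.

  Conversely, let \<open>\<sigma> = 1\<close> almost everywhere outside the half-space \<open>x \<bullet> r \<le> t\<close>, and let \<open>B\<close> be a test set.
  Then the monotonicity bounds show that, for every \<open>p\<close>-harmonic function \<open>u\<close>, the energy of \<open>u\<close> in \<open>B\<close>
  is at most a constant times its energy in that half-space. Wolff's solutions
  \<open>exp (\<tau> x \<bullet> r) w(\<tau> x \<bullet> b)\<close>, with \<open>b\<close> orthogonal to \<open>r\<close>, have gradients comparable to
  \<open>\<tau> exp (\<tau> x \<bullet> r)\<close> uniformly in \<open>\<tau>\<close> (\<open>exponential_solutions\<close>). As \<open>\<tau>\<close> tends to infinity, their energy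
  concentrates beyond the hyperplane, which forces \<open>B\<close> to have measure zero there
  (\<open>negligible_beyond_hyperplane\<close>), and \<open>B\<^sup>o\<close> to have no points there.

  The monotonicity bounds presuppose that the minimizers defining the Dirichlet-Neumann maps exist and
  that the pairing \<open>(\<Lambda>\<^sub>\<sigma>(f), f)\<close> is the minimal energy. The former is the direct method
  (\<open>minimizer_exists\<close>), driven by the uniform convexity of \<open>|a|^p\<close> (\<open>uniform_convexity\<close>), the
  completeness of \<open>L\<^sup>p\<close> (\<open>p_integrable_complete\<close>) and Poincare's inequality (\<open>poincare\<close>); the latter is
  the Euler--Lagrange equation (\<open>euler_lagrange\<close>, \<open>flux_pairing\<close>). Weak gradients are well defined by
  the fundamental lemma of the calculus of variations (\<open>fundamental_lemma\<close>).
\<close>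

section \<open>Pointwise inequalities for p-th powers\<close>

text \<open>The flux of a \<open>p\<close>-harmonic function in terms of its gradient; up to the factor \<open>p\<close>, it is the
  gradient of the function \<open>norm a powr p\<close>.\<close>

definition pflux :: "real \<Rightarrow> 'b::euclidean_space \<Rightarrow> 'b" where
  "pflux p a = norm a powr (p - 2) *\<^sub>R a"

text \<open>By the mean value theorem, a convex power lies above its tangents. The strict form is the source
  of all strict convexity below.\<close>

lemma powr_tangent:
  fixes s m p :: real
  assumes "1 < p" "0 \<le> s" "0 \<le> m"
  shows "s powr p \<ge> m powr p + p * m powr (p - 1) * (s - m)"
    and "s \<noteq> m \<Longrightarrow> s powr p > m powr p + p * m powr (p - 1) * (s - m)"
proof -
  have strict: "s powr p > m powr p + p * m powr (p - 1) * (s - m)" if "s \<noteq> m"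
  proof (cases "m = 0 \<or> s = 0")
    case True
    then show ?thesis
    proof
      assume "m = 0" then show ?thesis using that assms by auto
    next
      assume "s = 0"
      with that assms have "m > 0" by auto
      have "m powr p = m powr (p - 1) * m" using \<open>m > 0\<close> by (simp add: powr_diff)
      then have "m powr p + p * m powr (p - 1) * (s - m) = (1 - p) * m powr p"
        using \<open>s = 0\<close> by (simp add: algebra_simps)
      then show ?thesis using \<open>m > 0\<close> \<open>s = 0\<close> assms by (simp add: mult_neg_pos)
    qed
  next
    case False
    then have pos: "0 < m" "0 < s" using assms by auto
    have der: "((\<lambda>x. x powr p) has_real_derivative p * x powr (p - 1)) (at x)" if "0 < x" for x
      using that by (auto intro!: derivative_eq_intros)
    show ?thesis
    proof (cases "m < s")
      case True
      obtain z where z: "m < z" "z < s" "s powr p - m powr p = (s - m) * (p * z powr (p - 1))"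
        using MVT2[OF True, of "\<lambda>x. x powr p" "\<lambda>x. p * x powr (p - 1)"] der pos by auto
      have "m powr (p - 1) < z powr (p - 1)" using z pos assms by (intro powr_less_mono2) auto
      then have "(s - m) * (p * m powr (p - 1)) < (s - m) * (p * z powr (p - 1))"
        using True assms by (intro mult_strict_left_mono) auto
      then show ?thesis using z by (simp add: algebra_simps)
    next
      case False
      with that have lt: "s < m" by auto
      obtain z where z: "s < z" "z < m" "m powr p - s powr p = (m - s) * (p * z powr (p - 1))"
        using MVT2[OF lt, of "\<lambda>x. x powr p" "\<lambda>x. p * x powr (p - 1)"] der pos by auto
      have "z powr (p - 1) < m powr (p - 1)" using z pos assms by (intro powr_less_mono2) auto
      then have "(m - s) * (p * z powr (p - 1)) < (m - s) * (p * m powr (p - 1))"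
        using lt assms by (intro mult_strict_left_mono) auto
      then show ?thesis using z by (simp add: algebra_simps)
    qed
  qed
  then show "s \<noteq> m \<Longrightarrow> s powr p > m powr p + p * m powr (p - 1) * (s - m)" .
  show "s powr p \<ge> m powr p + p * m powr (p - 1) * (s - m)"
    using strict by (cases "s = m") auto
qed

lemma powr_minus_two_mult_square:
  fixes a :: "'b::euclidean_space"
  assumes "1 < p"
  shows "norm a powr (p - 2) * (a \<bullet> a) = norm a powr p"
proof (cases "a = 0")
  case False
  have "norm a powr (p - 2) * norm a powr 2 = norm a powr (p - 2 + 2)" by (rule powr_add[symmetric])
  moreover have "norm a powr 2 = a \<bullet> a" using False by (simp add: dot_square_norm)
  ultimately show ?thesis by simp
qed auto

lemma pflux_inner_self: "1 < p \<Longrightarrow> pflux p a \<bullet> a = norm a powr p"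
  by (simp add: pflux_def powr_minus_two_mult_square)

lemma norm_pflux: "1 < p \<Longrightarrow> norm (pflux p a) = norm a powr (p - 1)"
proof (cases "a = 0")
  case False
  assume "1 < p"
  have "norm a powr (p - 2) * norm a powr 1 = norm a powr (p - 2 + 1)" by (rule powr_add[symmetric])
  then show ?thesis using False by (simp add: pflux_def)
qed (auto simp: pflux_def)

lemma pflux_scale:
  fixes a :: "'b::euclidean_space"
  assumes "1 < p" "0 < c" shows "pflux p (c *\<^sub>R a) = c powr (p - 1) *\<^sub>R pflux p a"
proof -
  have "c powr (p - 2) * c powr 1 = c powr (p - 2 + 1)" by (rule powr_add[symmetric])
  then show ?thesis using assms by (simp add: pflux_def powr_mult)
qed

lemma continuous_pflux:
  fixes a :: "'b::euclidean_space"
  assumes "1 < p" shows "isCont (pflux p) a"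
proof (cases "a = 0")
  case True
  have "((\<lambda>x::'b. norm x powr (p - 1)) \<longlongrightarrow> 0 powr (p - 1)) (at 0)"
    using assms by (intro tendsto_powr') (auto intro!: tendsto_eq_intros)
  then have "((\<lambda>x::'b. norm (pflux p x)) \<longlongrightarrow> 0) (at 0)"
    using assms by (simp add: norm_pflux)
  then have "(pflux p \<longlongrightarrow> 0) (at (0::'b))" by (rule tendsto_norm_zero_cancel)
  then show ?thesis using True by (simp add: isCont_def pflux_def)
next
  case False
  have "isCont (\<lambda>a::'b. norm a powr (p - 2) *\<^sub>R a) a"
    using False by (intro continuous_intros) auto
  then show ?thesis unfolding pflux_def by simp
qed

lemma continuous_on_pflux [continuous_intros]:
  assumes "1 < p" "continuous_on S f"
  shows "continuous_on S (\<lambda>x. pflux p (f x :: 'b::euclidean_space))"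
proof -
  have "continuous_on UNIV (pflux p :: 'b \<Rightarrow> 'b)"
    using continuous_pflux[OF assms(1)] by (blast intro: continuous_at_imp_continuous_on)
  then show ?thesis using continuous_on_compose2[OF _ assms(2)] by blast
qed

lemma borel_measurable_pflux [measurable]:
  "f \<in> borel_measurable M \<Longrightarrow> (\<lambda>x. pflux p (f x :: 'b::euclidean_space)) \<in> borel_measurable M"
  unfolding pflux_def by measurable

text \<open>Convexity of \<open>norm a powr p\<close>. The radial part is the tangent inequality for powers, and the
  Cauchy--Schwarz inequality takes care of the direction.\<close>

lemma norm_powr_tangent:
  fixes a b :: "'b::euclidean_space"
  assumes "1 < p"
  shows "norm a powr p \<ge> norm b powr p + p * (pflux p b \<bullet> (a - b))"
proof -
  have "pflux p b \<bullet> a \<le> norm b powr (p - 1) * norm a"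
    using norm_cauchy_schwarz[of "pflux p b" a] assms by (simp add: norm_pflux)
  moreover have "norm b powr p = norm b powr (p - 1) * norm b"
    using assms by (cases "b = 0") (auto simp: powr_diff)
  ultimately have "pflux p b \<bullet> (a - b) \<le> norm b powr (p - 1) * (norm a - norm b)"
    using assms by (simp add: inner_diff_right pflux_inner_self algebra_simps)
  then have "p * (pflux p b \<bullet> (a - b)) \<le> p * (norm b powr (p - 1) * (norm a - norm b))"
    using assms by (intro mult_left_mono) auto
  moreover have "norm a powr p \<ge> norm b powr p + p * norm b powr (p - 1) * (norm a - norm b)"
    by (rule powr_tangent(1)) (use assms in auto)
  ultimately show ?thesis unfolding mult.assoc by linarith
qed

text \<open>Young's inequality with a weight. It is the tangent inequality between \<open>b\<close> and the multiple
  \<open>s powr (- 1 / (p - 1))\<close> of \<open>a\<close>, multiplied by \<open>s\<close>.\<close>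

lemma pflux_young:
  fixes a b :: "'b::euclidean_space"
  assumes "1 < p" "0 < s"
  shows "p * (pflux p a \<bullet> b) \<le> s * norm b powr p + (p - 1) * s powr (- 1 / (p - 1)) * norm a powr p"
proof -
  define r where "r = s powr (- 1 / (p - 1))"
  have r: "r > 0" using assms by (simp add: r_def)
  have rs: "r powr (p - 1) = 1 / s"
  proof -
    have "r powr (p - 1) = s powr (- 1 / (p - 1) * (p - 1))" unfolding r_def powr_powr ..
    also have "- 1 / (p - 1) * (p - 1) = - 1" using assms by simp
    finally show ?thesis using assms by (simp add: powr_minus_divide)
  qed
  have rp: "s * r powr p = r"
    using rs r assms by (simp add: powr_diff field_simps)
  have "norm (r *\<^sub>R a) powr p + p * (pflux p (r *\<^sub>R a) \<bullet> (b - r *\<^sub>R a)) \<le> norm b powr p"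
    by (rule norm_powr_tangent) fact
  moreover have "pflux p (r *\<^sub>R a) \<bullet> (r *\<^sub>R a) = norm (r *\<^sub>R a) powr p"
    by (rule pflux_inner_self) fact
  moreover have "norm (r *\<^sub>R a) powr p = r powr p * norm a powr p" using r by (simp add: powr_mult)
  moreover have "pflux p (r *\<^sub>R a) \<bullet> b = 1 / s * (pflux p a \<bullet> b)"
    using pflux_scale[OF assms(1) r, of a] rs by simp
  ultimately have "p * (1 / s * (pflux p a \<bullet> b)) \<le> norm b powr p + (p - 1) * (r powr p * norm a powr p)"
    by (simp add: inner_diff_right algebra_simps)
  then have "s * (p * (1 / s * (pflux p a \<bullet> b))) \<le> s * (norm b powr p + (p - 1) * (r powr p * norm a powr p))"
    using assms by (intro mult_left_mono) auto
  also have "\<dots> = s * norm b powr p + (p - 1) * (s * r powr p) * norm a powr p" by (simp add: algebra_simps)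
  finally show ?thesis using assms rp unfolding r_def[symmetric] by simp
qed

lemma norm_add_powr_le:
  fixes a b :: "'b::real_normed_vector"
  assumes "0 < p"
  shows "norm (a + b) powr p \<le> 2 powr p * (norm a powr p + norm b powr p)"
proof -
  define m where "m = max (norm a) (norm b)"
  have "norm (a + b) \<le> 2 * m" unfolding m_def using norm_triangle_ineq[of a b] by linarith
  then have "norm (a + b) powr p \<le> (2 * m) powr p" using assms by (intro powr_mono2) auto
  also have "\<dots> = 2 powr p * m powr p" using assms by (simp add: powr_mult m_def)
  also have "m powr p \<le> norm a powr p + norm b powr p" unfolding m_def max_def by auto
  finally show ?thesis by simp
qed

definition convexity_defect :: "real \<Rightarrow> 'b::euclidean_space \<Rightarrow> 'b \<Rightarrow> real" where
  "convexity_defect p a b =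
     (norm a powr p + norm b powr p) / 2 - norm ((1/2) *\<^sub>R (a + b)) powr p"

text \<open>Unless \<open>a\<close>, \<open>b\<close> and their midpoint have the same norm, the tangent inequality at the midpoint is
  strict. If the three norms agree, the parallelogram law yields \<open>a = b\<close>.\<close>

lemma convexity_defect_pos:
  fixes a b :: "'b::euclidean_space"
  assumes "1 < p" "a \<noteq> b"
  shows "convexity_defect p a b > 0"
proof -
  define m where "m = norm ((1/2) *\<^sub>R (a + b))"
  have m2: "2 * m = norm (a + b)" by (simp add: m_def)
  have tri: "norm a + norm b \<ge> 2 * m" unfolding m2 by (rule norm_triangle_ineq)
  have ne: "norm a \<noteq> m \<or> norm b \<noteq> m"
  proof (rule ccontr)
    assume "\<not> ?thesis"
    then have e: "norm a = m" "norm b = m" by auto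
    have "(norm (a - b))\<^sup>2 + (norm (a + b))\<^sup>2 = 2 * (norm a)\<^sup>2 + 2 * (norm b)\<^sup>2"
      by (simp add: power2_norm_eq_inner inner_add_left inner_add_right inner_diff_left inner_diff_right inner_commute)
    then have "(norm (a - b))\<^sup>2 = 0" using e m2[symmetric] by (simp add: power2_eq_square)
    then show False using assms by simp
  qed
  have A: "norm a powr p \<ge> m powr p + p * m powr (p - 1) * (norm a - m)"
    and B: "norm b powr p \<ge> m powr p + p * m powr (p - 1) * (norm b - m)"
    by (rule powr_tangent(1); use assms in \<open>simp add: m_def\<close>)+
  have AB: "norm a powr p > m powr p + p * m powr (p - 1) * (norm a - m) \<or>
     norm b powr p > m powr p + p * m powr (p - 1) * (norm b - m)"
    using ne powr_tangent(2)[of p "norm a" m] powr_tangent(2)[of p "norm b" m] assms by (auto simp: m_def)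
  have "p * m powr (p - 1) * (norm a + norm b - 2 * m) \<ge> 0"
    using assms tri by (intro mult_nonneg_nonneg) auto
  then have S: "p * m powr (p - 1) * (norm a - m) + p * m powr (p - 1) * (norm b - m) \<ge> 0"
    by (simp add: algebra_simps)
  have "norm a powr p + norm b powr p > 2 * m powr p"
    using A B AB S by linarith
  then show ?thesis by (simp add: convexity_defect_def m_def)
qed

lemma convexity_defect_nonneg:
  fixes a b :: "'b::euclidean_space"
  assumes "1 < p" shows "convexity_defect p a b \<ge> 0"
proof (cases "a = b")
  case True
  have "(1 / 2) *\<^sub>R (b + b) = b" by (simp add: scaleR_2[symmetric])
  then show ?thesis using True by (simp add: convexity_defect_def del: norm_scaleR)
next
  case False
  then show ?thesis using convexity_defect_pos[OF assms False] by simp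
qed

text \<open>A quantitative form of strict convexity that covers all exponents at once, where Clarkson's
  inequalities distinguish \<open>p < 2\<close> from \<open>p \<ge> 2\<close>. By homogeneity it suffices to consider pairs on a
  sphere, which is compact; there the defect is bounded below wherever \<open>a\<close> and \<open>b\<close> are far apart.\<close>

lemma uniform_convexity:
  assumes "1 < p" "0 < \<eta>"
  shows "\<exists>K>0. \<forall>a b::'b::euclidean_space.
    norm (a - b) powr p \<le> \<eta> * (norm a powr p + norm b powr p) + K * convexity_defect p a b"
proof -
  let ?D = "\<lambda>z::'b\<times>'b. convexity_defect p (fst z) (snd z)"
  define T where "T = sphere (0::'b\<times>'b) 1 \<inter>
     {z. \<eta> * (norm (fst z) powr p + norm (snd z) powr p) \<le> norm (fst z - snd z) powr p}"
  have cp: "continuous_on UNIV (\<lambda>z. norm (f z) powr p)" if "continuous_on UNIV f"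
    for f :: "'b\<times>'b \<Rightarrow> 'b"
    using that assms by (intro continuous_on_powr' continuous_intros) auto
  have "closed {z. \<eta> * (norm (fst z) powr p + norm (snd z :: 'b) powr p) \<le> norm (fst z - snd z) powr p}"
    by (intro closed_Collect_le continuous_intros cp)
  then have compT: "compact T" unfolding T_def by (intro compact_Int_closed) auto
  have contD: "continuous_on T ?D"
    unfolding convexity_defect_def by (rule continuous_on_subset[OF _ subset_UNIV]) (intro continuous_intros cp; simp)
  have "\<exists>\<delta>>0. \<forall>z\<in>T. ?D z \<ge> \<delta>"
  proof (cases "T = {}")
    case False
    obtain z0 where z0: "z0 \<in> T" "\<And>z. z \<in> T \<Longrightarrow> ?D z0 \<le> ?D z"
      using continuous_attains_inf[OF compT False contD] by auto
    have "fst z0 \<noteq> snd z0"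
    proof
      assume e: "fst z0 = snd z0"
      then have "\<eta> * (norm (fst z0) powr p + norm (snd z0) powr p) \<le> 0" using z0 by (simp add: T_def)
      then have "norm (fst z0) powr p + norm (snd z0) powr p \<le> 0"
        using assms by (simp add: mult_le_0_iff)
      then have "norm (fst z0) powr p = 0" "norm (snd z0) powr p = 0"
        using powr_ge_zero[of "norm (fst z0)" p] powr_ge_zero[of "norm (snd z0)" p] by linarith+
      then have "z0 = 0" by (simp add: prod_eq_iff)
      then show False using z0 by (simp add: T_def)
    qed
    then have "?D z0 > 0" using convexity_defect_pos assms by blast
    then show ?thesis using z0 by blast
  qed (auto intro: exI[of _ 1])
  then obtain \<delta> where \<delta>: "\<delta> > 0" "\<And>z. z \<in> T \<Longrightarrow> \<delta> \<le> ?D z" by blast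
  define K where "K = 2 powr p * 2 / \<delta>"
  have "norm (a - b) powr p \<le> \<eta> * (norm a powr p + norm b powr p) + K * convexity_defect p a b" for a b :: 'b
  proof (cases "\<eta> * (norm a powr p + norm b powr p) < norm (a - b) powr p")
    case True
    define r where "r = norm (a, b)"
    have "(a, b) \<noteq> 0" using True assms by (auto simp: zero_prod_def)
    then have r: "r > 0" by (simp add: r_def)
    define a' b' where "a' = (1/r) *\<^sub>R a" and "b' = (1/r) *\<^sub>R b"
    have ab: "a = r *\<^sub>R a'" "b = r *\<^sub>R b'" using r by (auto simp: a'_def b'_def)
    have sc: "norm (r *\<^sub>R x) powr p = r powr p * norm x powr p" for x :: 'b
      using r by (simp add: powr_mult)
    have rp: "r powr p > 0" using r by simp
    have "(a', b') = (1/r) *\<^sub>R (a, b)" by (simp add: a'_def b'_def)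
    then have nz: "norm (a', b') = 1" using r by (simp add: r_def[symmetric] del: scaleR_Pair)
    have dif: "norm (a - b) powr p = r powr p * norm (a' - b') powr p"
      unfolding ab scaleR_diff_right[symmetric] sc ..
    have "r powr p * (\<eta> * (norm a' powr p + norm b' powr p)) \<le> r powr p * norm (a' - b') powr p"
      using True dif unfolding ab sc by (simp add: algebra_simps)
    then have "\<eta> * (norm a' powr p + norm b' powr p) \<le> norm (a' - b') powr p"
      using rp by simp
    then have "(a', b') \<in> T" using nz by (simp add: T_def)
    then have dd: "\<delta> \<le> convexity_defect p a' b'" using \<delta>(2)[of "(a', b')"] by simp
    have defect: "convexity_defect p a b = r powr p * convexity_defect p a' b'"
    proof -
      have "(1/2) *\<^sub>R (r *\<^sub>R a' + r *\<^sub>R b') = r *\<^sub>R ((1/2) *\<^sub>R (a' + b'))" by (simp add: algebra_simps)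
      then show ?thesis unfolding convexity_defect_def ab sc by (simp only: sc) (simp add: algebra_simps)
    qed
    have n1: "norm a' \<le> 1" "norm b' \<le> 1"
      using nz norm_fst_le[of "a'" "b'"] norm_snd_le[of "b'" "a'"] by simp_all
    have "norm (a' - b') \<le> 2" using n1 norm_triangle_ineq4[of a' b'] by linarith
    then have "norm (a' - b') powr p \<le> 2 powr p" using assms by (intro powr_mono2) auto
    also have "\<dots> \<le> 2 powr p * 2 / \<delta> * \<delta>" using \<delta> by simp
    also have "\<dots> \<le> K * convexity_defect p a' b'"
      unfolding K_def using dd \<delta> by (intro mult_left_mono) auto
    finally have "norm (a - b) powr p \<le> r powr p * (K * convexity_defect p a' b')"
      unfolding dif by (intro mult_left_mono) auto
    also have "\<dots> = K * convexity_defect p a b" by (simp add: defect)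
    finally show ?thesis using assms by (simp add: add_increasing)
  next
    case False
    have "K * convexity_defect p a b \<ge> 0"
      using convexity_defect_nonneg[OF assms(1)] \<delta>(1) unfolding K_def
      by (intro mult_nonneg_nonneg divide_nonneg_pos) auto
    then show ?thesis using False by simp
  qed
  moreover have "K > 0" using \<delta> by (simp add: K_def)
  ultimately show ?thesis by blast
qed

section \<open>p-integrable functions\<close>

text \<open>Fatou's lemma in the form in which a bound on energies survives almost everywhere convergence.\<close>

lemma Fatou_bound:
  fixes h :: "nat \<Rightarrow> 'a \<Rightarrow> real"
  assumes int: "\<And>k. integrable M (h k)" and nn: "\<And>k x. 0 \<le> h k x"
    and ae: "AE x in M. (\<lambda>k. h k x) \<longlonglongrightarrow> g x" and gm [measurable]: "g \<in> borel_measurable M"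
    and le: "eventually (\<lambda>k. (LINT x|M. h k x) \<le> C) sequentially"
  shows "integrable M g" "(LINT x|M. g x) \<le> C" "AE x in M. 0 \<le> g x"
proof -
  have [measurable]: "h k \<in> borel_measurable M" for k using int by auto
  show g0: "AE x in M. 0 \<le> g x"
    using ae by eventually_elim (use nn in \<open>auto intro!: LIMSEQ_le_const\<close>)
  obtain k0 where k0: "\<And>k. k \<ge> k0 \<Longrightarrow> (LINT x|M. h k x) \<le> C"
    using le unfolding eventually_sequentially by auto
  have C0: "0 \<le> C" using k0[of k0] nn by (auto intro: order_trans[OF integral_nonneg_AE[of "h k0" M]])
  have "(\<integral>\<^sup>+x. ennreal (g x) \<partial>M) = (\<integral>\<^sup>+x. liminf (\<lambda>k. ennreal (h k x)) \<partial>M)"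
    using ae by (intro nn_integral_cong_AE, eventually_elim)
      (auto intro!: lim_imp_Liminf[symmetric] tendsto_ennrealI)
  also have "\<dots> \<le> liminf (\<lambda>k. \<integral>\<^sup>+x. ennreal (h k x) \<partial>M)" by (intro nn_integral_liminf) simp
  also have "\<dots> = liminf (\<lambda>k. ennreal (LINT x|M. h k x))"
    using int nn by (simp add: nn_integral_eq_integral)
  also have "\<dots> \<le> ennreal C"
    by (intro Liminf_le) (auto simp: eventually_sequentially intro!: exI[of _ k0] ennreal_leI k0)
  finally have nnb: "(\<integral>\<^sup>+x. ennreal (g x) \<partial>M) \<le> ennreal C" .
  show gi: "integrable M g"
  proof (rule integrableI_bounded)
    have "(\<integral>\<^sup>+x. ennreal (norm (g x)) \<partial>M) = (\<integral>\<^sup>+x. ennreal (g x) \<partial>M)"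
      using g0 by (intro nn_integral_cong_AE) auto
    then show "(\<integral>\<^sup>+x. ennreal (norm (g x)) \<partial>M) < \<infinity>" using nnb ennreal_less_top le_less_trans
      by (simp add: le_less_trans)
  qed simp
  have "ennreal (LINT x|M. g x) \<le> ennreal C" using nnb nn_integral_eq_integral[OF gi g0] by simp
  then show "(LINT x|M. g x) \<le> C" using C0 by simp
qed

definition p_integrable :: "real \<Rightarrow> 'a measure \<Rightarrow> ('a \<Rightarrow> 'b::euclidean_space) \<Rightarrow> bool" where
  "p_integrable p M f \<longleftrightarrow> f \<in> borel_measurable M \<and> integrable M (\<lambda>x. norm (f x) powr p)"

lemma p_integrableD:
  assumes "p_integrable p M f"
  shows "f \<in> borel_measurable M" "integrable M (\<lambda>x. norm (f x) powr p)"
  using assms by (auto simp: p_integrable_def)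

lemma p_integrable_scaleR:
  assumes "p_integrable p M f"
  shows "p_integrable p M (\<lambda>x. c *\<^sub>R f x)"
  using assms unfolding p_integrable_def by (auto simp: powr_mult)

lemma p_integrable_add:
  assumes "0 < p" "p_integrable p M f" "p_integrable p M g"
  shows "p_integrable p M (\<lambda>x. f x + g x)"
proof -
  note [measurable] = assms(2,3)[THEN p_integrableD(1)]
  have "integrable M (\<lambda>x. 2 powr p * (norm (f x) powr p + norm (g x) powr p))"
    using assms(2,3)[THEN p_integrableD(2)] by simp
  then have "integrable M (\<lambda>x. norm (f x + g x) powr p)"
    by (rule Bochner_Integration.integrable_bound) (use norm_add_powr_le[OF assms(1)] in auto)
  then show ?thesis by (simp add: p_integrable_def)
qed

lemma p_integrable_diff:
  assumes "0 < p" "p_integrable p M f" "p_integrable p M g"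
  shows "p_integrable p M (\<lambda>x. f x - g x)"
  using p_integrable_add[OF assms(1,2) p_integrable_scaleR[OF assms(3), of "-1"]] by simp

lemma p_integrable_cong_AE:
  assumes "p_integrable p M f" "AE x in M. f x = g x" "g \<in> borel_measurable M"
  shows "p_integrable p M g"
proof -
  note [measurable] = assms(3) p_integrableD(1)[OF assms(1)]
  have "AE x in M. norm (g x) powr p = norm (f x) powr p" using assms(2) by eventually_elim simp
  then have "integrable M (\<lambda>x. norm (g x) powr p) \<longleftrightarrow> integrable M (\<lambda>x. norm (f x) powr p)"
    by (intro integrable_cong_AE) measurable
  then show ?thesis using assms by (simp add: p_integrable_def)
qed

lemma p_integral_cong_AE:
  assumes "p_integrable p M f" "p_integrable p M g" "AE x in M. f x = g x"
  shows "(LINT x|M. norm (f x) powr p) = (LINT x|M. norm (g x) powr p)"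
proof (rule integral_cong_AE)
  show "AE x in M. norm (f x) powr p = norm (g x) powr p" using assms(3) by eventually_elim simp
qed (use assms(1,2)[THEN p_integrableD(2)] in blast)+

lemma p_integral_add_le:
  assumes "0 < p" "p_integrable p M f" "p_integrable p M g"
  shows "(LINT x|M. norm (f x + g x) powr p)
    \<le> 2 powr p * ((LINT x|M. norm (f x) powr p) + (LINT x|M. norm (g x) powr p))"
proof -
  have "(LINT x|M. norm (f x + g x) powr p) \<le> (LINT x|M. 2 powr p * (norm (f x) powr p + norm (g x) powr p))"
    using p_integrable_add[OF assms] assms(2,3)
    by (intro integral_mono norm_add_powr_le assms(1)) (auto dest: p_integrableD)
  then show ?thesis using assms(2,3)[THEN p_integrableD(2)] by simp
qed

text \<open>Together with finiteness of the measure, this does the work of Hoelder's inequality: an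
  \<open>L\<^sup>1\<close>-norm is small once the integral of the \<open>p\<close>-th power is small.\<close>

lemma le_powr_split:
  fixes s e p :: real
  assumes "1 < p" "0 < e" "0 \<le> s"
  shows "s \<le> e + e powr (1 - p) * s powr p"
proof (cases "s \<le> e")
  case False
  then have "s > 0" "e < s" using assms by auto
  have "1 = e powr (1 - p) * e powr (p - 1)" using assms by (simp add: powr_add[symmetric])
  also have "\<dots> \<le> e powr (1 - p) * s powr (p - 1)"
    using assms \<open>e < s\<close> by (intro mult_left_mono powr_mono2) auto
  finally have "s * 1 \<le> s * (e powr (1 - p) * s powr (p - 1))" using \<open>s > 0\<close> by (intro mult_left_mono) auto
  also have "\<dots> = e powr (1 - p) * s powr p" using \<open>s > 0\<close> by (simp add: powr_diff)
  finally show ?thesis using assms by simp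
qed (use assms in \<open>simp add: add_increasing2\<close>)

lemma p_integrable_imp_integrable:
  assumes "1 < p" "finite_measure M" "p_integrable p M f"
  shows "integrable M f"
proof -
  interpret finite_measure M by fact
  note [measurable] = p_integrableD(1)[OF assms(3)]
  have "integrable M (\<lambda>x. 1 + norm (f x) powr p)" using p_integrableD(2)[OF assms(3)] by simp
  then show ?thesis
    by (rule Bochner_Integration.integrable_bound)
      (use le_powr_split[OF assms(1), of 1] in \<open>auto intro!: AE_I2 simp: \<close>)
qed

lemma L1_bound_from_p_integral:
  assumes "1 < p" "finite_measure M" "p_integrable p M f" "0 < e"
  shows "(LINT x|M. norm (f x)) \<le> e * measure M (space M) + e powr (1 - p) * (LINT x|M. norm (f x) powr p)"
proof -
  interpret finite_measure M by fact
  have "(LINT x|M. norm (f x)) \<le> (LINT x|M. e + e powr (1 - p) * norm (f x) powr p)"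
    using p_integrable_imp_integrable[OF assms(1-3)] p_integrableD(2)[OF assms(3)]
    by (intro integral_mono le_powr_split assms) auto
  then show ?thesis using p_integrableD(2)[OF assms(3)] by (simp add: mult.commute)
qed

lemma L1_tendsto_from_p_integral:
  assumes "1 < p" "finite_measure M" "\<And>k. p_integrable p M (f k)"
    and lim: "(\<lambda>k. LINT x|M. norm (f k x) powr p) \<longlonglongrightarrow> 0"
  shows "(\<lambda>k. LINT x|M. norm (f k x)) \<longlonglongrightarrow> 0"
proof (rule LIMSEQ_I)
  fix r :: real assume "0 < r"
  define e where "e = r / (2 * (measure M (space M) + 1))"
  have m: "measure M (space M) + 1 > 0" by (simp add: add_nonneg_pos)
  then have e: "e > 0" using \<open>0 < r\<close> by (simp add: e_def)
  have em: "e * measure M (space M) < r / 2"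
    using \<open>0 < r\<close> m by (simp add: e_def field_simps)
  have "(\<lambda>k. e * measure M (space M) + e powr (1 - p) * (LINT x|M. norm (f k x) powr p))
      \<longlonglongrightarrow> e * measure M (space M) + e powr (1 - p) * 0" by (intro tendsto_intros lim)
  then have "eventually (\<lambda>k. e * measure M (space M) + e powr (1 - p) * (LINT x|M. norm (f k x) powr p) < r) sequentially"
    by (rule order_tendstoD) (use em \<open>0 < r\<close> in auto)
  then have "eventually (\<lambda>k. (LINT x|M. norm (f k x)) < r) sequentially"
    by eventually_elim (use L1_bound_from_p_integral[OF assms(1-3) e] in \<open>auto intro: le_less_trans\<close>)
  then show "\<exists>no. \<forall>n\<ge>no. norm ((LINT x|M. norm (f n x)) - 0) < r"
    unfolding eventually_sequentially by simp
qed

text \<open>Completeness of \<open>L\<^sup>p\<close>: a fast Cauchy subsequence converges almost everywhere by the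
  Borel--Cantelli lemma, and Fatou's lemma turns this into convergence in the \<open>p\<close>-th mean.\<close>

lemma p_integrable_complete:
  fixes f :: "nat \<Rightarrow> 'a \<Rightarrow> 'b::euclidean_space"
  assumes p: "1 < p" and f: "\<And>k. p_integrable p M (f k)"
    and cau: "\<And>e. 0 < e \<Longrightarrow> \<exists>N. \<forall>m\<ge>N. \<forall>n\<ge>N. (LINT x|M. norm (f m x - f n x) powr p) < e"
  obtains g r where "p_integrable p M g" "strict_mono (r :: nat \<Rightarrow> nat)"
    "AE x in M. (\<lambda>k. f (r k) x) \<longlonglongrightarrow> g x"
    "(\<lambda>k. LINT x|M. norm (f k x - g x) powr p) \<longlonglongrightarrow> 0"
proof -
  note [measurable] = p_integrableD(1)[OF f]
  have int: "integrable M (\<lambda>x. norm (f m x - f n x) powr p)" for m n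
    using p_integrable_diff[OF _ f f] p by (auto dest: p_integrableD)
  define q where "q = (1/2::real) powr p"
  have q: "0 < q" "q < 1" using p powr_less_mono2[of p "1/2" 1] by (auto simp: q_def)
  have "\<forall>k. \<exists>N. \<forall>m\<ge>N. \<forall>n\<ge>N. (LINT x|M. norm (f m x - f n x) powr p) < (q * q) ^ k"
    using cau q by simp
  then obtain N where N: "\<And>k m n. m \<ge> N k \<Longrightarrow> n \<ge> N k \<Longrightarrow> (LINT x|M. norm (f m x - f n x) powr p) < (q * q) ^ k"
    by metis
  \<comment> \<open>\<open>q\<close> is the \<open>p\<close>-th power of \<open>1/2\<close>: consecutive members of the subsequence will differ by less than
    \<open>(1/2) ^ k\<close> outside a set of measure at most \<open>q ^ k\<close>.\<close>
  define r where "r = rec_nat (N 0) (\<lambda>k s. max (Suc s) (N (Suc k)))"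
  have r0: "r 0 = N 0" and rS: "r (Suc k) = max (Suc (r k)) (N (Suc k))" for k by (auto simp: r_def)
  have rN: "r k \<ge> N k" for k by (cases k) (auto simp: r0 rS)
  have sm: "strict_mono r" by (rule strict_mono_Suc_iff[THEN iffD2]) (auto simp: rS)
  have rN2: "r (Suc k) \<ge> N k" for k using rN[of k] strict_monoD[OF sm, of k "Suc k"] by simp
  define d where "d k x = norm (f (r (Suc k)) x - f (r k) x) powr p" for k x
  have di: "integrable M (d k)" for k unfolding d_def by (rule int)
  have d_nonneg: "0 \<le> d k x" for k x by (simp add: d_def)
  have [measurable]: "d k \<in> borel_measurable M" for k using di by auto
  define A where "A k = {x\<in>space M. d k x \<ge> q ^ k}" for k
  have Am [measurable]: "A k \<in> sets M" for k unfolding A_def by measurable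
  have mA: "measure M (A k) \<le> q ^ k" for k
  proof -
    have "measure M (A k) \<le> (LINT x|M. d k x) / q ^ k"
      unfolding A_def by (rule integral_Markov_inequality_measure[OF di, where A="{}"]) (simp_all add: d_nonneg q)
    also have "\<dots> \<le> (q * q) ^ k / q ^ k"
      using N[OF rN2 rN, of k] q unfolding d_def by (intro divide_right_mono) auto
    also have "\<dots> = q ^ k" using q by (simp add: power_mult_distrib)
    finally show ?thesis .
  qed
  have eA: "emeasure M (A k) < \<infinity>" for k
  proof -
    have "emeasure M (A k) \<le> ennreal ((1 / q ^ k) * (LINT x|M. d k x))"
      unfolding A_def by (rule integral_Markov_inequality[OF di]) (simp_all add: d_nonneg q)
    then show ?thesis by (simp add: le_less_trans)
  qed
  have "AE x in M. eventually (\<lambda>k. x \<in> space M - A k) sequentially"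
  proof (rule borel_cantelli_AE1[OF Am eA])
    have "summable (\<lambda>k. q ^ k)" using q by (intro summable_geometric) simp
    then show "summable (\<lambda>k. measure M (A k))"
      by (rule summable_comparison_test') (use mA in simp)
  qed
  then have AEc: "AE x in M. convergent (\<lambda>k. f (r k) x)"
  proof eventually_elim
    case (elim x)
    have step: "norm (f (r (Suc k)) x - f (r k) x) \<le> (1/2) ^ k" if "x \<in> space M - A k" for k
    proof -
      have "norm (f (r (Suc k)) x - f (r k) x) powr p < q ^ k" using that by (auto simp: A_def d_def)
      also have "q ^ k = ((1/2) ^ k) powr p"
      proof -
        have "((1/2) powr p) powr real k = ((1/2) powr real k) powr p"
          by (simp only: powr_powr mult.commute)
        then show ?thesis by (simp add: q_def powr_realpow)
      qed
      finally have "\<not> (1/2) ^ k \<le> norm (f (r (Suc k)) x - f (r k) x)"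
        using powr_mono2[of p "(1/2) ^ k" "norm (f (r (Suc k)) x - f (r k) x)"] p by auto
      then show ?thesis by simp
    qed
    have "eventually (\<lambda>k. norm (f (r (Suc k)) x - f (r k) x) \<le> (1/2) ^ k) sequentially"
      using elim by eventually_elim (rule step)
    then have "summable (\<lambda>k. f (r (Suc k)) x - f (r k) x)"
      by (rule summable_comparison_test_ev) (simp add: summable_geometric)
    then have "convergent (\<lambda>n. \<Sum>k<n. f (r (Suc k)) x - f (r k) x)" by (simp add: summable_iff_convergent)
    then have "convergent (\<lambda>n. f (r n) x - f (r 0) x)" by (simp only: sum_lessThan_telescope[of "\<lambda>k. f (r k) x"])
    then have "convergent (\<lambda>n. (f (r n) x - f (r 0) x) + f (r 0) x)" by (intro convergent_add convergent_const)
    then show ?case by simp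
  qed
  define g where "g x = lim (\<lambda>k. f (r k) x)" for x
  have gm [measurable]: "g \<in> borel_measurable M" unfolding g_def by measurable
  have AEg: "AE x in M. (\<lambda>k. f (r k) x) \<longlonglongrightarrow> g x"
    using AEc by eventually_elim (simp add: g_def convergent_LIMSEQ_iff)
  have fat: "integrable M (\<lambda>x. norm (f m x - g x) powr p) \<and> (LINT x|M. norm (f m x - g x) powr p) \<le> e"
    if e: "0 < e" and m: "\<And>n. n \<ge> N0 \<Longrightarrow> (LINT x|M. norm (f m x - f n x) powr p) < e" for m N0 e
  proof -
    have conv: "AE x in M. (\<lambda>k. norm (f m x - f (r k) x) powr p) \<longlonglongrightarrow> norm (f m x - g x) powr p"
      using AEg by eventually_elim (intro tendsto_powr' tendsto_intros; use p in simp)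
    have "eventually (\<lambda>k. (LINT x|M. norm (f m x - f (r k) x) powr p) \<le> e) sequentially"
      unfolding eventually_sequentially
      by (intro exI[of _ N0]) (use seq_suble[OF sm] order_trans in \<open>blast intro: less_imp_le m\<close>)
    then show ?thesis
      using Fatou_bound[of M "\<lambda>k x. norm (f m x - f (r k) x) powr p" "\<lambda>x. norm (f m x - g x) powr p" e]
        int conv by auto
  qed
  obtain N1 where N1: "\<And>m n. m \<ge> N1 \<Longrightarrow> n \<ge> N1 \<Longrightarrow> (LINT x|M. norm (f m x - f n x) powr p) < 1"
    using cau[of 1] by auto
  have "p_integrable p M (\<lambda>x. f N1 x - g x)"
    using fat[of 1 N1 N1] N1 by (auto simp: p_integrable_def)
  then have "p_integrable p M (\<lambda>x. f N1 x - (f N1 x - g x))"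
    by (rule p_integrable_diff[rotated 2]) (use f p in auto)
  moreover have "f N1 x - (f N1 x - g x) = g x" for x by simp
  ultimately have gp: "p_integrable p M g" by simp
  have lim: "(\<lambda>k. LINT x|M. norm (f k x - g x) powr p) \<longlonglongrightarrow> 0"
  proof (rule LIMSEQ_I)
    fix e :: real assume e: "0 < e"
    obtain N2 where N2: "\<And>m n. m \<ge> N2 \<Longrightarrow> n \<ge> N2 \<Longrightarrow> (LINT x|M. norm (f m x - f n x) powr p) < e / 2"
      using cau[of "e/2"] e by auto
    have "(LINT x|M. norm (f m x - g x) powr p) < e" if "m \<ge> N2" for m
      using fat[of "e/2" N2 m] N2[OF that] e by auto
    then show "\<exists>no. \<forall>n\<ge>no. norm ((LINT x|M. norm (f n x - g x) powr p) - 0) < e"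
      by (intro exI[of _ N2]) auto
  qed
  show ?thesis by (rule that[OF gp sm AEg lim])
qed

section \<open>Smooth functions and bump functions\<close>

lemma partial_deriv_eq: "(f has_derivative f') (at x) \<Longrightarrow> partial_deriv i f x = f' (axis i 1)"
  unfolding partial_deriv_def by (drule frechet_derivative_at) simp

lemma C_k_imp_continuous: "C_k k f \<Longrightarrow> continuous_on UNIV f"
  by (cases k) (auto intro!: continuous_at_imp_continuous_on differentiable_imp_continuous_within)

lemma C_k_Suc_imp_C_k: "C_k (Suc k) f \<Longrightarrow> C_k k f"
proof (induction k arbitrary: f)
  case 0
  then show ?case using C_k_imp_continuous[OF 0] by simp
qed auto

lemma C_k_const: "C_k k (\<lambda>x::real^'n::finite. c)"
proof (induction k arbitrary: c)
  case (Suc k)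
  have "partial_deriv i (\<lambda>x::real^'n. c) = (\<lambda>x. 0)" for i
    by (rule ext) (simp add: partial_deriv_eq[OF has_derivative_const])
  then show ?case using Suc.IH[of 0] by simp
qed simp

lemma C_k_add: "C_k k f \<Longrightarrow> C_k k g \<Longrightarrow> C_k k (\<lambda>x. f x + g x)"
proof (induction k arbitrary: f g)
  case 0
  then show ?case by (auto intro: continuous_intros)
next
  case (Suc k)
  have d: "(f has_derivative frechet_derivative f (at x)) (at x)"
    "(g has_derivative frechet_derivative g (at x)) (at x)" for x
    using Suc.prems by (auto simp: frechet_derivative_works[symmetric])
  have "partial_deriv i (\<lambda>x. f x + g x) = (\<lambda>x. partial_deriv i f x + partial_deriv i g x)" for i
    by (rule ext) (use partial_deriv_eq[OF has_derivative_add[OF d]] in \<open>simp add: partial_deriv_def\<close>)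
  then show ?case using Suc by (auto intro: differentiable_add)
qed

lemma C_k_mult: "C_k k f \<Longrightarrow> C_k k g \<Longrightarrow> C_k k (\<lambda>x. f x * g x)"
proof (induction k arbitrary: f g)
  case 0
  then show ?case by (auto intro: continuous_intros)
next
  case (Suc k)
  have d: "(f has_derivative frechet_derivative f (at x)) (at x)"
    "(g has_derivative frechet_derivative g (at x)) (at x)" for x
    using Suc.prems by (auto simp: frechet_derivative_works[symmetric])
  have "partial_deriv i (\<lambda>x. f x * g x) = (\<lambda>x. f x * partial_deriv i g x + partial_deriv i f x * g x)" for i
    by (rule ext) (use partial_deriv_eq[OF has_derivative_mult[OF d]] in \<open>simp add: partial_deriv_def\<close>)
  moreover have "C_k k f" "C_k k g" using Suc.prems by (auto intro: C_k_Suc_imp_C_k simp del: C_k.simps)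
  ultimately show ?case using Suc.prems by (auto intro!: differentiable_mult C_k_add Suc.IH)
qed

lemma C_k_prod: "finite I \<Longrightarrow> (\<And>i. i \<in> I \<Longrightarrow> C_k k (f i)) \<Longrightarrow> C_k k (\<lambda>x. \<Prod>i\<in>I. f i x)"
  by (induction I rule: finite_induct) (auto intro: C_k_const C_k_mult)

text \<open>For \<open>P = 1\<close> this is the standard function \<open>exp (- 1 / t)\<close> extended by zero. The polynomial factor
  makes the family closed under differentiation, so smoothness follows without computing higher
  derivatives.\<close>

definition flat_exp :: "real poly \<Rightarrow> real \<Rightarrow> real" where
  "flat_exp P t = (if 0 < t then poly P (1 / t) * exp (- (1 / t)) else 0)"

definition flat_exp_deriv :: "real poly \<Rightarrow> real poly" where
  "flat_exp_deriv P = [:0, 0, 1:] * (P - pderiv P)"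

lemma poly_times_exp_tendsto_0: "((\<lambda>s. poly P s * exp (- s)) \<longlongrightarrow> (0::real)) at_top"
proof -
  have "((\<lambda>s. \<Sum>i\<le>degree P. coeff P i * (s ^ i / exp s)) \<longlongrightarrow> (\<Sum>i\<le>degree P. coeff P i * 0)) at_top"
    by (intro tendsto_intros tendsto_power_div_exp_0)
  then show ?thesis
    by (simp add: poly_altdef sum_distrib_right exp_minus divide_inverse mult.assoc)
qed

lemma flat_exp_has_derivative: "(flat_exp P has_real_derivative flat_exp (flat_exp_deriv P) t) (at t)"
proof -
  consider "t > 0" | "t < 0" | "t = 0" by linarith
  then show ?thesis
  proof cases
    case 1
    have "((\<lambda>t. poly P (1 / t) * exp (- (1 / t))) has_real_derivative flat_exp (flat_exp_deriv P) t) (at t)"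
      using 1 by (auto intro!: derivative_eq_intros DERIV_chain2[OF poly_DERIV]
          simp: flat_exp_def flat_exp_deriv_def algebra_simps power2_eq_square divide_inverse)
    then show ?thesis
      by (rule has_field_derivative_transform_within_open[of _ _ _ "{0<..}"]) (use 1 in \<open>auto simp: flat_exp_def\<close>)
  next
    case 2
    have "((\<lambda>t. 0) has_real_derivative flat_exp (flat_exp_deriv P) t) (at t)"
      using 2 by (simp add: flat_exp_def)
    then show ?thesis
      by (rule has_field_derivative_transform_within_open[of _ _ _ "{..<0}"]) (use 2 in \<open>auto simp: flat_exp_def\<close>)
  next
    case 3
    have "((\<lambda>h. poly ([:0, 1:] * P) (inverse h) * exp (- inverse h)) \<longlongrightarrow> 0) (at_right 0)"
      by (rule filterlim_compose[OF poly_times_exp_tendsto_0 filterlim_inverse_at_top_right])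
    then have "((\<lambda>h. flat_exp P h / h) \<longlongrightarrow> 0) (at_right 0)"
      by (rule Lim_transform_eventually)
        (auto simp: eventually_at_right_field flat_exp_def divide_inverse intro!: exI[of _ 1])
    moreover have "((\<lambda>h. flat_exp P h / h) \<longlongrightarrow> 0) (at_left 0)"
      by (rule Lim_transform_eventually[OF tendsto_const])
        (auto simp: eventually_at_left_field flat_exp_def intro!: exI[of _ "-1"])
    ultimately have "((\<lambda>h. flat_exp P h / h) \<longlongrightarrow> 0) (at 0)" by (simp add: filterlim_split_at)
    then show ?thesis using 3 by (simp add: DERIV_def flat_exp_def)
  qed
qed

lemma C_k_flat_exp: "C_k k (\<lambda>x::real^'n::finite. flat_exp P (c * x $ i + d))"
proof (induction k arbitrary: P)
  case 0
  have "continuous_on UNIV (flat_exp P)"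
    using flat_exp_has_derivative DERIV_isCont by (blast intro: continuous_at_imp_continuous_on)
  then show ?case by (auto intro!: continuous_on_compose2[of UNIV "flat_exp P"] continuous_intros)
next
  case (Suc k)
  have d: "((\<lambda>x::real^'n. flat_exp P (c * x $ i + d)) has_derivative
     (\<lambda>v. (c * v $ i) * flat_exp (flat_exp_deriv P) (c * x $ i + d))) (at x)" for x
  proof -
    have "((\<lambda>x::real^'n. c * x $ i + d) has_derivative (\<lambda>v. c * v $ i)) (at x)"
      by (auto intro!: derivative_eq_intros bounded_linear_imp_has_derivative bounded_linear_vec_nth)
    from has_derivative_compose[OF this flat_exp_has_derivative[THEN has_field_derivative_imp_has_derivative]]
    show ?thesis by (simp add: mult.commute)
  qed
  have "partial_deriv j (\<lambda>x::real^'n. flat_exp P (c * x $ i + d)) =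
     (\<lambda>x. (if i = j then c else 0) * flat_exp (flat_exp_deriv P) (c * x $ i + d))" for j
    by (rule ext) (use partial_deriv_eq[OF d] in \<open>auto simp: axis_def\<close>)
  then show ?case using d by (auto intro!: C_k_mult C_k_const Suc simp: differentiable_def)
qed

definition bump :: "nat \<Rightarrow> real^'n::finite \<Rightarrow> real^'n \<Rightarrow> real^'n \<Rightarrow> real" where
  "bump m a b x = (\<Prod>i\<in>UNIV. flat_exp 1 (real m * x $ i + - real m * a $ i) *
      flat_exp 1 (- real m * x $ i + real m * b $ i))"

lemma flat_exp_1_bounds: "0 \<le> flat_exp 1 t" "flat_exp 1 t \<le> 1"
  by (auto simp: flat_exp_def)

lemma bump_bounds: "0 \<le> bump m a b x" "bump m a b x \<le> 1"
  unfolding bump_def by (auto intro!: prod_nonneg prod_le_1 mult_le_one flat_exp_1_bounds mult_nonneg_nonneg)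

lemma bump_eq_0: "x \<notin> box a b \<Longrightarrow> bump m a b x = 0"
proof -
  assume "x \<notin> box a b"
  then obtain i where "x $ i \<le> a $ i \<or> b $ i \<le> x $ i" by (auto simp: mem_box_cart not_less)
  then have "real m * x $ i + - real m * a $ i \<le> 0 \<or> - real m * x $ i + real m * b $ i \<le> 0"
    by (auto intro: mult_left_mono)
  then have "flat_exp 1 (real m * x $ i + - real m * a $ i) * flat_exp 1 (- real m * x $ i + real m * b $ i) = 0"
    by (auto simp: flat_exp_def)
  then show ?thesis unfolding bump_def by (intro prod_zero) auto
qed

lemma bump_tendsto: "(\<lambda>m. bump m a b x) \<longlonglongrightarrow> indicator (box a b) x"
proof (cases "x \<in> box a b")
  case True
  have lim: "(\<lambda>m. flat_exp 1 (real m * s)) \<longlonglongrightarrow> 1" if "s > 0" for s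
  proof -
    have "filterlim (\<lambda>m. real m * s) at_top sequentially"
      using that by (simp add: filterlim_at_top_mult_tendsto_pos[OF tendsto_const _ filterlim_real_sequentially])
    then have "(\<lambda>m. 1 / (real m * s)) \<longlonglongrightarrow> 0"
      by (intro tendsto_divide_0[OF tendsto_const]) (rule filterlim_at_top_imp_at_infinity)
    from tendsto_exp[OF tendsto_minus[OF this]]
    have "(\<lambda>m. exp (- (1 / (real m * s)))) \<longlonglongrightarrow> 1" by simp
    then show ?thesis
      by (rule Lim_transform_eventually)
        (use that in \<open>auto simp: flat_exp_def eventually_sequentially intro!: exI[of _ 1]\<close>)
  qed
  have "(\<lambda>m. \<Prod>i\<in>UNIV. flat_exp 1 (real m * (x $ i - a $ i)) * flat_exp 1 (real m * (b $ i - x $ i)))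
      \<longlonglongrightarrow> (\<Prod>i\<in>(UNIV::'a set). 1 * 1)"
    using True by (intro tendsto_prod tendsto_mult lim) (auto simp: mem_box_cart)
  then show ?thesis using True by (simp add: bump_def algebra_simps)
qed (simp add: bump_eq_0)

lemma bump_test_function:
  assumes "cbox a b \<subseteq> \<Omega>" shows "bump m a b \<in> test_functions \<Omega>"
proof -
  have "C_k k (bump m a b)" for k
    unfolding bump_def[abs_def] by (intro C_k_prod C_k_mult C_k_flat_exp) simp
  moreover have cl: "closure {x. bump m a b x \<noteq> 0} \<subseteq> cbox a b"
    using bump_eq_0 by (intro closure_minimal) (force intro: box_subset_cbox[THEN subsetD])+
  moreover have "compact (closure {x. bump m a b x \<noteq> 0})"
    using cl bounded_subset[OF bounded_cbox] by (simp add: compact_eq_bounded_closed)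
  ultimately show ?thesis using assms by (auto simp: test_functions_def)
qed

section \<open>The fundamental lemma of the calculus of variations\<close>

lemma continuous_imp_lebesgue_measurable:
  fixes f :: "'a::euclidean_space \<Rightarrow> 'b::euclidean_space"
  assumes "continuous_on UNIV f" shows "f \<in> borel_measurable lebesgue"
proof -
  have "f \<in> borel_measurable lborel" using borel_measurable_continuous_onI[OF assms] by simp
  then show ?thesis by (rule measurable_completion)
qed

lemma integrable_lebesgue_on_iff:
  fixes f :: "'a::euclidean_space \<Rightarrow> 'b::euclidean_space"
  assumes "S \<in> sets lebesgue"
  shows "integrable (lebesgue_on S) f \<longleftrightarrow> integrable lebesgue (\<lambda>x. indicator S x *\<^sub>R f x)"
  using assms by (simp add: integrable_restrict_space)

lemma locally_integrable_times_compact: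
  fixes f :: "real^'n::finite \<Rightarrow> real"
  assumes f: "locally_integrable \<Omega> f" and \<Omega>: "\<Omega> \<in> sets lebesgue"
    and K: "compact K" "K \<subseteq> \<Omega>" and g: "continuous_on UNIV g" "\<And>x. x \<notin> K \<Longrightarrow> g x = 0"
  shows "integrable (lebesgue_on \<Omega>) (\<lambda>x. f x * g x)"
proof -
  have Km: "K \<in> sets lebesgue" using K(1) by (simp add: borel_closed compact_imp_closed)
  have fK: "integrable lebesgue (\<lambda>x. indicator K x *\<^sub>R f x)"
    using f K integrable_lebesgue_on_iff[OF Km, of f] by (simp add: locally_integrable_def)
  have "bounded (g ` K)" using g(1) K(1) by (intro compact_imp_bounded compact_continuous_image) (auto intro: continuous_on_subset)
  then obtain B where B: "\<And>x. x \<in> K \<Longrightarrow> norm (g x) \<le> B" by (auto simp: bounded_iff)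
  have gm: "g \<in> borel_measurable lebesgue" using g(1) by (rule continuous_imp_lebesgue_measurable)
  have "integrable lebesgue (\<lambda>x. (indicator K x *\<^sub>R f x) * g x)"
  proof (rule Bochner_Integration.integrable_bound)
    show "integrable lebesgue (\<lambda>x. B * norm (indicator K x *\<^sub>R f x))" using fK by (intro integrable_mult_right integrable_norm)
    show "(\<lambda>x. (indicator K x *\<^sub>R f x) * g x) \<in> borel_measurable lebesgue"
      using fK gm by (intro borel_measurable_times) auto
    show "AE x in lebesgue. norm ((indicator K x *\<^sub>R f x) * g x) \<le> norm (B * norm (indicator K x *\<^sub>R f x))"
    proof (rule AE_I2)
      fix x
      show "norm ((indicator K x *\<^sub>R f x) * g x) \<le> norm (B * norm (indicator K x *\<^sub>R f x))"
      proof (cases "x \<in> K")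
        case True
        have "B \<ge> 0" using B[OF True] norm_ge_zero order_trans by blast
        have "\<bar>f x\<bar> * \<bar>g x\<bar> \<le> \<bar>f x\<bar> * B" using B[OF True] by (intro mult_left_mono) auto
        then show ?thesis using True \<open>B \<ge> 0\<close> by (simp add: abs_mult mult.commute)
      qed simp
    qed
  qed
  also have "(\<lambda>x. (indicator K x *\<^sub>R f x) * g x) = (\<lambda>x. indicator \<Omega> x *\<^sub>R (f x * g x))"
    using K(2) g(2) by (auto simp: fun_eq_iff indicator_def)
  finally show ?thesis using \<Omega> by (simp add: integrable_lebesgue_on_iff)
qed

text \<open>At almost every point, \<open>f\<close> is the limit of its averages over small cubes, which all vanish.\<close>

lemma AE_eq_0_if_box_integrals_0:
  fixes f :: "real^'n::finite \<Rightarrow> real"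
  assumes \<Omega>: "open \<Omega>" and f: "locally_integrable \<Omega> f"
    and zero: "\<And>a b. cbox a b \<subseteq> \<Omega> \<Longrightarrow> (LINT x|lebesgue_on (cbox a b). f x) = 0"
  shows "AE x in lebesgue_on \<Omega>. f x = 0"
proof -
  obtain D where D: "countable D" "\<And>X. X \<in> D \<Longrightarrow> X \<subseteq> \<Omega>" "\<And>X. X \<in> D \<Longrightarrow> \<exists>a b. X = cbox a b" "\<Union>D = \<Omega>"
    using open_countable_Union_open_cbox[OF \<Omega>] by (metis PowD subsetD)
  have "AE x in lebesgue. x \<in> X \<longrightarrow> f x = 0" if "X \<in> D" for X
  proof -
    obtain a b where X: "X = cbox a b" using D(3) \<open>X \<in> D\<close> by blast
    have sub: "cbox a b \<subseteq> \<Omega>" using D(2) \<open>X \<in> D\<close> X by blast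
    have int: "integrable (lebesgue_on (cbox c d)) f" if "cbox c d \<subseteq> \<Omega>" for c d
      using f that by (auto simp: locally_integrable_def)
    define g where "g x = (if x \<in> cbox a b then f x else 0)" for x
    have "f integrable_on cbox a b" using int[OF sub] by (intro integrable_on_lebesgue_on) auto
    then have gU: "g integrable_on UNIV" unfolding g_def by (simp add: integrable_restrict_UNIV)
    then have "g integrable_on cbox c d" for c d by (rule integrable_on_subcbox) simp
    then obtain N where N: "negligible N" "\<And>x e. x \<notin> N \<Longrightarrow> 0 < e \<Longrightarrow>
       \<exists>d>0. \<forall>h. 0 < h \<and> h < d \<longrightarrow> norm (integral (cbox x (x + h *\<^sub>R One)) g /\<^sub>R h ^ DIM(real^'n) - g x) < e"
      using integrable_ccontinuous_explicit[of g] by metis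
    have "f x = 0" if x: "x \<in> box a b" "x \<notin> N" for x
    proof (rule ccontr)
      assume "f x \<noteq> 0"
      have gx: "g x = f x" using x box_subset_cbox by (auto simp: g_def)
      obtain d where d: "d > 0" "\<And>h. 0 < h \<Longrightarrow> h < d \<Longrightarrow>
          norm (integral (cbox x (x + h *\<^sub>R One)) g /\<^sub>R h ^ DIM(real^'n) - g x) < \<bar>f x\<bar>"
        using N(2)[OF x(2), of "\<bar>f x\<bar>"] \<open>f x \<noteq> 0\<close> by auto
      have "((\<lambda>h. x + h *\<^sub>R One) \<longlongrightarrow> x + 0 *\<^sub>R One) (at_right (0::real))" by (intro tendsto_intros)
      then have "eventually (\<lambda>h. x + h *\<^sub>R One \<in> box a b) (at_right (0::real))"
        using x(1) by (intro topological_tendstoD) auto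
      then obtain e where e: "e > 0" "\<And>h. 0 < h \<Longrightarrow> h < e \<Longrightarrow> x + h *\<^sub>R One \<in> box a b"
        by (auto simp: eventually_at_right_field)
      define h where "h = min d e / 2"
      have h: "0 < h" "h < d" "h < e" using d(1) e(1) by (auto simp: h_def)
      have sub2: "cbox x (x + h *\<^sub>R One) \<subseteq> cbox a b"
        using x(1) e(2)[OF h(1,3)] by (simp add: subset_box mem_box less_imp_le)
      have "integral (cbox x (x + h *\<^sub>R One)) g = integral (cbox x (x + h *\<^sub>R One)) f"
        by (rule integral_cong) (use sub2 in \<open>auto simp: g_def\<close>)
      also have "\<dots> = (LINT x|lebesgue_on (cbox x (x + h *\<^sub>R One)). f x)"
        using int[of x "x + h *\<^sub>R One"] sub sub2 by (intro lebesgue_integral_eq_integral[symmetric]) auto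
      also have "\<dots> = 0" using zero sub sub2 by blast
      finally show False using d(2)[OF h(1,2)] gx by simp
    qed
    then have "{x. \<not> (x \<in> X \<longrightarrow> f x = 0)} \<subseteq> N \<union> (cbox a b - box a b)" using X by auto
    moreover have "negligible (N \<union> (cbox a b - box a b))"
      using N(1) by (intro negligible_Un negligible_frontier_interval)
    ultimately have "negligible {x. \<not> (x \<in> X \<longrightarrow> f x = 0)}" using negligible_subset by blast
    then show ?thesis by (intro AE_I'[of "{x. \<not> (x \<in> X \<longrightarrow> f x = 0)}"]) (auto simp: negligible_iff_null_sets)
  qed
  then have "AE x in lebesgue. \<forall>X\<in>D. x \<in> X \<longrightarrow> f x = 0" using D(1) by (intro AE_ball_countable[THEN iffD2] ballI)
  then have "AE x in lebesgue. x \<in> \<Omega> \<longrightarrow> f x = 0" by eventually_elim (use D(4) in blast)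
  then show ?thesis using \<Omega> by (simp add: AE_restrict_space_iff borel_open)
qed

text \<open>Bump functions converge boundedly to the indicator of a box, so the hypothesis passes from test
  functions to boxes.\<close>

lemma fundamental_lemma:
  fixes f :: "real^'n::finite \<Rightarrow> real"
  assumes \<Omega>: "open \<Omega>" and f: "locally_integrable \<Omega> f"
    and zero: "\<And>\<phi>. \<phi> \<in> test_functions \<Omega> \<Longrightarrow> (LINT x|lebesgue_on \<Omega>. f x * \<phi> x) = 0"
  shows "AE x in lebesgue_on \<Omega>. f x = 0"
proof (rule AE_eq_0_if_box_integrals_0[OF \<Omega> f])
  fix a b :: "real^'n" assume sub: "cbox a b \<subseteq> \<Omega>"
  have \<Omega>m: "\<Omega> \<in> sets lebesgue" using \<Omega> by (simp add: borel_open)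
  define F where "F x = indicator (cbox a b) x *\<^sub>R f x" for x
  have F: "integrable lebesgue F"
    unfolding F_def using f sub integrable_lebesgue_on_iff[of "cbox a b" f] by (simp add: locally_integrable_def)
  have bxm: "(indicator (box a b) :: _ \<Rightarrow> real) \<in> borel_measurable lebesgue"
    by (intro borel_measurable_indicator) (simp add: borel_open)
  have bm: "bump m a b \<in> borel_measurable lebesgue" for m
  proof -
    have "C_k 0 (bump m a b)" using bump_test_function[OF sub, of m] unfolding test_functions_def by blast
    then show ?thesis by (simp add: continuous_imp_lebesgue_measurable)
  qed
  have "(\<lambda>m. LINT x|lebesgue. F x * bump m a b x) \<longlonglongrightarrow> (LINT x|lebesgue. F x * indicator (box a b) x)"
  proof (rule integral_dominated_convergence)
    show "integrable lebesgue (\<lambda>x. norm (F x))" using F by simp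
    show "AE x in lebesgue. norm (F x * bump m a b x) \<le> norm (F x)" for m
    proof (rule AE_I2)
      fix x
      show "norm (F x * bump m a b x) \<le> norm (F x)"
        using mult_left_mono[OF bump_bounds(2)[of m a b x], of "\<bar>F x\<bar>"] bump_bounds(1)[of m a b x] by (simp add: abs_mult)
    qed
    show "AE x in lebesgue. (\<lambda>m. F x * bump m a b x) \<longlonglongrightarrow> F x * indicator (box a b) x"
      by (intro AE_I2 tendsto_intros bump_tendsto)
  qed (use F bm bxm in \<open>simp_all add: borel_measurable_integrable borel_measurable_times\<close>)
  moreover have "(LINT x|lebesgue. F x * bump m a b x) = 0" for m
  proof -
    have "(\<lambda>x. F x * bump m a b x) = (\<lambda>x. indicator \<Omega> x *\<^sub>R (f x * bump m a b x))"
    proof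
      fix x
      show "F x * bump m a b x = indicator \<Omega> x *\<^sub>R (f x * bump m a b x)"
        using bump_eq_0[of x a b m] sub box_subset_cbox[of a b]
        by (cases "x \<in> cbox a b") (auto simp: F_def)
    qed
    then have "(LINT x|lebesgue. F x * bump m a b x) = (LINT x|lebesgue_on \<Omega>. f x * bump m a b x)"
      using \<Omega>m by (simp add: integral_restrict_space)
    then show ?thesis using zero[OF bump_test_function[OF sub]] by simp
  qed
  ultimately have "(LINT x|lebesgue. F x * indicator (box a b) x) = 0"
    by (simp add: LIMSEQ_const_iff)
  moreover have "(LINT x|lebesgue. F x * indicator (box a b) x) = (LINT x|lebesgue. F x)"
  proof (rule integral_cong_AE)
    have "AE x in lebesgue. x \<notin> cbox a b - box a b"
      using negligible_frontier_interval[of a b] by (intro AE_not_in) (simp add: negligible_iff_null_sets)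
    then show "AE x in lebesgue. F x * indicator (box a b) x = F x"
      by eventually_elim (auto simp: F_def indicator_def)
  qed (use F bxm in \<open>simp_all add: borel_measurable_integrable borel_measurable_times\<close>)
  ultimately show "(LINT x|lebesgue_on (cbox a b). f x) = 0"
    by (simp add: F_def integral_restrict_space)
qed

section \<open>Integration by parts\<close>

text \<open>The integral of a difference quotient vanishes by translation invariance, and the quotients
  converge boundedly, on a bounded set, to the directional derivative.\<close>

lemma integral_directional_derivative:
  fixes h :: "'a::euclidean_space \<Rightarrow> real"
  assumes der: "\<And>x. (h has_derivative h' x) (at x)" and cont: "continuous_on UNIV (\<lambda>x. h' x v)"
    and bdd: "bounded {x. h x \<noteq> 0}"
  shows "integrable lborel (\<lambda>x. h' x v)" "(LINT x|lborel. h' x v) = 0"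
proof -
  obtain R where R: "\<And>x. h x \<noteq> 0 \<Longrightarrow> norm x \<le> R" using bdd by (auto simp: bounded_iff)
  define g where "g x = h' x v" for x
  have g0: "g x = 0" if "x \<notin> cball 0 R" for x
  proof -
    have "open (- cball (0::'a) R)" by (simp add: open_Compl)
    moreover have "((\<lambda>x. 0) has_derivative (\<lambda>v. 0)) (at x)" by simp
    ultimately have "(h has_derivative (\<lambda>v. 0)) (at x)"
      using that R by (subst has_derivative_transform_within_open[of "\<lambda>x. 0" _ _ _ "- cball 0 R"]) auto
    then have "h' x = (\<lambda>v. 0)" using has_derivative_unique[OF der] by blast
    then show ?thesis by (simp add: g_def)
  qed
  have hc: "continuous_on UNIV h"
    using der has_derivative_continuous by (blast intro: continuous_at_imp_continuous_on)
  have gc: "continuous_on UNIV g" using cont unfolding g_def by simp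
  have "bounded (g ` cball 0 R)" using gc by (intro compact_imp_bounded compact_continuous_image) (auto intro: continuous_on_subset)
  then obtain M0 where M0: "\<And>x. x \<in> cball 0 R \<Longrightarrow> norm (g x) \<le> M0" unfolding bounded_iff by blast
  define M where "M = max M0 0"
  have M: "\<bar>g x\<bar> \<le> M" for x using M0[of x] g0[of x] by (cases "x \<in> cball 0 R") (auto simp: M_def)
  have lineder: "((\<lambda>t. h (x + t *\<^sub>R v)) has_real_derivative g (x + t *\<^sub>R v)) (at t)" for x t
  proof -
    have "((\<lambda>t. x + t *\<^sub>R v) has_derivative (\<lambda>s. s *\<^sub>R v)) (at t)" by (auto intro!: derivative_eq_intros)
    from has_derivative_compose[OF this der]
    have "((\<lambda>t. h (x + t *\<^sub>R v)) has_derivative (\<lambda>s. h' (x + t *\<^sub>R v) (s *\<^sub>R v))) (at t)" .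
    moreover have "h' y (s *\<^sub>R v) = g y * s" for y s
      using linear_scale[OF has_derivative_linear[OF der[of y]]] by (simp add: g_def)
    ultimately show ?thesis by (simp add: has_field_derivative_def mult.commute[of _ "g _"])
  qed
  define t where "t k = inverse (real (Suc k))" for k
  have t: "0 < t k" "t k \<le> 1" for k by (auto simp: t_def field_simps)
  define D where "D k x = (h (x + t k *\<^sub>R v) - h x) / t k" for k x
  have hI: "integrable lborel h"
  proof -
    have "integrable lborel (\<lambda>x. indicator (cball 0 R) x *\<^sub>R h x)"
      using hc by (intro borel_integrable_compact) (auto intro: continuous_on_subset)
    moreover have "(\<lambda>x. indicator (cball 0 R) x *\<^sub>R h x) = h" using R by (auto simp: fun_eq_iff indicator_def)
    ultimately show ?thesis by simp
  qed
  have [measurable]: "h \<in> borel_measurable borel" "g \<in> borel_measurable borel"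
    using hc gc by (auto intro: borel_measurable_continuous_onI)
  have shift: "integrable lborel (\<lambda>x. h (x + c))" "(LINT x|lborel. h (x + c)) = (LINT x|lborel. h x)" for c
  proof -
    have eq: "lborel = distr lborel borel (\<lambda>x::'a. c + x)" by (simp add: lborel_distr_plus)
    have "integrable (distr lborel borel (\<lambda>x::'a. c + x)) h" using hI eq by simp
    then show "integrable lborel (\<lambda>x. h (x + c))" by (subst (asm) integrable_distr_eq) (auto simp: add.commute)
    have "(LINT x|lborel. h x) = (LINT x|distr lborel borel (\<lambda>x::'a. c + x). h x)" using eq by simp
    also have "\<dots> = (LINT x|lborel. h (c + x))" by (rule integral_distr) auto
    finally show "(LINT x|lborel. h (x + c)) = (LINT x|lborel. h x)" by (simp add: add.commute)
  qed
  have D0: "(LINT x|lborel. D k x) = 0" for k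
    unfolding D_def using shift[of "t k *\<^sub>R v"] hI by simp
  have Dlim: "(\<lambda>k. D k x) \<longlonglongrightarrow> g x" for x
  proof -
    have "((\<lambda>s. (h (x + s *\<^sub>R v) - h x) / s) \<longlongrightarrow> g x) (at 0)"
      using lineder[of x 0] by (simp add: DERIV_def)
    moreover have "filterlim t (at 0) sequentially"
    proof -
      have "t \<longlonglongrightarrow> 0" unfolding t_def by (rule LIMSEQ_inverse_real_of_nat)
      moreover have "t k \<noteq> 0" for k using t(1)[of k] by simp
      ultimately show ?thesis unfolding filterlim_at by simp
    qed
    ultimately show ?thesis unfolding D_def by (rule filterlim_compose)
  qed
  have Dbound: "norm (D k x) \<le> M * indicator (cball 0 (R + norm v)) x" for k x
  proof (cases "x \<in> cball 0 (R + norm v)")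
    case True
    obtain z where "h (x + t k *\<^sub>R v) - h (x + 0 *\<^sub>R v) = (t k - 0) * g (x + z *\<^sub>R v)"
      using MVT2[of 0 "t k" "\<lambda>s. h (x + s *\<^sub>R v)" "\<lambda>s. g (x + s *\<^sub>R v)"] lineder t by auto
    then have "D k x = g (x + z *\<^sub>R v)" using t[of k] by (simp add: D_def)
    then show ?thesis using M True by simp
  next
    case False
    then have n: "norm x > R + norm v" by simp
    have "norm (t k *\<^sub>R v) \<le> norm v" using t[of k] by (simp add: mult_left_le_one_le)
    then have "norm (x + t k *\<^sub>R v) > R" using n norm_diff_ineq[of x "t k *\<^sub>R v"] by linarith
    moreover have "norm x > R" using n norm_ge_zero[of v] by linarith
    ultimately have "h (x + t k *\<^sub>R v) = 0" "h x = 0" using R[of x] R[of "x + t k *\<^sub>R v"] by auto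
    then show ?thesis using False by (simp add: D_def)
  qed
  have "(\<lambda>k. LINT x|lborel. D k x) \<longlonglongrightarrow> (LINT x|lborel. g x)"
  proof (rule integral_dominated_convergence)
    show "integrable lborel (\<lambda>x. M * indicator (cball 0 (R + norm v)) (x::'a))"
      by (intro integrable_mult_right integrable_real_indicator) (use emeasure_bounded_finite[OF bounded_cball] in \<open>auto simp: infinity_ennreal_def\<close>)
  qed (use Dlim Dbound in \<open>auto simp: D_def\<close>)
  then show "(LINT x|lborel. h' x v) = 0"
    by (simp add: D0 LIMSEQ_const_iff g_def)
  have "integrable lborel (\<lambda>x. indicator (cball 0 R) x *\<^sub>R g x)"
    using gc by (intro borel_integrable_compact) (auto intro: continuous_on_subset)
  moreover have "(\<lambda>x. indicator (cball 0 R) x *\<^sub>R g x) = g" using g0 by (auto simp: fun_eq_iff indicator_def)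
  ultimately show "integrable lborel (\<lambda>x. h' x v)" unfolding g_def by simp
qed

lemma integral_lebesgue_on_eq_lborel:
  fixes f :: "'a::euclidean_space \<Rightarrow> real"
  assumes "continuous_on UNIV f" "S \<in> sets lebesgue" "\<And>x. x \<notin> S \<Longrightarrow> f x = 0"
  shows "(LINT x|lebesgue_on S. f x) = (LINT x|lborel. f x)"
    and "integrable lborel f \<Longrightarrow> integrable (lebesgue_on S) f"
proof -
  have eq: "(\<lambda>x. indicator S x *\<^sub>R f x) = f" using assms(3) by (auto simp: fun_eq_iff indicator_def)
  have fm: "f \<in> borel_measurable lborel" using assms(1) by (auto intro: borel_measurable_continuous_onI)
  have "(LINT x|lebesgue_on S. f x) = (LINT x|lebesgue. indicator S x *\<^sub>R f x)"
    using assms(2) by (intro integral_restrict_space) simp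
  then show "(LINT x|lebesgue_on S. f x) = (LINT x|lborel. f x)"
    unfolding eq integral_completion[OF fm] .
  show "integrable (lebesgue_on S) f" if "integrable lborel f"
    unfolding integrable_lebesgue_on_iff[OF assms(2)] eq using that fm by (simp add: integrable_completion)
qed

text \<open>As \<open>\<phi>\<close> vanishes outside \<open>S\<close>, all integrals may be taken over the whole space, where the
  derivative of \<open>\<psi> \<phi>\<close> integrates to zero.\<close>

lemma integral_by_parts:
  fixes \<psi> \<phi> :: "'a::euclidean_space \<Rightarrow> real"
  assumes S: "S \<in> sets lebesgue"
    and \<psi>: "\<And>x. (\<psi> has_derivative \<psi>' x) (at x)" "continuous_on UNIV (\<lambda>x. \<psi>' x v)"
    and \<phi>: "\<And>x. (\<phi> has_derivative \<phi>' x) (at x)" "continuous_on UNIV (\<lambda>x. \<phi>' x v)"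
    and bdd: "bounded {x. \<phi> x \<noteq> 0}" and vanish: "\<And>x. x \<notin> S \<Longrightarrow> \<phi> x = 0" "\<And>x. x \<notin> S \<Longrightarrow> \<phi>' x v = 0"
  shows "(LINT x|lebesgue_on S. \<psi> x * \<phi>' x v) = - (LINT x|lebesgue_on S. \<psi>' x v * \<phi> x)"
    and "integrable (lebesgue_on S) (\<lambda>x. \<psi> x * \<phi>' x v)"
    and "integrable (lebesgue_on S) (\<lambda>x. \<psi>' x v * \<phi> x)"
proof -
  have c: "continuous_on UNIV \<psi>" "continuous_on UNIV \<phi>"
    using \<psi>(1) \<phi>(1) has_derivative_continuous by (blast intro: continuous_at_imp_continuous_on)+
  have cp: "continuous_on UNIV (\<lambda>x. \<psi> x * \<phi>' x v)" "continuous_on UNIV (\<lambda>x. \<psi>' x v * \<phi> x)"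
    using c \<psi>(2) \<phi>(2) by (auto intro!: continuous_intros)
  have d: "((\<lambda>x. \<psi> x * \<phi> x) has_derivative (\<lambda>h. \<psi> x * \<phi>' x h + \<psi>' x h * \<phi> x)) (at x)" for x
    by (rule has_derivative_mult[OF \<psi>(1) \<phi>(1)])
  have b2: "bounded {x. \<psi> x * \<phi> x \<noteq> 0}" by (rule bounded_subset[OF bdd]) auto
  have I: "integrable lborel (\<lambda>x. \<psi> x * \<phi>' x v + \<psi>' x v * \<phi> x)"
    "(LINT x|lborel. \<psi> x * \<phi>' x v + \<psi>' x v * \<phi> x) = 0"
    using integral_directional_derivative[OF d continuous_on_add[OF cp] b2] by auto
  obtain R where R: "\<And>x. \<phi> x \<noteq> 0 \<Longrightarrow> norm x \<le> R" using bdd by (auto simp: bounded_iff)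
  have "integrable lborel (\<lambda>x. indicator (cball 0 R) x *\<^sub>R (\<psi>' x v * \<phi> x))"
    using cp by (intro borel_integrable_compact) (auto intro: continuous_on_subset)
  moreover have "(\<lambda>x. indicator (cball 0 R) x *\<^sub>R (\<psi>' x v * \<phi> x)) = (\<lambda>x. \<psi>' x v * \<phi> x)"
    using R by (auto simp: fun_eq_iff indicator_def)
  ultimately have I2: "integrable lborel (\<lambda>x. \<psi>' x v * \<phi> x)" by simp
  from Bochner_Integration.integrable_diff[OF I(1) I2]
  have I1: "integrable lborel (\<lambda>x. \<psi> x * \<phi>' x v)" by simp
  have "(LINT x|lborel. \<psi> x * \<phi>' x v) = - (LINT x|lborel. \<psi>' x v * \<phi> x)"
    using I(2) I1 I2 by simp
  then show "(LINT x|lebesgue_on S. \<psi> x * \<phi>' x v) = - (LINT x|lebesgue_on S. \<psi>' x v * \<phi> x)"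
    using integral_lebesgue_on_eq_lborel(1)[OF cp(1) S] integral_lebesgue_on_eq_lborel(1)[OF cp(2) S] vanish by simp
  show "integrable (lebesgue_on S) (\<lambda>x. \<psi> x * \<phi>' x v)" "integrable (lebesgue_on S) (\<lambda>x. \<psi>' x v * \<phi> x)"
    using integral_lebesgue_on_eq_lborel(2)[OF cp(1) S _ I1] integral_lebesgue_on_eq_lborel(2)[OF cp(2) S _ I2] vanish by auto
qed

section \<open>Sobolev functions on a bounded domain\<close>

text \<open>Since a weak gradient is chosen arbitrarily among its versions, its measurability on the domain
  rests on the completeness of Lebesgue measure.\<close>

lemma borel_measurable_lebesgue_on_cong_AE:
  fixes f g :: "'a::euclidean_space \<Rightarrow> 'b::euclidean_space"
  assumes "S \<in> sets lebesgue" "f \<in> borel_measurable (lebesgue_on S)" "AE x in lebesgue_on S. f x = g x"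
  shows "g \<in> borel_measurable (lebesgue_on S)"
proof -
  have "(\<lambda>x. indicator S x *\<^sub>R f x) \<in> borel_measurable lebesgue"
    using assms(1,2) by (simp add: borel_measurable_restrict_space_iff)
  moreover have "AE x in lebesgue. indicator S x *\<^sub>R f x = indicator S x *\<^sub>R g x"
  proof -
    have "AE x in lebesgue. x \<in> S \<longrightarrow> f x = g x" using assms(1,3) by (simp add: AE_restrict_space_iff)
    then show ?thesis by eventually_elim (auto simp: indicator_def)
  qed
  ultimately have "(\<lambda>x. indicator S x *\<^sub>R g x) \<in> borel_measurable lebesgue" by (rule borel_measurable_AE)
  then show ?thesis using assms(1) by (simp add: borel_measurable_restrict_space_iff)
qed

lemma frechet_derivative_eq_inner:
  fixes f :: "real^'n::finite \<Rightarrow> real"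
  assumes "f differentiable (at x)"
  shows "(f has_derivative (\<lambda>v. (\<chi> i. partial_deriv i f x) \<bullet> v)) (at x)"
proof -
  have d: "(f has_derivative frechet_derivative f (at x)) (at x)"
    using assms by (simp add: frechet_derivative_works)
  have lin: "linear (frechet_derivative f (at x))" using has_derivative_linear[OF d] .
  have "frechet_derivative f (at x) v = (\<chi> i. partial_deriv i f x) \<bullet> v" for v
  proof -
    have "v = (\<Sum>i\<in>UNIV. v $ i *\<^sub>R axis i 1)"
      by (simp add: vec_eq_iff axis_def if_distrib cong: if_cong)
    then have "frechet_derivative f (at x) v = frechet_derivative f (at x) (\<Sum>i\<in>UNIV. v $ i *\<^sub>R axis i 1)" by simp
    also have "\<dots> = (\<Sum>i\<in>UNIV. v $ i * partial_deriv i f x)"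
      by (simp add: linear_sum[OF lin] linear_scale[OF lin] partial_deriv_def)
    also have "\<dots> = (\<chi> i. partial_deriv i f x) \<bullet> v" by (simp add: inner_vec_def mult.commute)
    finally show ?thesis .
  qed
  then have "frechet_derivative f (at x) = (\<lambda>v. (\<chi> i. partial_deriv i f x) \<bullet> v)" by (rule ext)
  then show ?thesis using d by simp
qed

lemma test_functionD:
  assumes "\<phi> \<in> test_functions \<Omega>"
  shows "continuous_on UNIV \<phi>" "\<phi> differentiable (at x)" "continuous_on UNIV (partial_deriv i \<phi>)"
    "compact (closure {x. \<phi> x \<noteq> 0})" "closure {x. \<phi> x \<noteq> 0} \<subseteq> \<Omega>"
    "x \<notin> closure {x. \<phi> x \<noteq> 0} \<Longrightarrow> \<phi> x = 0"
    "x \<notin> closure {x. \<phi> x \<noteq> 0} \<Longrightarrow> partial_deriv i \<phi> x = 0"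
    "bounded {x. \<phi> x \<noteq> 0}" "x \<notin> \<Omega> \<Longrightarrow> \<phi> x = 0" "x \<notin> \<Omega> \<Longrightarrow> partial_deriv i \<phi> x = 0"
proof -
  define K where "K = closure {x. \<phi> x \<noteq> 0}"
  have C: "C_k (Suc 0) \<phi>" "C_k 0 \<phi>" using assms unfolding test_functions_def by blast+
  then show "continuous_on UNIV \<phi>" "\<phi> differentiable (at x)" "continuous_on UNIV (partial_deriv i \<phi>)"
    by simp_all
  have K: "compact K" "K \<subseteq> \<Omega>"
    using assms unfolding test_functions_def K_def by blast+
  then show "compact (closure {x. \<phi> x \<noteq> 0})" "closure {x. \<phi> x \<noteq> 0} \<subseteq> \<Omega>"
    by (simp_all only: K_def)
  have z: "\<phi> y = 0" if "y \<notin> K" for y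
    using that closure_subset[of "{x. \<phi> x \<noteq> 0}"] unfolding K_def by blast
  have dz: "partial_deriv i \<phi> y = 0" if "y \<notin> K" for y
  proof -
    have "open (- K)" using K(1) by (simp add: compact_imp_closed open_Compl)
    then have "(\<phi> has_derivative (\<lambda>v. 0)) (at y)"
      by (rule has_derivative_transform_within_open[OF has_derivative_const]) (use that z in simp_all)
    from partial_deriv_eq[OF this] show ?thesis .
  qed
  show "x \<notin> closure {x. \<phi> x \<noteq> 0} \<Longrightarrow> \<phi> x = 0"
    "x \<notin> closure {x. \<phi> x \<noteq> 0} \<Longrightarrow> partial_deriv i \<phi> x = 0"
    using z[of x] dz[of x] unfolding K_def by iprover+
  show "bounded {x. \<phi> x \<noteq> 0}"
    by (rule bounded_subset[OF compact_imp_bounded[OF K(1)]]) (simp only: K_def closure_subset)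
  show "\<phi> x = 0" "partial_deriv i \<phi> x = 0" if "x \<notin> \<Omega>"
    using z[of x] dz[of x] K(2) that by blast+
qed

lemma test_functions_lincomb:
  assumes "\<phi> \<in> test_functions \<Omega>" "\<psi> \<in> test_functions \<Omega>"
  shows "(\<lambda>x. \<phi> x + c * \<psi> x) \<in> test_functions \<Omega>"
proof -
  have "C_k k (\<lambda>x. \<phi> x + c * \<psi> x)" for k
    using assms unfolding test_functions_def by (intro C_k_add C_k_mult C_k_const) auto
  moreover have sub: "closure {x. \<phi> x + c * \<psi> x \<noteq> 0} \<subseteq> closure {x. \<phi> x \<noteq> 0} \<union> closure {x. \<psi> x \<noteq> 0}"
    unfolding closure_Un[symmetric] by (intro closure_mono) auto
  moreover have "compact (closure {x. \<phi> x + c * \<psi> x \<noteq> 0})"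
    using compact_Int_closed[OF compact_Un[OF test_functionD(4)[OF assms(1)] test_functionD(4)[OF assms(2)]] closed_closure,
        of "{x. \<phi> x + c * \<psi> x \<noteq> 0}"] sub by (simp add: Int_absorb1)
  ultimately show ?thesis using assms unfolding test_functions_def by blast
qed

lemma zero_test_function: "(\<lambda>x. 0) \<in> test_functions \<Omega>"
  by (simp add: test_functions_def C_k_const)

lemma has_weak_gradient_lincomb:
  assumes \<Omega>: "\<Omega> \<in> sets lebesgue" and "has_weak_gradient \<Omega> u G" "has_weak_gradient \<Omega> v H"
  shows "has_weak_gradient \<Omega> (\<lambda>x. u x + c * v x) (\<lambda>x. G x + c *\<^sub>R H x)"
proof -
  have li: "locally_integrable \<Omega> u" "locally_integrable \<Omega> v" "locally_integrable \<Omega> G" "locally_integrable \<Omega> H"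
    using assms by (auto simp: has_weak_gradient_def)
  have lic: "locally_integrable \<Omega> (\<lambda>x. F x $ i)" if "locally_integrable \<Omega> F" for F :: "_ \<Rightarrow> real^'n" and i
    using that unfolding locally_integrable_def cart_eq_inner_axis by (auto intro: integrable_inner_left)
  have "locally_integrable \<Omega> (\<lambda>x. u x + c * v x)" "locally_integrable \<Omega> (\<lambda>x. G x + c *\<^sub>R H x)"
    using li unfolding locally_integrable_def by auto
  moreover have "(LINT x|lebesgue_on \<Omega>. (u x + c * v x) * partial_deriv i \<phi> x) =
        - (LINT x|lebesgue_on \<Omega>. (G x + c *\<^sub>R H x) $ i * \<phi> x)" if \<phi>: "\<phi> \<in> test_functions \<Omega>" for \<phi> i
  proof -
    note t = test_functionD[OF \<phi>]
    have I: "integrable (lebesgue_on \<Omega>) (\<lambda>x. f x * partial_deriv i \<phi> x)" "integrable (lebesgue_on \<Omega>) (\<lambda>x. f x * \<phi> x)"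
      if "locally_integrable \<Omega> f" for f
      by (rule locally_integrable_times_compact[OF that \<Omega> t(4,5)]; use t in blast)+
    have "(LINT x|lebesgue_on \<Omega>. (u x + c * v x) * partial_deriv i \<phi> x) =
       (LINT x|lebesgue_on \<Omega>. u x * partial_deriv i \<phi> x) + c * (LINT x|lebesgue_on \<Omega>. v x * partial_deriv i \<phi> x)"
      using I(1)[OF li(1)] I(1)[OF li(2)] by (simp add: distrib_right mult.assoc)
    also have "\<dots> = - (LINT x|lebesgue_on \<Omega>. G x $ i * \<phi> x) + c * - (LINT x|lebesgue_on \<Omega>. H x $ i * \<phi> x)"
      using assms \<phi> by (simp add: has_weak_gradient_def)
    also have "\<dots> = - (LINT x|lebesgue_on \<Omega>. (G x + c *\<^sub>R H x) $ i * \<phi> x)"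
      using I(2)[OF lic[OF li(3)], of i] I(2)[OF lic[OF li(4)], of i] by (simp add: distrib_right mult.assoc)
    finally show ?thesis .
  qed
  ultimately show ?thesis by (simp add: has_weak_gradient_def)
qed

text \<open>The difference of two weak gradients is a weak gradient of zero, and the fundamental lemma applies
  to each of its components.\<close>

lemma has_weak_gradient_unique:
  fixes \<Omega> :: "(real^'n::finite) set"
  assumes \<Omega>: "open \<Omega>" and "has_weak_gradient \<Omega> u G" "has_weak_gradient \<Omega> u H"
  shows "AE x in lebesgue_on \<Omega>. G x = H x"
proof -
  have \<Omega>m: "\<Omega> \<in> sets lebesgue" using \<Omega> by (simp add: borel_open)
  have "has_weak_gradient \<Omega> (\<lambda>x. u x + (-1) * u x) (\<lambda>x. G x + (-1) *\<^sub>R H x)"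
    by (rule has_weak_gradient_lincomb) fact+
  then have w: "has_weak_gradient \<Omega> (\<lambda>x. 0) (\<lambda>x. G x - H x)" by simp
  have "AE x in lebesgue_on \<Omega>. (G x - H x) $ i = 0" for i
  proof (rule fundamental_lemma[OF \<Omega>])
    show "locally_integrable \<Omega> (\<lambda>x. (G x - H x) $ i)"
      using w unfolding has_weak_gradient_def locally_integrable_def cart_eq_inner_axis
      by (auto intro: integrable_inner_left)
    show "(LINT x|lebesgue_on \<Omega>. (G x - H x) $ i * \<phi> x) = 0" if "\<phi> \<in> test_functions \<Omega>" for \<phi>
    proof -
      have "(LINT x|lebesgue_on \<Omega>. 0 * partial_deriv i \<phi> x) = - (LINT x|lebesgue_on \<Omega>. (G x - H x) $ i * \<phi> x)"
        using w that unfolding has_weak_gradient_def by blast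
      then show ?thesis by simp
    qed
  qed
  then have "AE x in lebesgue_on \<Omega>. \<forall>i. (G x - H x) $ i = 0" by (simp add: AE_all_countable)
  then show ?thesis by eventually_elim (simp add: vec_eq_iff)
qed

lemma integral_mult_bounded_tendsto:
  fixes f :: "nat \<Rightarrow> 'a \<Rightarrow> real"
  assumes "1 < p" "finite_measure M" "\<And>k. p_integrable p M (f k)" "p_integrable p M g"
    and lim: "(\<lambda>k. LINT x|M. norm (f k x - g x) powr p) \<longlonglongrightarrow> 0"
    and h: "h \<in> borel_measurable M" "\<And>x. x \<in> space M \<Longrightarrow> \<bar>h x\<bar> \<le> B"
  shows "(\<lambda>k. LINT x|M. f k x * h x) \<longlonglongrightarrow> (LINT x|M. g x * h x)"
proof -
  note [measurable] = h(1)
  have Fi: "integrable M F" if "p_integrable p M F" for F :: "'a \<Rightarrow> real"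
    by (rule p_integrable_imp_integrable[OF assms(1,2) that])
  have d: "p_integrable p M (\<lambda>x. f k x - g x)" for k using assms by (intro p_integrable_diff) auto
  have ih: "integrable M (\<lambda>x. F x * h x)" if "integrable M F" for F
  proof (rule Bochner_Integration.integrable_bound)
    show "integrable M (\<lambda>x. \<bar>B\<bar> * norm (F x))" using that by simp
    show "AE x in M. norm (F x * h x) \<le> norm (\<bar>B\<bar> * norm (F x))"
    proof (rule AE_I2)
      fix x assume "x \<in> space M"
      then have "\<bar>F x\<bar> * \<bar>h x\<bar> \<le> \<bar>F x\<bar> * \<bar>B\<bar>" using h(2)[of x] by (intro mult_left_mono) auto
      then show "norm (F x * h x) \<le> norm (\<bar>B\<bar> * norm (F x))" by (simp add: abs_mult mult.commute)
    qed
  qed (use that in measurable)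
  have bound: "norm ((LINT x|M. f k x * h x) - (LINT x|M. g x * h x)) \<le> \<bar>B\<bar> * (LINT x|M. norm (f k x - g x))" for k
  proof -
    have "(LINT x|M. f k x * h x) - (LINT x|M. g x * h x) = (LINT x|M. (f k x - g x) * h x)"
      using ih[OF Fi[OF assms(3)]] ih[OF Fi[OF assms(4)]] by (simp add: left_diff_distrib)
    also have "norm \<dots> \<le> (LINT x|M. norm ((f k x - g x) * h x))" by (rule integral_norm_bound)
    also have "\<dots> \<le> (LINT x|M. \<bar>B\<bar> * norm (f k x - g x))"
    proof (rule integral_mono)
      show "integrable M (\<lambda>x. norm ((f k x - g x) * h x))" using ih[OF Fi[OF d]] by (rule integrable_norm)
      show "integrable M (\<lambda>x. \<bar>B\<bar> * norm (f k x - g x))" using Fi[OF d] by simp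
      show "norm ((f k x - g x) * h x) \<le> \<bar>B\<bar> * norm (f k x - g x)" if "x \<in> space M" for x
        using mult_left_mono[of "\<bar>h x\<bar>" "\<bar>B\<bar>" "\<bar>f k x - g x\<bar>"] h(2)[OF that] by (simp add: abs_mult mult.commute)
    qed
    finally show ?thesis by simp
  qed
  have "(\<lambda>k. \<bar>B\<bar> * (LINT x|M. norm (f k x - g x))) \<longlonglongrightarrow> \<bar>B\<bar> * 0"
    by (intro tendsto_intros L1_tendsto_from_p_integral[OF assms(1,2) d lim])
  then have "(\<lambda>k. \<bar>B\<bar> * (LINT x|M. norm (f k x - g x))) \<longlonglongrightarrow> 0" by simp
  with always_eventually[OF allI[OF bound]]
  have "(\<lambda>k. (LINT x|M. f k x * h x) - (LINT x|M. g x * h x)) \<longlonglongrightarrow> 0"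
    by (rule Lim_null_comparison)
  then show ?thesis by (rule LIM_zero_cancel)
qed

lemma abs_powr_has_derivative:
  assumes "1 < p"
  shows "((\<lambda>s::real. \<bar>s\<bar> powr p) has_real_derivative p * pflux p s) (at s)"
proof -
  consider "s > 0" | "s < 0" | "s = 0" by linarith
  then show ?thesis
  proof cases
    case 1
    have "((\<lambda>s. s powr p) has_real_derivative p * pflux p s) (at s)"
      using 1 by (auto intro!: derivative_eq_intros simp: pflux_def powr_diff power2_eq_square)
    then show ?thesis
      by (rule has_field_derivative_transform_within_open[of _ _ _ "{0<..}"]) (use 1 in auto)
  next
    case 2
    have "((\<lambda>s. (- s) powr p) has_real_derivative p * pflux p s) (at s)"
      using 2 by (auto intro!: derivative_eq_intros simp: pflux_def powr_diff power2_eq_square field_simps)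
    then show ?thesis
      by (rule has_field_derivative_transform_within_open[of _ _ _ "{..<0}"]) (use 2 in auto)
  next
    case 3
    have "((\<lambda>h::real. pflux p h) \<longlongrightarrow> 0) (at 0)"
    proof -
      have "pflux p (0::real) = 0" by (simp add: pflux_def)
      then show ?thesis using continuous_pflux[OF assms, of "0::real"] by (simp add: isCont_def)
    qed
    then have "((\<lambda>h::real. \<bar>h\<bar> powr p / h) \<longlongrightarrow> 0) (at 0)"
    proof (rule Lim_transform_eventually)
      have "pflux p h = \<bar>h\<bar> powr p / h" if "h \<noteq> 0" for h :: real
        using pflux_inner_self[OF assms, of h] that by (simp add: field_simps)
      then show "eventually (\<lambda>h::real. pflux p h = \<bar>h\<bar> powr p / h) (at 0)"
        by (simp add: eventually_at_filter)
    qed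
    then show ?thesis using 3 by (simp add: DERIV_def pflux_def)
  qed
qed

locale bounded_domain =
  fixes p :: real and \<Omega> :: "(real^'n::finite) set"
  assumes p_gt_1: "1 < p" and open_domain: "open \<Omega>" and bounded_domain: "bounded \<Omega>"
begin

abbreviation M :: "(real^'n) measure" where "M \<equiv> lebesgue_on \<Omega>"
abbreviation grad :: "(real^'n \<Rightarrow> real) \<Rightarrow> real^'n \<Rightarrow> real^'n" where "grad \<equiv> weak_gradient \<Omega>"
abbreviation W where "W \<equiv> sobolev p \<Omega>"
abbreviation W0 where "W0 \<equiv> sobolev_0 p \<Omega>"

lemma domain_sets [simp]: "\<Omega> \<in> sets lebesgue"
  using open_domain by (simp add: borel_open)

lemma p_pos: "0 < p" using p_gt_1 by simp

lemma finite_M: "finite_measure M"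
  using bounded_domain by (intro finite_measure_lebesgue_on bounded_set_imp_lmeasurable) simp_all

lemma Lp_fun_iff: "f \<in> Lp_fun p \<Omega> \<longleftrightarrow> p_integrable p M f"
  by (simp add: Lp_fun_def p_integrable_def)

lemma p_integrable_locally_integrable:
  assumes "p_integrable p M f" shows "locally_integrable \<Omega> f"
  unfolding locally_integrable_def
proof (intro allI impI)
  fix K assume K: "compact K \<and> K \<subseteq> \<Omega>"
  then have Km: "K \<in> sets lebesgue" by (simp add: borel_closed compact_imp_closed)
  have "integrable lebesgue (\<lambda>x. indicator \<Omega> x *\<^sub>R f x)"
    using p_integrable_imp_integrable[OF p_gt_1 finite_M assms] by (simp add: integrable_lebesgue_on_iff)
  from integrable_mult_indicator[OF Km this]
  have "integrable lebesgue (\<lambda>x. indicator K x *\<^sub>R (indicator \<Omega> x *\<^sub>R f x))" .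
  also have "(\<lambda>x. indicator K x *\<^sub>R (indicator \<Omega> x *\<^sub>R f x)) = (\<lambda>x. indicator K x *\<^sub>R f x)"
    using K by (auto simp: fun_eq_iff indicator_def)
  finally show "integrable (lebesgue_on K) f" using integrable_lebesgue_on_iff[OF Km] by blast
qed

lemma weak_gradient_eq:
  assumes "has_weak_gradient \<Omega> u G"
  shows "has_weak_gradient \<Omega> u (grad u)" "AE x in M. grad u x = G x"
proof -
  show "has_weak_gradient \<Omega> u (grad u)" unfolding weak_gradient_def using assms by (rule someI[where P="has_weak_gradient \<Omega> u"])
  then show "AE x in M. grad u x = G x" using has_weak_gradient_unique open_domain assms by blast
qed

lemma sobolevI:
  assumes "p_integrable p M u" "p_integrable p M G" "has_weak_gradient \<Omega> u G"
  shows "u \<in> W"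
  using assms by (auto simp: sobolev_def Lp_fun_iff)

lemma sobolevD:
  assumes "u \<in> W"
  shows "p_integrable p M u" "p_integrable p M (grad u)" "has_weak_gradient \<Omega> u (grad u)"
proof -
  obtain G where G: "p_integrable p M G" "has_weak_gradient \<Omega> u G" and "p_integrable p M u"
    using assms by (auto simp: sobolev_def Lp_fun_iff)
  then show "p_integrable p M u" by simp
  show "has_weak_gradient \<Omega> u (grad u)" using weak_gradient_eq G(2) by blast
  have eq: "AE x in M. G x = grad u x" using weak_gradient_eq(2)[OF G(2)] by eventually_elim simp
  show "p_integrable p M (grad u)"
    by (rule p_integrable_cong_AE[OF G(1) eq])
      (rule borel_measurable_lebesgue_on_cong_AE[OF domain_sets p_integrableD(1)[OF G(1)] eq])
qed

lemma sobolev_lincomb: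
  assumes "u \<in> W" "v \<in> W"
  shows "(\<lambda>x. u x + c * v x) \<in> W" "AE x in M. grad (\<lambda>x. u x + c * v x) x = grad u x + c *\<^sub>R grad v x"
proof -
  note u = sobolevD[OF assms(1)] and v = sobolevD[OF assms(2)]
  have h: "has_weak_gradient \<Omega> (\<lambda>x. u x + c * v x) (\<lambda>x. grad u x + c *\<^sub>R grad v x)"
    by (rule has_weak_gradient_lincomb[OF domain_sets u(3) v(3)])
  show "(\<lambda>x. u x + c * v x) \<in> W"
    by (rule sobolevI[OF p_integrable_add[OF p_pos u(1) p_integrable_scaleR[OF v(1), of c, simplified]]
          p_integrable_add[OF p_pos u(2) p_integrable_scaleR[OF v(2), of c]] h])
  show "AE x in M. grad (\<lambda>x. u x + c * v x) x = grad u x + c *\<^sub>R grad v x"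
    by (rule weak_gradient_eq(2)[OF h])
qed

lemma sobolev_diff:
  assumes "u \<in> W" "v \<in> W"
  shows "(\<lambda>x. u x - v x) \<in> W" "AE x in M. grad (\<lambda>x. u x - v x) x = grad u x - grad v x"
  using sobolev_lincomb[OF assms, of "-1"] by simp_all

lemma bounded_imp_p_integrable:
  fixes f :: "real^'n \<Rightarrow> 'b::euclidean_space"
  assumes "f \<in> borel_measurable M" "\<And>x. x \<in> \<Omega> \<Longrightarrow> norm (f x) \<le> B"
  shows "p_integrable p M f"
proof -
  interpret finite_measure M by (rule finite_M)
  have "integrable M (\<lambda>x. norm (f x) powr p)"
  proof (rule integrable_const_bound)
    show "AE x in M. norm (norm (f x) powr p) \<le> B powr p"
      using assms(2) p_pos by (intro AE_I2) (auto intro: powr_mono2)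
    show "(\<lambda>x. norm (f x) powr p) \<in> borel_measurable M" using assms(1) by measurable
  qed
  then show ?thesis using assms(1) by (simp add: p_integrable_def)
qed

lemma continuous_imp_measurable_bounded:
  fixes f :: "real^'n \<Rightarrow> 'b::euclidean_space"
  assumes "continuous_on UNIV f"
  shows "f \<in> borel_measurable M" "\<exists>B. \<forall>x\<in>\<Omega>. norm (f x) \<le> B" "p_integrable p M f"
proof -
  show m: "f \<in> borel_measurable M"
    using continuous_imp_lebesgue_measurable[OF assms] by (rule measurable_restrict_space1)
  have "compact (closure \<Omega>)" using bounded_domain by simp
  then have "bounded (f ` closure \<Omega>)"
    using assms by (intro compact_imp_bounded compact_continuous_image) (auto intro: continuous_on_subset)
  then obtain B where "\<forall>y\<in>f ` closure \<Omega>. norm y \<le> B" unfolding bounded_iff by blast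
  then have "\<forall>x\<in>\<Omega>. norm (f x) \<le> B" using closure_subset by blast
  then show "\<exists>B. \<forall>x\<in>\<Omega>. norm (f x) \<le> B" "p_integrable p M f"
    using bounded_imp_p_integrable[OF m] by blast+
qed

text \<open>On a bounded domain such functions and their gradients are bounded, and integration by parts
  identifies the weak gradient.\<close>

lemma C1_imp_sobolev:
  assumes der: "\<And>x. (u has_derivative (\<lambda>v. G x \<bullet> v)) (at x)" and cont: "continuous_on UNIV G"
  shows "u \<in> W" "AE x in M. grad u x = G x"
proof -
  have cu: "continuous_on UNIV u"
    using der has_derivative_continuous by (blast intro: continuous_at_imp_continuous_on)
  note pu = continuous_imp_measurable_bounded(3)[OF cu] and pG = continuous_imp_measurable_bounded(3)[OF cont]
  have "(LINT x|M. u x * partial_deriv i \<phi> x) = - (LINT x|M. G x $ i * \<phi> x)"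
    if \<phi>: "\<phi> \<in> test_functions \<Omega>" for \<phi> i
  proof -
    note t = test_functionD[OF \<phi>]
    have c: "(\<lambda>x. G x \<bullet> axis i 1) = (\<lambda>x. G x $ i)" "(\<chi> j. partial_deriv j \<phi> x) \<bullet> axis i 1 = partial_deriv i \<phi> x" for x
      by (auto simp: inner_axis fun_eq_iff)
    show ?thesis
      using integral_by_parts(1)[of \<Omega> u "\<lambda>x v. G x \<bullet> v" "axis i 1" \<phi> "\<lambda>x v. (\<chi> j. partial_deriv j \<phi> x) \<bullet> v"]
        der frechet_derivative_eq_inner[OF t(2)] t(3,8,9,10) cont unfolding c
      by (simp add: inner_axis continuous_on_component)
  qed
  then have h: "has_weak_gradient \<Omega> u G"
    using p_integrable_locally_integrable[OF pu] p_integrable_locally_integrable[OF pG] by (simp add: has_weak_gradient_def)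
  show "u \<in> W" by (rule sobolevI[OF pu pG h])
  show "AE x in M. grad u x = G x" by (rule weak_gradient_eq(2)[OF h])
qed

lemma test_function_sobolev:
  assumes "\<phi> \<in> test_functions \<Omega>"
  shows "\<phi> \<in> W" "AE x in M. grad \<phi> x = (\<chi> i. partial_deriv i \<phi> x)"
proof -
  note t = test_functionD[OF assms]
  have "continuous_on UNIV (\<lambda>x. \<chi> i. partial_deriv i \<phi> x)"
    using t(3) by (intro continuous_on_vec_lambda) simp
  then show "\<phi> \<in> W" "AE x in M. grad \<phi> x = (\<chi> i. partial_deriv i \<phi> x)"
    using C1_imp_sobolev[OF frechet_derivative_eq_inner[OF t(2)]] by blast+
qed

text \<open>The identity defining a weak gradient passes to the limit because it pairs the functions with
  bounded factors only.\<close>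

lemma weak_gradient_limit:
  assumes w: "\<And>k. u k \<in> W" and u: "p_integrable p M v" "(\<lambda>k. LINT x|M. norm (u k x - v x) powr p) \<longlonglongrightarrow> 0"
    and G: "p_integrable p M G" "(\<lambda>k. LINT x|M. norm (grad (u k) x - G x) powr p) \<longlonglongrightarrow> 0"
  shows "v \<in> W" "AE x in M. grad v x = G x"
proof -
  have pc: "p_integrable p M (\<lambda>x. F x $ i)" if "p_integrable p M F" for F :: "real^'n \<Rightarrow> real^'n" and i
  proof -
    note [measurable] = p_integrableD(1)[OF that]
    have m: "(\<lambda>x. F x $ i) \<in> borel_measurable M" unfolding cart_eq_inner_axis by measurable
    have "integrable M (\<lambda>x. norm (F x $ i) powr p)"
      by (rule Bochner_Integration.integrable_bound[OF p_integrableD(2)[OF that]])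
        (use m p_pos component_le_norm_cart in \<open>auto intro!: AE_I2 powr_mono2\<close>)
    then show ?thesis using m by (simp add: p_integrable_def)
  qed
  have "(LINT x|M. v x * partial_deriv i \<phi> x) = - (LINT x|M. G x $ i * \<phi> x)"
    if \<phi>: "\<phi> \<in> test_functions \<Omega>" for \<phi> i
  proof -
    note t = test_functionD[OF \<phi>]
    obtain B1 where B1: "\<And>x. x \<in> \<Omega> \<Longrightarrow> norm (\<phi> x) \<le> B1" using continuous_imp_measurable_bounded(2)[OF t(1)] by blast
    obtain B2 where B2: "\<And>x. x \<in> \<Omega> \<Longrightarrow> norm (partial_deriv i \<phi> x) \<le> B2" using continuous_imp_measurable_bounded(2)[OF t(3)] by blast
    have l1: "(\<lambda>k. LINT x|M. u k x * partial_deriv i \<phi> x) \<longlonglongrightarrow> (LINT x|M. v x * partial_deriv i \<phi> x)"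
      by (rule integral_mult_bounded_tendsto[OF p_gt_1 finite_M sobolevD(1)[OF w] u, where B=B2])
        (use B2 continuous_imp_measurable_bounded(1)[OF t(3)] in auto)
    have "(\<lambda>k. LINT x|M. norm (grad (u k) x $ i - G x $ i) powr p) \<longlonglongrightarrow> 0"
    proof (rule tendsto_sandwich[OF _ _ tendsto_const G(2)])
      show "eventually (\<lambda>k. (LINT x|M. norm (grad (u k) x $ i - G x $ i) powr p) \<le> (LINT x|M. norm (grad (u k) x - G x) powr p)) sequentially"
      proof (rule always_eventually, rule allI, rule integral_mono)
        fix k x
        have d: "p_integrable p M (\<lambda>x. grad (u k) x - G x)" by (rule p_integrable_diff[OF p_pos sobolevD(2)[OF w] G(1)])
        show "integrable M (\<lambda>x. norm (grad (u k) x - G x) powr p)" using p_integrableD(2)[OF d] .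
        show "integrable M (\<lambda>x. norm (grad (u k) x $ i - G x $ i) powr p)" using p_integrableD(2)[OF pc[OF d, of i]] by simp
        show "norm (grad (u k) x $ i - G x $ i) powr p \<le> norm (grad (u k) x - G x) powr p"
          using p_pos component_le_norm_cart[of "grad (u k) x - G x" i] by (intro powr_mono2) auto
      qed
    qed (simp add: integral_nonneg_AE)
    then have l2: "(\<lambda>k. LINT x|M. grad (u k) x $ i * \<phi> x) \<longlonglongrightarrow> (LINT x|M. G x $ i * \<phi> x)"
      by (rule integral_mult_bounded_tendsto[OF p_gt_1 finite_M pc[OF sobolevD(2)[OF w]] pc[OF G(1)], where B=B1])
        (use B1 continuous_imp_measurable_bounded(1)[OF t(1)] in auto)
    have "(LINT x|M. u k x * partial_deriv i \<phi> x) = - (LINT x|M. grad (u k) x $ i * \<phi> x)" for k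
      using sobolevD(3)[OF w[of k]] \<phi> unfolding has_weak_gradient_def by blast
    then have "(\<lambda>k. LINT x|M. u k x * partial_deriv i \<phi> x) \<longlonglongrightarrow> - (LINT x|M. G x $ i * \<phi> x)"
      using tendsto_minus[OF l2] by simp
    then show ?thesis by (rule LIMSEQ_unique[OF l1])
  qed
  then have h: "has_weak_gradient \<Omega> v G"
    using p_integrable_locally_integrable[OF u(1)] p_integrable_locally_integrable[OF G(1)] by (simp add: has_weak_gradient_def)
  show "v \<in> W" by (rule sobolevI[OF u(1) G(1) h])
  show "AE x in M. grad v x = G x" by (rule weak_gradient_eq(2)[OF h])
qed

section \<open>Functions with zero boundary values\<close>

text \<open>The \<open>p\<close>-th power of the Sobolev norm. It is subadditive only up to a constant factor, which is
  elementary and enough for all approximation arguments.\<close>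

definition sobolev_modulus :: "(real^'n \<Rightarrow> real) \<Rightarrow> real" where
  "sobolev_modulus u = (LINT x|M. \<bar>u x\<bar> powr p) + (LINT x|M. norm (grad u x) powr p)"

lemma sobolev_modulus_nonneg: "0 \<le> sobolev_modulus u"
  by (simp add: sobolev_modulus_def)

lemma sobolev_norm_less_iff:
  assumes "0 < e" shows "sobolev_norm p \<Omega> u < e \<longleftrightarrow> sobolev_modulus u < e powr p"
proof -
  have n: "sobolev_norm p \<Omega> u = sobolev_modulus u powr (1 / p)"
    by (simp add: sobolev_norm_def sobolev_modulus_def)
  have e: "e = (e powr p) powr (1 / p)" using assms p_pos by (simp add: powr_powr)
  show ?thesis
  proof
    assume "sobolev_norm p \<Omega> u < e"
    then have "sobolev_modulus u powr (1 / p) < (e powr p) powr (1 / p)" using n e by simp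
    then show "sobolev_modulus u < e powr p"
      using powr_mono2[of "1/p" "e powr p" "sobolev_modulus u"] p_pos by (force simp: not_less[symmetric])
  next
    assume "sobolev_modulus u < e powr p"
    then have "sobolev_modulus u powr (1 / p) < (e powr p) powr (1 / p)"
      using p_pos sobolev_modulus_nonneg by (intro powr_less_mono2) auto
    then show "sobolev_norm p \<Omega> u < e" using n e by simp
  qed
qed

lemma sobolev_0_iff:
  "u \<in> W0 \<longleftrightarrow> u \<in> W \<and> (\<forall>e>0. \<exists>\<phi>\<in>test_functions \<Omega>. sobolev_modulus (\<lambda>x. u x - \<phi> x) < e)"
proof -
  have "(\<forall>e>0. \<exists>\<phi>\<in>test_functions \<Omega>. sobolev_norm p \<Omega> (\<lambda>x. u x - \<phi> x) < e)
     \<longleftrightarrow> (\<forall>e>0. \<exists>\<phi>\<in>test_functions \<Omega>. sobolev_modulus (\<lambda>x. u x - \<phi> x) < e)"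
  proof
    assume L: "\<forall>e>0. \<exists>\<phi>\<in>test_functions \<Omega>. sobolev_norm p \<Omega> (\<lambda>x. u x - \<phi> x) < e"
    show "\<forall>e>0. \<exists>\<phi>\<in>test_functions \<Omega>. sobolev_modulus (\<lambda>x. u x - \<phi> x) < e"
    proof (intro allI impI)
      fix e :: real assume "0 < e"
      then have "0 < e powr (1 / p)" "(e powr (1 / p)) powr p = e" using p_pos by (auto simp: powr_powr)
      then show "\<exists>\<phi>\<in>test_functions \<Omega>. sobolev_modulus (\<lambda>x. u x - \<phi> x) < e"
        using L sobolev_norm_less_iff[of "e powr (1 / p)"] by metis
    qed
  next
    assume R: "\<forall>e>0. \<exists>\<phi>\<in>test_functions \<Omega>. sobolev_modulus (\<lambda>x. u x - \<phi> x) < e"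
    show "\<forall>e>0. \<exists>\<phi>\<in>test_functions \<Omega>. sobolev_norm p \<Omega> (\<lambda>x. u x - \<phi> x) < e"
      using R sobolev_norm_less_iff by (metis powr_gt_zero less_irrefl)
  qed
  then show ?thesis by (simp add: sobolev_0_def)
qed

lemma sobolev_0_imp_sobolev: "u \<in> W0 \<Longrightarrow> u \<in> W"
  by (simp add: sobolev_0_iff)

lemma sobolev_modulus_lincomb_le:
  assumes "u \<in> W" "v \<in> W"
  shows "sobolev_modulus (\<lambda>x. u x + c * v x) \<le> 2 powr p * (sobolev_modulus u + \<bar>c\<bar> powr p * sobolev_modulus v)"
proof -
  note u = sobolevD[OF assms(1)] and v = sobolevD[OF assms(2)]
  note cv = p_integrable_scaleR[OF v(1), of c] p_integrable_scaleR[OF v(2), of c]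
  have "(LINT x|M. norm (u x + c *\<^sub>R v x) powr p)
      \<le> 2 powr p * ((LINT x|M. norm (u x) powr p) + (LINT x|M. norm (c *\<^sub>R v x) powr p))"
    by (rule p_integral_add_le[OF p_pos u(1) cv(1)])
  then have A: "(LINT x|M. \<bar>u x + c * v x\<bar> powr p)
      \<le> 2 powr p * ((LINT x|M. \<bar>u x\<bar> powr p) + \<bar>c\<bar> powr p * (LINT x|M. \<bar>v x\<bar> powr p))"
    by (simp add: abs_mult powr_mult)
  have "(LINT x|M. norm (grad (\<lambda>x. u x + c * v x) x) powr p) = (LINT x|M. norm (grad u x + c *\<^sub>R grad v x) powr p)"
    by (rule p_integral_cong_AE[OF sobolevD(2)[OF sobolev_lincomb(1)[OF assms]]
          p_integrable_add[OF p_pos u(2) cv(2)] sobolev_lincomb(2)[OF assms]])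
  also have "\<dots> \<le> 2 powr p * ((LINT x|M. norm (grad u x) powr p) + (LINT x|M. norm (c *\<^sub>R grad v x) powr p))"
    by (rule p_integral_add_le[OF p_pos u(2) cv(2)])
  also have "(LINT x|M. norm (c *\<^sub>R grad v x) powr p) = \<bar>c\<bar> powr p * (LINT x|M. norm (grad v x) powr p)"
    by (simp add: powr_mult)
  finally show ?thesis using A by (simp add: sobolev_modulus_def algebra_simps)
qed

lemma sobolev_0_approx:
  assumes "u \<in> W0"
  obtains \<phi> where "\<And>k. \<phi> k \<in> test_functions \<Omega>" "(\<lambda>k. sobolev_modulus (\<lambda>x. u x - \<phi> k x)) \<longlonglongrightarrow> 0"
proof -
  have "\<forall>k. \<exists>\<phi>. \<phi> \<in> test_functions \<Omega> \<and> sobolev_modulus (\<lambda>x. u x - \<phi> x) < inverse (real (Suc k))"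
    using assms unfolding sobolev_0_iff by (metis of_nat_0_less_iff positive_imp_inverse_positive zero_less_Suc)
  then obtain \<phi> where \<phi>: "\<And>k. \<phi> k \<in> test_functions \<Omega>"
      "\<And>k. sobolev_modulus (\<lambda>x. u x - \<phi> k x) < inverse (real (Suc k))" by metis
  have "(\<lambda>k. sobolev_modulus (\<lambda>x. u x - \<phi> k x)) \<longlonglongrightarrow> 0"
    by (rule tendsto_sandwich[OF _ _ tendsto_const LIMSEQ_inverse_real_of_nat])
      (use \<phi>(2) sobolev_modulus_nonneg in \<open>auto intro!: always_eventually less_imp_le\<close>)
  with \<phi>(1) show ?thesis by (rule that)
qed

lemma sobolev_0_closed:
  assumes u: "u \<in> W" and w: "\<And>k. w k \<in> W0" and lim: "(\<lambda>k. sobolev_modulus (\<lambda>x. u x - w k x)) \<longlonglongrightarrow> 0"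
  shows "u \<in> W0"
  unfolding sobolev_0_iff
proof (intro conjI u allI impI)
  fix e :: real assume "0 < e"
  define d where "d = e / (2 * 2 powr p)"
  have d: "d > 0" using \<open>0 < e\<close> by (simp add: d_def)
  obtain k where k: "sobolev_modulus (\<lambda>x. u x - w k x) < d"
    using eventually_happens'[OF sequentially_bot order_tendstoD(2)[OF lim d]] by blast
  obtain \<phi> where \<phi>: "\<phi> \<in> test_functions \<Omega>" "sobolev_modulus (\<lambda>x. w k x - \<phi> x) < d"
    using w[of k] d unfolding sobolev_0_iff by blast
  have wW: "w k \<in> W" "\<phi> \<in> W" using sobolev_0_imp_sobolev[OF w] test_function_sobolev(1)[OF \<phi>(1)] by simp_all
  have "sobolev_modulus (\<lambda>x. (u x - w k x) + 1 * (w k x - \<phi> x))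
     \<le> 2 powr p * (sobolev_modulus (\<lambda>x. u x - w k x) + \<bar>1\<bar> powr p * sobolev_modulus (\<lambda>x. w k x - \<phi> x))"
    by (rule sobolev_modulus_lincomb_le[OF sobolev_diff(1)[OF u wW(1)] sobolev_diff(1)[OF wW]])
  also have "\<dots> < 2 powr p * (d + d)"
    using k \<phi>(2) by (intro mult_strict_left_mono) auto
  also have "\<dots> = e" by (simp add: d_def)
  finally show "\<exists>\<phi>\<in>test_functions \<Omega>. sobolev_modulus (\<lambda>x. u x - \<phi> x) < e" using \<phi>(1) by auto
qed

lemma test_function_sobolev_0:
  assumes "\<phi> \<in> test_functions \<Omega>" shows "\<phi> \<in> W0"
  unfolding sobolev_0_iff
proof (intro conjI test_function_sobolev(1) assms allI impI)
  fix e :: real assume "0 < e"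
  have "AE x in M. grad (\<lambda>x. 0::real) x = 0"
    using C1_imp_sobolev(2)[of "\<lambda>x. 0" "\<lambda>x. 0"] by simp
  then have "AE x in M. norm (grad (\<lambda>x. 0::real) x) powr p = 0" by eventually_elim simp
  then have "sobolev_modulus (\<lambda>x. 0) = 0" unfolding sobolev_modulus_def by (simp add: integral_eq_zero_AE)
  then show "\<exists>\<psi>\<in>test_functions \<Omega>. sobolev_modulus (\<lambda>x. \<phi> x - \<psi> x) < e"
    using assms \<open>0 < e\<close> by (intro bexI[of _ \<phi>]) auto
qed

lemma sobolev_0_lincomb:
  assumes "u \<in> W0" "v \<in> W0" shows "(\<lambda>x. u x + c * v x) \<in> W0"
proof -
  obtain \<phi> where \<phi>: "\<And>k. \<phi> k \<in> test_functions \<Omega>" "(\<lambda>k. sobolev_modulus (\<lambda>x. u x - \<phi> k x)) \<longlonglongrightarrow> 0"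
    using sobolev_0_approx[OF assms(1)] by blast
  obtain \<psi> where \<psi>: "\<And>k. \<psi> k \<in> test_functions \<Omega>" "(\<lambda>k. sobolev_modulus (\<lambda>x. v x - \<psi> k x)) \<longlonglongrightarrow> 0"
    using sobolev_0_approx[OF assms(2)] by blast
  have W: "u \<in> W" "v \<in> W" "\<phi> k \<in> W" "\<psi> k \<in> W" for k
    using assms test_function_sobolev(1)[OF \<phi>(1)] test_function_sobolev(1)[OF \<psi>(1)]
    by (simp_all add: sobolev_0_imp_sobolev)
  have le: "sobolev_modulus (\<lambda>x. (u x + c * v x) - (\<phi> k x + c * \<psi> k x))
     \<le> 2 powr p * (sobolev_modulus (\<lambda>x. u x - \<phi> k x) + \<bar>c\<bar> powr p * sobolev_modulus (\<lambda>x. v x - \<psi> k x))" for k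
    using sobolev_modulus_lincomb_le[OF sobolev_diff(1)[OF W(1,3)] sobolev_diff(1)[OF W(2,4)], where c=c]
    by (simp add: algebra_simps)
  have "(\<lambda>k. 2 powr p * (sobolev_modulus (\<lambda>x. u x - \<phi> k x) + \<bar>c\<bar> powr p * sobolev_modulus (\<lambda>x. v x - \<psi> k x)))
     \<longlonglongrightarrow> 2 powr p * (0 + \<bar>c\<bar> powr p * 0)" by (intro tendsto_intros \<phi> \<psi>)
  then have rhs: "(\<lambda>k. 2 powr p * (sobolev_modulus (\<lambda>x. u x - \<phi> k x) + \<bar>c\<bar> powr p * sobolev_modulus (\<lambda>x. v x - \<psi> k x)))
     \<longlonglongrightarrow> 0" by simp
  have "(\<lambda>k. sobolev_modulus (\<lambda>x. (u x + c * v x) - (\<phi> k x + c * \<psi> k x))) \<longlonglongrightarrow> 0"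
    by (rule tendsto_sandwich[OF _ _ tendsto_const rhs])
      (use le sobolev_modulus_nonneg in \<open>auto intro!: always_eventually\<close>)
  then show ?thesis
    by (rule sobolev_0_closed[OF sobolev_lincomb(1)[OF W(1,2)] test_function_sobolev_0[OF test_functions_lincomb[OF \<phi>(1) \<psi>(1)]]])
qed

lemma sobolev_0_diff: "u \<in> W0 \<Longrightarrow> v \<in> W0 \<Longrightarrow> (\<lambda>x. u x - v x) \<in> W0"
  using sobolev_0_lincomb[of u v "-1"] by simp

lemma sobolev_0_zero: "(\<lambda>x. 0) \<in> W0"
  by (rule test_function_sobolev_0[OF zero_test_function])

text \<open>Integration by parts against the coordinate \<open>x $ i\<close>, whose \<open>i\<close>-th partial derivative is \<open>1\<close>,
  expresses the integral of \<open>|\<phi>| powr p\<close> through that of \<open>x $ i\<close> times \<open>\<partial>\<^sub>i |\<phi>| powr p\<close>. As \<open>x\<close> is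
  bounded, this is controlled by \<open>|\<phi>| powr (p - 1)\<close> times the norm of the gradient, and half of the
  left-hand side can be absorbed.\<close>

lemma poincare_test_functions:
  obtains C where "0 < C" "\<And>\<phi>. \<phi> \<in> test_functions \<Omega> \<Longrightarrow>
     (LINT x|M. \<bar>\<phi> x\<bar> powr p) \<le> C * (LINT x|M. norm (grad \<phi> x) powr p)"
proof -
  obtain R where R: "R > 0" "\<And>x. x \<in> \<Omega> \<Longrightarrow> norm x \<le> R" using bounded_domain bounded_pos by metis
  \<comment> \<open>With this constant, \<open>s \<ge> K * g\<close> makes \<open>p * R * (s powr (p - 1) * g)\<close> at most half of \<open>s powr p\<close>.\<close>
  define K where "K = 2 * p * R"
  have K: "K > 0" using R p_pos by (simp add: K_def)
  define C where "C = p * R * K powr (p - 1)"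
  have C: "C > 0" using R K p_pos by (simp add: C_def)
  have young: "p * R * (s powr (p - 1) * g) \<le> s powr p / 2 + C * g powr p" if "0 \<le> s" "0 \<le> g" for s g :: real
  proof (cases "s \<le> K * g")
    case True
    have "s powr (p - 1) \<le> (K * g) powr (p - 1)" using that True p_gt_1 by (intro powr_mono2) auto
    then have "s powr (p - 1) * g \<le> (K * g) powr (p - 1) * g" using that by (intro mult_right_mono)
    also have "\<dots> = K powr (p - 1) * g powr p"
      using that K p_gt_1 by (cases "g = 0") (auto simp: powr_mult powr_diff)
    finally have "p * R * (s powr (p - 1) * g) \<le> p * R * (K powr (p - 1) * g powr p)"
      using R p_pos by (intro mult_left_mono) auto
    then show ?thesis by (simp add: C_def add_increasing mult.assoc)
  next
    case False
    moreover have "0 \<le> K * g" using that K by simp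
    ultimately have "0 < s" by linarith
    then have s: "0 < s" "g \<le> s / K" using False K by (auto simp: field_simps)
    have "p * R * (s powr (p - 1) * g) \<le> p * R * (s powr (p - 1) * (s / K))"
      using s R p_pos by (intro mult_left_mono) auto
    also have "\<dots> = s powr p / 2" using s R p_pos by (simp add: K_def powr_diff)
    finally show ?thesis using C by (simp add: add_increasing2)
  qed
  have "(LINT x|M. \<bar>\<phi> x\<bar> powr p) \<le> 2 * C * (LINT x|M. norm (grad \<phi> x) powr p)"
    if \<phi>: "\<phi> \<in> test_functions \<Omega>" for \<phi>
  proof -
    note t = test_functionD[OF \<phi>] and w = test_function_sobolev[OF \<phi>]
    fix i :: 'n
    define g where "g x = (\<chi> j. partial_deriv j \<phi> x)" for x
    have dphi: "(\<phi> has_derivative (\<lambda>v. g x \<bullet> v)) (at x)" for x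
      using frechet_derivative_eq_inner[OF t(2)] by (simp add: g_def)
    define h' where "h' x v = p * pflux p (\<phi> x) * (g x \<bullet> v)" for x v
    have dh: "((\<lambda>x. \<bar>\<phi> x\<bar> powr p) has_derivative h' x) (at x)" for x
      using has_derivative_compose[OF dphi abs_powr_has_derivative[OF p_gt_1, THEN has_field_derivative_imp_has_derivative]]
      by (simp add: h'_def[abs_def])
    have gi: "g x \<bullet> axis i 1 = partial_deriv i \<phi> x" for x by (simp add: g_def inner_axis)
    have ch: "continuous_on UNIV (\<lambda>x. h' x (axis i 1))"
      unfolding h'_def gi using t(1,3) p_gt_1 by (intro continuous_intros) auto
    have dx: "((\<lambda>x::real^'n. x $ i) has_derivative (\<lambda>v. v $ i)) (at x)" for x
      by (auto intro!: bounded_linear_imp_has_derivative bounded_linear_vec_nth)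
    have b: "bounded {x. \<bar>\<phi> x\<bar> powr p \<noteq> 0}" by (rule bounded_subset[OF t(8)]) auto
    have v: "\<And>x. x \<notin> \<Omega> \<Longrightarrow> \<bar>\<phi> x\<bar> powr p = 0" "\<And>x. x \<notin> \<Omega> \<Longrightarrow> h' x (axis i 1) = 0"
      using t(9,10) unfolding h'_def gi by auto
    have ibp: "(LINT x|M. x $ i * h' x (axis i 1)) = - (LINT x|M. axis i 1 $ i * \<bar>\<phi> x\<bar> powr p)"
      "integrable M (\<lambda>x. x $ i * h' x (axis i 1))"
      using integral_by_parts(1,2)[OF domain_sets dx _ dh ch b v] by (auto simp del: axis_nth)
    have le: "- (x $ i * h' x (axis i 1)) \<le> \<bar>\<phi> x\<bar> powr p / 2 + C * norm (grad \<phi> x) powr p"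
      if "x \<in> \<Omega>" "grad \<phi> x = g x" for x
    proof -
      have "- (x $ i * h' x (axis i 1)) \<le> \<bar>x $ i * h' x (axis i 1)\<bar>" by simp
      also have "\<dots> = \<bar>x $ i\<bar> * (p * (norm (pflux p (\<phi> x)) * \<bar>g x $ i\<bar>))"
        using p_pos by (simp add: h'_def abs_mult inner_axis)
      also have "\<dots> \<le> R * (p * (norm (pflux p (\<phi> x)) * norm (g x)))"
        using R(2)[OF that(1)] component_le_norm_cart[of x i] component_le_norm_cart[of "g x" i] p_pos R(1)
        by (intro mult_mono mult_left_mono) auto
      also have "\<dots> = p * R * (\<bar>\<phi> x\<bar> powr (p - 1) * norm (grad \<phi> x))"
        using norm_pflux[OF p_gt_1, of "\<phi> x"] that by simp
      also have "\<dots> \<le> \<bar>\<phi> x\<bar> powr p / 2 + C * norm (grad \<phi> x) powr p" by (rule young) auto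
      finally show ?thesis .
    qed
    have int: "integrable M (\<lambda>x. \<bar>\<phi> x\<bar> powr p)" "integrable M (\<lambda>x. norm (grad \<phi> x) powr p)"
      using p_integrableD(2)[OF sobolevD(1)[OF w(1)]] p_integrableD(2)[OF sobolevD(2)[OF w(1)]] by simp_all
    have "(LINT x|M. \<bar>\<phi> x\<bar> powr p) = (LINT x|M. - (x $ i * h' x (axis i 1)))" using ibp by simp
    also have "\<dots> \<le> (LINT x|M. \<bar>\<phi> x\<bar> powr p / 2 + C * norm (grad \<phi> x) powr p)"
    proof (rule integral_mono_AE)
      have "AE x in M. x \<in> \<Omega>" by (rule AE_I2) simp
      with w(2) show "AE x in M. - (x $ i * h' x (axis i 1)) \<le> \<bar>\<phi> x\<bar> powr p / 2 + C * norm (grad \<phi> x) powr p"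
        by eventually_elim (rule le; simp add: g_def)
    qed (use int ibp in auto)
    also have "\<dots> = (LINT x|M. \<bar>\<phi> x\<bar> powr p) / 2 + C * (LINT x|M. norm (grad \<phi> x) powr p)"
      using int by simp
    finally show ?thesis by simp
  qed
  then show ?thesis using C by (intro that[of "2 * C"]) auto
qed

lemma poincare:
  obtains C where "0 < C" "\<And>u. u \<in> W0 \<Longrightarrow> (LINT x|M. \<bar>u x\<bar> powr p) \<le> C * (LINT x|M. norm (grad u x) powr p)"
proof -
  obtain C where C: "0 < C" "\<And>\<phi>. \<phi> \<in> test_functions \<Omega> \<Longrightarrow>
     (LINT x|M. \<bar>\<phi> x\<bar> powr p) \<le> C * (LINT x|M. norm (grad \<phi> x) powr p)"
    using poincare_test_functions by blast
  define q where "q = (2::real) powr p"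
  have q: "q > 0" by (simp add: q_def)
  have "(LINT x|M. \<bar>u x\<bar> powr p) \<le> q * C * q * (LINT x|M. norm (grad u x) powr p)" if u: "u \<in> W0" for u
  proof -
    obtain \<phi> where \<phi>: "\<And>k. \<phi> k \<in> test_functions \<Omega>" "(\<lambda>k. sobolev_modulus (\<lambda>x. u x - \<phi> k x)) \<longlonglongrightarrow> 0"
      using sobolev_0_approx[OF u] by blast
    have uW: "u \<in> W" by (rule sobolev_0_imp_sobolev[OF u])
    have pW: "\<phi> k \<in> W" for k by (rule test_function_sobolev(1)[OF \<phi>(1)])
    define e where "e k = sobolev_modulus (\<lambda>x. u x - \<phi> k x)" for k
    define A where "A = (LINT x|M. norm (grad u x) powr p)"
    have "(LINT x|M. \<bar>u x\<bar> powr p) \<le> q * (e k + C * (q * (A + e k)))" for k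
    proof -
      note d = sobolev_diff[OF uW pW, of k]
      have e1: "(LINT x|M. \<bar>u x - \<phi> k x\<bar> powr p) \<le> e k" "(LINT x|M. norm (grad (\<lambda>x. u x - \<phi> k x) x) powr p) \<le> e k"
        unfolding e_def sobolev_modulus_def by simp_all
      have "(LINT x|M. norm ((u x - \<phi> k x) + \<phi> k x) powr p)
         \<le> 2 powr p * ((LINT x|M. norm (u x - \<phi> k x) powr p) + (LINT x|M. norm (\<phi> k x) powr p))"
        by (rule p_integral_add_le[OF p_pos sobolevD(1)[OF d(1)] sobolevD(1)[OF pW]])
      then have "(LINT x|M. \<bar>u x\<bar> powr p) \<le> q * ((LINT x|M. \<bar>u x - \<phi> k x\<bar> powr p) + (LINT x|M. \<bar>\<phi> k x\<bar> powr p))"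
        by (simp add: q_def)
      also have "\<dots> \<le> q * (e k + C * (LINT x|M. norm (grad (\<phi> k) x) powr p))"
        using q e1(1) C(2)[OF \<phi>(1)] by (intro mult_left_mono add_mono) auto
      also have "(LINT x|M. norm (grad (\<phi> k) x) powr p) = (LINT x|M. norm (grad u x + (-1) *\<^sub>R grad (\<lambda>x. u x - \<phi> k x) x) powr p)"
      proof (rule p_integral_cong_AE[OF sobolevD(2)[OF pW] p_integrable_add[OF p_pos sobolevD(2)[OF uW]
              p_integrable_scaleR[OF sobolevD(2)[OF d(1)]]]])
        show "AE x in M. grad (\<phi> k) x = grad u x + (-1) *\<^sub>R grad (\<lambda>x. u x - \<phi> k x) x"
          using d(2) by eventually_elim simp
      qed
      also have "\<dots> \<le> q * ((LINT x|M. norm (grad u x) powr p) + (LINT x|M. norm ((-1) *\<^sub>R grad (\<lambda>x. u x - \<phi> k x) x) powr p))"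
        unfolding q_def by (rule p_integral_add_le[OF p_pos sobolevD(2)[OF uW] p_integrable_scaleR[OF sobolevD(2)[OF d(1)]]])
      also have "\<dots> \<le> q * (A + e k)" using q e1(2) unfolding A_def by (intro mult_left_mono add_mono) auto
      finally show ?thesis using C q by simp
    qed
    moreover have "(\<lambda>k. q * (e k + C * (q * (A + e k)))) \<longlonglongrightarrow> q * (0 + C * (q * (A + 0)))"
      using \<phi>(2) unfolding e_def by (intro tendsto_intros)
    ultimately have "(LINT x|M. \<bar>u x\<bar> powr p) \<le> q * (0 + C * (q * (A + 0)))"
      by (intro LIMSEQ_le_const) auto
    then show ?thesis by (simp add: A_def mult.assoc)
  qed
  then show ?thesis using C q by (intro that[of "q * C * q"]) auto
qed

end

section \<open>Existence of minimizers\<close>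

lemma integrable_bounded_mult:
  fixes f s :: "'a \<Rightarrow> real"
  assumes "integrable M f" and [measurable]: "s \<in> borel_measurable M" and "AE x in M. \<bar>s x\<bar> \<le> C"
  shows "integrable M (\<lambda>x. s x * f x)"
proof (rule Bochner_Integration.integrable_bound)
  show "integrable M (\<lambda>x. \<bar>C\<bar> * norm (f x))" using assms(1) by simp
  show "(\<lambda>x. s x * f x) \<in> borel_measurable M" using assms(1) by measurable
  show "AE x in M. norm (s x * f x) \<le> norm (\<bar>C\<bar> * norm (f x))"
    using assms(3)
  proof eventually_elim
    case (elim x)
    then have "\<bar>s x\<bar> * \<bar>f x\<bar> \<le> \<bar>C\<bar> * \<bar>f x\<bar>" by (intro mult_right_mono) auto
    then show ?case by (simp add: abs_mult)
  qed
qed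

context bounded_domain
begin

definition bounded_conductivity :: "(real^'n \<Rightarrow> real) \<Rightarrow> real \<Rightarrow> real \<Rightarrow> bool" where
  "bounded_conductivity s c C \<longleftrightarrow>
     s \<in> borel_measurable M \<and> 0 < c \<and> (AE x in M. c \<le> s x \<and> s x \<le> C)"

lemma bounded_conductivity_1: "bounded_conductivity (\<lambda>x. 1) 1 1"
  by (simp add: bounded_conductivity_def)

lemma bounded_conductivityD:
  assumes "bounded_conductivity s c C"
  shows "s \<in> borel_measurable M" "0 < c" "AE x in M. c \<le> s x" "AE x in M. \<bar>s x\<bar> \<le> C" "AE x in M. 0 \<le> s x"
proof -
  have ae: "AE x in M. c \<le> s x \<and> s x \<le> C" and c: "0 < c" using assms by (auto simp: bounded_conductivity_def)
  show "s \<in> borel_measurable M" "0 < c" using assms by (auto simp: bounded_conductivity_def)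
  show "AE x in M. c \<le> s x" "AE x in M. \<bar>s x\<bar> \<le> C" "AE x in M. 0 \<le> s x"
    using ae by (eventually_elim, use c in auto)+
qed

lemma L_infinity_plus_bounded_conductivity:
  assumes "\<sigma> \<in> L_infinity_plus \<Omega>"
  obtains c C where "bounded_conductivity \<sigma> c C"
proof -
  have m: "\<sigma> \<in> borel_measurable M" using assms by (simp add: L_infinity_plus_def)
  have "esssup M (\<lambda>x. ereal \<bar>\<sigma> x\<bar>) < \<infinity>" using assms by (simp add: L_infinity_plus_def)
  then obtain C where C: "esssup M (\<lambda>x. ereal \<bar>\<sigma> x\<bar>) < ereal C" using ereal_dense2 by blast
  have "AE x in M. ereal \<bar>\<sigma> x\<bar> \<le> esssup M (\<lambda>x. ereal \<bar>\<sigma> x\<bar>)" by (rule esssup_AE)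
  then have 1: "AE x in M. \<sigma> x \<le> C"
  proof eventually_elim
    case (elim x)
    then have "ereal \<bar>\<sigma> x\<bar> < ereal C" using C le_less_trans by blast
    then show ?case by simp
  qed
  have "0 < - esssup M (\<lambda>x. - ereal (\<sigma> x))" using assms by (simp add: L_infinity_plus_def ess_inf_def)
  then obtain c where c: "0 < ereal c" "ereal c < - esssup M (\<lambda>x. - ereal (\<sigma> x))" using ereal_dense2 by blast
  have "AE x in M. - ereal (\<sigma> x) \<le> esssup M (\<lambda>x. - ereal (\<sigma> x))" by (rule esssup_AE)
  then have 2: "AE x in M. c \<le> \<sigma> x"
  proof eventually_elim
    case (elim x)
    then have "- esssup M (\<lambda>x. - ereal (\<sigma> x)) \<le> ereal (\<sigma> x)" by (metis ereal_uminus_le_reorder)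
    then have "ereal c < ereal (\<sigma> x)" using c(2) less_le_trans by blast
    then show ?case by simp
  qed
  from 1 2 have "AE x in M. c \<le> \<sigma> x \<and> \<sigma> x \<le> C" by eventually_elim simp
  then show ?thesis using m c(1) by (intro that[of c C]) (simp add: bounded_conductivity_def)
qed

abbreviation u0 :: "(real^'n \<Rightarrow> real) set \<Rightarrow> real^'n \<Rightarrow> real" where
  "u0 f \<equiv> dirichlet_solution p \<Omega> (\<lambda>x. 1) f"

abbreviation energy :: "(real^'n \<Rightarrow> real) \<Rightarrow> (real^'n \<Rightarrow> real) \<Rightarrow> real" where
  "energy s u \<equiv> p_energy p \<Omega> s u"

lemma weighted_integrable:
  assumes "bounded_conductivity s c C" "p_integrable p M F"
  shows "integrable M (\<lambda>x. s x * norm (F x) powr p)"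
  using integrable_bounded_mult[OF p_integrableD(2)[OF assms(2)] bounded_conductivityD(1,4)[OF assms(1)]] .

lemma weighted_integral_ge:
  assumes s: "bounded_conductivity s c C" and F: "p_integrable p M F"
  shows "c * (LINT x|M. norm (F x) powr p) \<le> (LINT x|M. s x * norm (F x) powr p)"
proof -
  have "(LINT x|M. c * norm (F x) powr p) \<le> (LINT x|M. s x * norm (F x) powr p)"
    using weighted_integrable[OF s F] p_integrableD(2)[OF F] bounded_conductivityD(3)[OF s]
    by (intro integral_mono_AE) (auto elim!: eventually_mono intro!: mult_right_mono)
  then show ?thesis by simp
qed

lemma energy_nonneg:
  assumes "bounded_conductivity s c C" shows "0 \<le> energy s u"
  unfolding p_energy_def using bounded_conductivityD(5)[OF assms]
  by (intro integral_nonneg_AE) (auto elim!: eventually_mono)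

lemma energy_cong_gradient:
  assumes s: "bounded_conductivity s c C" and u: "u \<in> W" and F: "p_integrable p M F" and eq: "AE x in M. grad u x = F x"
  shows "energy s u = (LINT x|M. s x * norm (F x) powr p)"
  unfolding p_energy_def
proof (rule integral_cong_AE)
  show "(\<lambda>x. s x * norm (grad u x) powr p) \<in> borel_measurable M"
    using weighted_integrable[OF s sobolevD(2)[OF u]] by blast
  show "(\<lambda>x. s x * norm (F x) powr p) \<in> borel_measurable M"
    using weighted_integrable[OF s F] by blast
  show "AE x in M. s x * norm (grad u x) powr p = s x * norm (F x) powr p"
    using eq by eventually_elim simp
qed

text \<open>If the midpoint of \<open>u\<close> and \<open>v\<close> has almost their energy, the gradients of \<open>u\<close> and \<open>v\<close> are close in
  the \<open>p\<close>-th mean. Both the convergence of minimizing sequences and the uniqueness of the minimizing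
  gradient rest on this.\<close>

lemma energy_uniform_convexity:
  assumes s: "bounded_conductivity s c C" and uv: "u \<in> W" "v \<in> W"
    and K: "\<And>a b::real^'n. norm (a - b) powr p \<le> \<eta> * (norm a powr p + norm b powr p) + K * convexity_defect p a b"
  shows "c * (LINT x|M. norm (grad u x - grad v x) powr p) \<le> \<eta> * (energy s u + energy s v) +
    K * ((energy s u + energy s v) / 2 - energy s (\<lambda>x. u x + (1/2) * (v x - u x)))"
proof -
  note pu = sobolevD(2)[OF uv(1)] and pv = sobolevD(2)[OF uv(2)]
  define m where "m x = u x + (1/2) * (v x - u x)" for x
  have mW: "m \<in> W" and mg: "AE x in M. grad m x = (1/2) *\<^sub>R (grad u x + grad v x)"
  proof -
    note d = sobolev_diff[OF uv(2,1)]
    note l = sobolev_lincomb[OF uv(1) d(1), of "1/2"]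
    show "m \<in> W" using l(1) by (simp add: m_def[abs_def])
    have "AE x in M. grad m x = grad u x + (1/2) *\<^sub>R grad (\<lambda>x. v x - u x) x"
      using l(2) by (simp add: m_def[abs_def])
    then show "AE x in M. grad m x = (1/2) *\<^sub>R (grad u x + grad v x)"
      using d(2)
    proof eventually_elim
      case (elim x)
      have "grad u x + (1/2) *\<^sub>R (grad v x - grad u x) = (1/2) *\<^sub>R (grad u x + grad v x)"
        by (simp add: vec_eq_iff field_simps)
      then show ?case using elim by simp
    qed
  qed
  have pm: "p_integrable p M (\<lambda>x. (1/2) *\<^sub>R (grad u x + grad v x))"
    by (rule p_integrable_scaleR[OF p_integrable_add[OF p_pos pu pv]])
  have em: "energy s m = (LINT x|M. s x * norm ((1/2) *\<^sub>R (grad u x + grad v x)) powr p)"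
    by (rule energy_cong_gradient[OF s mW pm mg])
  note I = weighted_integrable[OF s pu] weighted_integrable[OF s pv] weighted_integrable[OF s pm]
  have pd: "p_integrable p M (\<lambda>x. grad u x - grad v x)" by (rule p_integrable_diff[OF p_pos pu pv])
  have "c * (LINT x|M. norm (grad u x - grad v x) powr p) \<le> (LINT x|M. s x * norm (grad u x - grad v x) powr p)"
    by (rule weighted_integral_ge[OF s pd])
  also have "\<dots> \<le> (LINT x|M. \<eta> * (s x * norm (grad u x) powr p + s x * norm (grad v x) powr p) +
      K * ((s x * norm (grad u x) powr p + s x * norm (grad v x) powr p) / 2
        - s x * norm ((1/2) *\<^sub>R (grad u x + grad v x)) powr p))"
  proof (rule integral_mono_AE)
    show "AE x in M. s x * norm (grad u x - grad v x) powr p \<le> \<eta> * (s x * norm (grad u x) powr p + s x * norm (grad v x) powr p) +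
      K * ((s x * norm (grad u x) powr p + s x * norm (grad v x) powr p) / 2
        - s x * norm ((1/2) *\<^sub>R (grad u x + grad v x)) powr p)"
      using bounded_conductivityD(5)[OF s]
    proof eventually_elim
      case (elim x)
      have "s x * norm (grad u x - grad v x) powr p \<le> s x * (\<eta> * (norm (grad u x) powr p + norm (grad v x) powr p)
         + K * convexity_defect p (grad u x) (grad v x))"
        using K elim by (intro mult_left_mono) auto
      then show ?case unfolding convexity_defect_def by (simp only: algebra_simps) (simp add: algebra_simps)
    qed
    show "integrable M (\<lambda>x. \<eta> * (s x * norm (grad u x) powr p + s x * norm (grad v x) powr p) +
      K * ((s x * norm (grad u x) powr p + s x * norm (grad v x) powr p) / 2
        - s x * norm ((1/2) *\<^sub>R (grad u x + grad v x)) powr p))"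
      by (intro Bochner_Integration.integrable_add Bochner_Integration.integrable_diff integrable_mult_right integrable_divide I)
  qed (rule weighted_integrable[OF s pd])
  also have "\<dots> = \<eta> * (energy s u + energy s v) + K * ((energy s u + energy s v) / 2 - energy s m)"
    unfolding em unfolding p_energy_def using I
    by (simp del: norm_scaleR)
  finally show ?thesis unfolding m_def .
qed

lemma boundary_spaceD:
  assumes "f \<in> boundary_space p \<Omega>"
  shows "f \<noteq> {}" "f \<subseteq> W" "u \<in> f \<Longrightarrow> v \<in> f \<Longrightarrow> (\<lambda>x. v x - u x) \<in> W0"
    "u \<in> f \<Longrightarrow> w \<in> W0 \<Longrightarrow> (\<lambda>x. u x + c * w x) \<in> f"
proof -
  obtain v0 where v0: "v0 \<in> W" and f: "f = {v. v \<in> W \<and> (\<lambda>x. v x - v0 x) \<in> W0}"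
    using assms unfolding boundary_space_def by (auto elim!: quotientE)
  have "v0 \<in> f" using v0 sobolev_0_zero by (simp add: f)
  then show "f \<noteq> {}" by blast
  show "f \<subseteq> W" by (auto simp: f)
  show "(\<lambda>x. v x - u x) \<in> W0" if "u \<in> f" "v \<in> f"
    using sobolev_0_diff[of "\<lambda>x. v x - v0 x" "\<lambda>x. u x - v0 x"] that by (simp add: f)
  show "(\<lambda>x. u x + c * w x) \<in> f" if "u \<in> f" "w \<in> W0"
  proof -
    have "(\<lambda>x. (u x - v0 x) + c * w x) \<in> W0" using that by (intro sobolev_0_lincomb) (simp_all add: f)
    moreover have "(\<lambda>x. u x + c * w x) \<in> W" using that by (intro sobolev_lincomb) (simp_all add: f sobolev_0_imp_sobolev)
    ultimately show ?thesis by (simp add: f algebra_simps)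
  qed
qed

lemma boundary_class:
  assumes "u \<in> W"
  obtains f where "f \<in> boundary_space p \<Omega>" "u \<in> f"
proof
  let ?f = "{(u, v). u \<in> W \<and> v \<in> W \<and> (\<lambda>x. v x - u x) \<in> W0} `` {u}"
  show "?f \<in> boundary_space p \<Omega>" unfolding boundary_space_def using assms by (rule quotientI)
  show "u \<in> ?f" using assms sobolev_0_zero by simp
qed

text \<open>The direct method. All midpoints of a minimizing sequence stay in the coset and hence above the
  infimum, so by uniform convexity the gradients form a Cauchy sequence; by Poincare's inequality, so
  do the functions themselves. Fatou's lemma bounds the energy of the limit.\<close>

lemma minimizer_exists:
  assumes f: "f \<in> boundary_space p \<Omega>" and s: "bounded_conductivity s c C"
  shows "\<exists>u\<in>f. \<forall>v\<in>f. energy s u \<le> energy s v"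
proof -
  note fD = boundary_spaceD[OF f]
  define I where "I = (INF u\<in>f. energy s u)"
  have bdd: "bdd_below (energy s ` f)" using energy_nonneg[OF s] by (intro bdd_belowI[of _ 0]) auto
  have I_le: "I \<le> energy s u" if "u \<in> f" for u unfolding I_def using bdd that by (rule cINF_lower)
  have I0: "0 \<le> I" unfolding I_def using fD(1) energy_nonneg[OF s] by (intro cINF_greatest) auto
  have c: "0 < c" using bounded_conductivityD(2)[OF s] .
  define d where "d k = inverse (real (Suc k))" for k
  have d: "0 < d k" "d k \<le> 1" for k by (auto simp: d_def field_simps)
  have dlim: "d \<longlonglongrightarrow> 0" unfolding d_def by (rule LIMSEQ_inverse_real_of_nat)
  have "\<exists>u\<in>f. energy s u < I + d k" for k
    using cINF_less_iff[OF fD(1) bdd, of "I + d k"] d(1)[of k] unfolding I_def by auto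
  then obtain u where u: "\<And>k. u k \<in> f" "\<And>k. energy s (u k) < I + d k" by metis
  have uW: "u k \<in> W" for k using u(1) fD(2) by blast
  note pg = sobolevD(2)[OF uW]
  have cau: "\<exists>N. \<forall>m\<ge>N. \<forall>n\<ge>N. (LINT x|M. norm (grad (u m) x - grad (u n) x) powr p) < e" if "0 < e" for e
  proof -
    define \<eta> where "\<eta> = c * e / (4 * (I + 1))"
    have \<eta>: "0 < \<eta>" using that c I0 by (simp add: \<eta>_def)
    obtain K where K: "0 < K" "\<And>a b::real^'n. norm (a - b) powr p \<le> \<eta> * (norm a powr p + norm b powr p) + K * convexity_defect p a b"
      using uniform_convexity[OF p_gt_1 \<eta>] by blast
    have "eventually (\<lambda>k. d k < c * e / (2 * K)) sequentially"
      by (rule order_tendstoD(2)[OF dlim]) (use c that K in simp)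
    then obtain N where N: "\<And>k. k \<ge> N \<Longrightarrow> d k < c * e / (2 * K)" by (auto simp: eventually_sequentially)
    have "(LINT x|M. norm (grad (u m) x - grad (u n) x) powr p) < e" if mn: "m \<ge> N" "n \<ge> N" for m n
    proof -
      let ?S = "energy s (u m) + energy s (u n)"
      let ?mid = "\<lambda>x. u m x + (1/2) * (u n x - u m x)"
      have "?mid \<in> f" by (rule fD(4)[OF u(1) fD(3)[OF u(1) u(1)]])
      then have mid: "I \<le> energy s ?mid" by (rule I_le)
      have "c * (LINT x|M. norm (grad (u m) x - grad (u n) x) powr p) \<le> \<eta> * ?S + K * (?S / 2 - energy s ?mid)"
        by (rule energy_uniform_convexity[OF s uW uW K(2)])
      also have "\<dots> < \<eta> * (2 * (I + 1)) + K * (c * e / (2 * K))"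
      proof (rule add_le_less_mono)
        show "\<eta> * ?S \<le> \<eta> * (2 * (I + 1))"
          using \<eta> u(2)[of m] u(2)[of n] d(2)[of m] d(2)[of n] by (intro mult_left_mono) auto
        define q where "q = c * e / (2 * K)"
        have "?S / 2 - energy s ?mid < q"
          using u(2)[of m] u(2)[of n] N[OF mn(1)] N[OF mn(2)] mid unfolding q_def[symmetric] by argo
        then show "K * (?S / 2 - energy s ?mid) < K * (c * e / (2 * K))"
          unfolding q_def using K(1) by (rule mult_strict_left_mono)
      qed
      also have "\<dots> = c * e" using I0 K(1) by (simp add: \<eta>_def field_simps)
      finally show ?thesis using c by simp
    qed
    then show ?thesis by blast
  qed
  obtain G r where G: "p_integrable p M G" "strict_mono (r :: nat \<Rightarrow> nat)"
    "AE x in M. (\<lambda>k. grad (u (r k)) x) \<longlonglongrightarrow> G x"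
    "(\<lambda>k. LINT x|M. norm (grad (u k) x - G x) powr p) \<longlonglongrightarrow> 0"
    by (rule p_integrable_complete[OF p_gt_1 pg cau])
  obtain CP where CP: "0 < CP" "\<And>w. w \<in> W0 \<Longrightarrow> (LINT x|M. \<bar>w x\<bar> powr p) \<le> CP * (LINT x|M. norm (grad w x) powr p)"
    using poincare by blast
  have grad_int_cong: "(LINT x|M. norm (grad (\<lambda>x. a x - b x) x) powr p) = (LINT x|M. norm (F x - H x) powr p)"
    if "a \<in> W" "b \<in> W" "p_integrable p M F" "p_integrable p M H" "AE x in M. grad a x = F x" "AE x in M. grad b x = H x"
    for a b F H
  proof (rule p_integral_cong_AE[OF sobolevD(2)[OF sobolev_diff(1)[OF that(1,2)]] p_integrable_diff[OF p_pos that(3,4)]])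
    show "AE x in M. grad (\<lambda>x. a x - b x) x = F x - H x"
      using sobolev_diff(2)[OF that(1,2)] that(5,6) by eventually_elim simp
  qed
  have cau2: "\<exists>N. \<forall>m\<ge>N. \<forall>n\<ge>N. (LINT x|M. norm (u m x - u n x) powr p) < e" if e: "0 < e" for e
  proof -
    obtain N where N: "\<And>m n. m \<ge> N \<Longrightarrow> n \<ge> N \<Longrightarrow> (LINT x|M. norm (grad (u m) x - grad (u n) x) powr p) < e / CP"
      using cau[OF divide_pos_pos[OF e CP(1)]] by blast
    have "(LINT x|M. norm (u m x - u n x) powr p) < e" if "m \<ge> N" "n \<ge> N" for m n
    proof -
      have "(LINT x|M. \<bar>u m x - u n x\<bar> powr p) \<le> CP * (LINT x|M. norm (grad (\<lambda>x. u m x - u n x) x) powr p)"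
        by (rule CP(2)[OF fD(3)[OF u(1) u(1)]])
      also have "(LINT x|M. norm (grad (\<lambda>x. u m x - u n x) x) powr p) = (LINT x|M. norm (grad (u m) x - grad (u n) x) powr p)"
        by (rule grad_int_cong[OF uW uW pg pg]) simp_all
      also have "CP * \<dots> < CP * (e / CP)" using N[OF that] CP(1) by (intro mult_strict_left_mono)
      finally show ?thesis using CP(1) by simp
    qed
    then show ?thesis by blast
  qed
  obtain v r' where v: "p_integrable p M v" "(\<lambda>k. LINT x|M. norm (u k x - v x) powr p) \<longlonglongrightarrow> 0"
    by (rule p_integrable_complete[OF p_gt_1 sobolevD(1)[OF uW] cau2])
  have vW: "v \<in> W" and vG: "AE x in M. grad v x = G x"
    using weak_gradient_limit[OF uW v G(1,4)] by blast+
  have vu0: "(\<lambda>x. v x - u 0 x) \<in> W0"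
  proof (rule sobolev_0_closed[OF sobolev_diff(1)[OF vW uW] fD(3)[OF u(1) u(1)]])
    have "sobolev_modulus (\<lambda>x. (v x - u 0 x) - (u k x - u 0 x)) =
       (LINT x|M. norm (u k x - v x) powr p) + (LINT x|M. norm (grad (u k) x - G x) powr p)" for k
      using grad_int_cong[OF vW uW[of k] G(1) pg vG AE_I2[OF refl]]
      by (simp add: sobolev_modulus_def abs_minus_commute norm_minus_commute)
    then show "(\<lambda>k. sobolev_modulus (\<lambda>x. (v x - u 0 x) - (u k x - u 0 x))) \<longlonglongrightarrow> 0"
      using tendsto_add[OF v(2) G(4)] by simp
  qed
  have vf: "v \<in> f" using fD(4)[OF u(1)[of 0] vu0, of 1] by simp
  have "energy s v \<le> I + e" if e: "0 < e" for e
  proof -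
    have ev: "energy s v = (LINT x|M. \<bar>s x\<bar> * norm (G x) powr p)"
      unfolding energy_cong_gradient[OF s vW G(1) vG]
    proof (rule integral_cong_AE)
      show m: "(\<lambda>x. s x * norm (G x) powr p) \<in> borel_measurable M"
        using weighted_integrable[OF s G(1)] by blast
      show "(\<lambda>x. \<bar>s x\<bar> * norm (G x) powr p) \<in> borel_measurable M"
        using borel_measurable_abs[OF m] by (simp add: abs_mult)
      show "AE x in M. s x * norm (G x) powr p = \<bar>s x\<bar> * norm (G x) powr p"
        using bounded_conductivityD(5)[OF s] by eventually_elim simp
    qed
    have sI: "integrable M (\<lambda>x. \<bar>s x\<bar> * norm (grad (u k) x) powr p)" for k
      using integrable_abs[OF weighted_integrable[OF s pg[of k]]] by (simp add: abs_mult)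
    have sE: "(LINT x|M. \<bar>s x\<bar> * norm (grad (u k) x) powr p) = energy s (u k)" for k
      unfolding p_energy_def
    proof (rule integral_cong_AE)
      show "AE x in M. \<bar>s x\<bar> * norm (grad (u k) x) powr p = s x * norm (grad (u k) x) powr p"
        using bounded_conductivityD(5)[OF s] by eventually_elim simp
    qed (use sI weighted_integrable[OF s pg[of k]] in blast)+
    have "(LINT x|M. \<bar>s x\<bar> * norm (G x) powr p) \<le> I + e"
    proof (rule Fatou_bound(2)[of M "\<lambda>k x. \<bar>s x\<bar> * norm (grad (u (r k)) x) powr p"])
      show "AE x in M. (\<lambda>k. \<bar>s x\<bar> * norm (grad (u (r k)) x) powr p) \<longlonglongrightarrow> \<bar>s x\<bar> * norm (G x) powr p"
        using G(3) by eventually_elim (intro tendsto_mult tendsto_const tendsto_powr' tendsto_norm; use p_pos in simp)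
      show "(\<lambda>x. \<bar>s x\<bar> * norm (G x) powr p) \<in> borel_measurable M"
        using borel_measurable_abs[OF borel_measurable_integrable[OF weighted_integrable[OF s G(1)]]] by (simp add: abs_mult)
      have "eventually (\<lambda>k. d (r k) < e) sequentially"
        using LIMSEQ_subseq_LIMSEQ[OF dlim G(2)] e by (auto simp: o_def dest: order_tendstoD(2))
      then show "eventually (\<lambda>k. (LINT x|M. \<bar>s x\<bar> * norm (grad (u (r k)) x) powr p) \<le> I + e) sequentially"
      proof eventually_elim
        case (elim k)
        then show ?case using u(2)[of "r k"] sE[of "r k"] by simp
      qed
    qed (use sI in simp_all)
    then show ?thesis using ev by simp
  qed
  then have "energy s v \<le> I" by (rule field_le_epsilon)
  then show ?thesis using vf I_le by (meson order_trans)
qed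

lemma dirichlet_solution_minimizes:
  assumes f: "f \<in> boundary_space p \<Omega>" and s: "bounded_conductivity s c C"
  shows "dirichlet_solution p \<Omega> s f \<in> f" "v \<in> f \<Longrightarrow> energy s (dirichlet_solution p \<Omega> s f) \<le> energy s v"
    "dirichlet_solution p \<Omega> s f \<in> W"
proof -
  obtain u where u: "u \<in> f" "\<And>v. v \<in> f \<Longrightarrow> energy s u \<le> energy s v" using minimizer_exists[OF f s] by blast
  then have "is_arg_min (p_energy p \<Omega> s) (\<lambda>x. x \<in> f) u" by (auto simp: is_arg_min_def not_less)
  then have "is_arg_min (p_energy p \<Omega> s) (\<lambda>x. x \<in> f) (dirichlet_solution p \<Omega> s f)"
    unfolding dirichlet_solution_def arg_min_on_def arg_min_def
    by (rule someI[where P="is_arg_min (p_energy p \<Omega> s) (\<lambda>x. x \<in> f)"])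
  then show 1: "dirichlet_solution p \<Omega> s f \<in> f" "v \<in> f \<Longrightarrow> energy s (dirichlet_solution p \<Omega> s f) \<le> energy s v"
    by (auto simp: is_arg_min_def not_less)
  then show "dirichlet_solution p \<Omega> s f \<in> W" using boundary_spaceD(2)[OF f] by blast
qed

section \<open>The Euler--Lagrange equation and the energy form of the Dirichlet-Neumann map\<close>

lemma pflux_inner_bound:
  fixes a b :: "'b::euclidean_space"
  shows "\<bar>pflux p a \<bullet> b\<bar> \<le> norm a powr p + norm b powr p"
proof -
  define m where "m = max (norm a) (norm b)"
  have "\<bar>pflux p a \<bullet> b\<bar> \<le> norm a powr (p - 1) * norm b"
    using Cauchy_Schwarz_ineq2[of "pflux p a" b] p_gt_1 by (simp add: norm_pflux)
  also have "\<dots> \<le> m powr (p - 1) * m" using p_gt_1 by (intro mult_mono powr_mono2) (auto simp: m_def)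
  also have "\<dots> = m powr p"
  proof (cases "m = 0")
    case False
    then have "0 < m" using norm_ge_zero[of a] unfolding m_def by linarith
    then show ?thesis by (simp add: powr_diff)
  qed simp
  also have "\<dots> \<le> norm a powr p + norm b powr p" by (auto simp: m_def max_def)
  finally show ?thesis .
qed

lemma weighted_flux_integrable:
  assumes s: "bounded_conductivity s c C" and F: "p_integrable p M (F :: _ \<Rightarrow> real^'n)" and G: "p_integrable p M G"
  shows "integrable M (\<lambda>x. s x * (pflux p (F x) \<bullet> G x))"
proof -
  note [measurable] = p_integrableD(1)[OF F] p_integrableD(1)[OF G]
  have "integrable M (\<lambda>x. pflux p (F x) \<bullet> G x)"
  proof (rule Bochner_Integration.integrable_bound)
    show "integrable M (\<lambda>x. norm (F x) powr p + norm (G x) powr p)"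
      using p_integrableD(2)[OF F] p_integrableD(2)[OF G] by simp
    show "AE x in M. norm (pflux p (F x) \<bullet> G x) \<le> norm (norm (F x) powr p + norm (G x) powr p)"
      using pflux_inner_bound by (intro AE_I2) simp
  qed measurable
  then show ?thesis by (rule integrable_bounded_mult[OF _ bounded_conductivityD(1,4)[OF s]])
qed

lemma flux_cong_gradient:
  assumes s: "bounded_conductivity s c C" and F: "p_integrable p M F" and w: "w \<in> W"
    and G: "p_integrable p M G" "AE x in M. grad w x = G x"
  shows "(LINT x|M. s x * (pflux p (F x) \<bullet> grad w x)) = (LINT x|M. s x * (pflux p (F x) \<bullet> G x))"
proof (rule integral_cong_AE)
  show "(\<lambda>x. s x * (pflux p (F x) \<bullet> grad w x)) \<in> borel_measurable M"
    using weighted_flux_integrable[OF s F sobolevD(2)[OF w]] by blast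
  show "(\<lambda>x. s x * (pflux p (F x) \<bullet> G x)) \<in> borel_measurable M"
    using weighted_flux_integrable[OF s F G(1)] by blast
  show "AE x in M. s x * (pflux p (F x) \<bullet> grad w x) = s x * (pflux p (F x) \<bullet> G x)"
    using G(2) by eventually_elim simp
qed

text \<open>The tangent inequality at \<open>u + t w\<close> shows that the flux of \<open>u + t w\<close>, tested with \<open>w\<close>, is
  nonnegative for \<open>t > 0\<close>. Letting \<open>t\<close> tend to zero requires only continuity of the flux, and the
  energy need not be differentiated.\<close>

lemma euler_lagrange_nonneg:
  assumes f: "f \<in> boundary_space p \<Omega>" and s: "bounded_conductivity s c C"
    and u: "u \<in> f" "\<And>v. v \<in> f \<Longrightarrow> energy s u \<le> energy s v" and w: "w \<in> W0"
  shows "0 \<le> (LINT x|M. s x * (pflux p (grad u x) \<bullet> grad w x))"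
proof -
  have uW: "u \<in> W" using u boundary_spaceD(2)[OF f] by blast
  have wW: "w \<in> W" by (rule sobolev_0_imp_sobolev[OF w])
  note pu = sobolevD(2)[OF uW] and pw = sobolevD(2)[OF wW]
  note [measurable] = p_integrableD(1)[OF pu] p_integrableD(1)[OF pw] bounded_conductivityD(1)[OF s]
  define t where "t k = inverse (real (Suc k))" for k
  have t: "0 < t k" "t k \<le> 1" for k by (auto simp: t_def field_simps)
  have tlim: "t \<longlonglongrightarrow> 0" unfolding t_def by (rule LIMSEQ_inverse_real_of_nat)
  define F where "F k x = grad u x + t k *\<^sub>R grad w x" for k x
  have pF: "p_integrable p M (F k)" for k
    unfolding F_def by (rule p_integrable_add[OF p_pos pu p_integrable_scaleR[OF pw]])
  have nonneg: "0 \<le> (LINT x|M. s x * (pflux p (F k x) \<bullet> grad w x))" for k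
  proof -
    have "(\<lambda>x. u x + t k * w x) \<in> f" by (rule boundary_spaceD(4)[OF f u(1) w])
    then have "energy s u \<le> energy s (\<lambda>x. u x + t k * w x)" by (rule u(2))
    also have "\<dots> = (LINT x|M. s x * norm (F k x) powr p)"
      using energy_cong_gradient[OF s sobolev_lincomb(1)[OF uW wW] pF[of k], of "t k"] sobolev_lincomb(2)[OF uW wW, of "t k"]
      by (simp add: F_def)
    finally have le: "energy s u \<le> (LINT x|M. s x * norm (F k x) powr p)" .
    note I = weighted_integrable[OF s pF[of k]] weighted_flux_integrable[OF s pF pw, of k]
    have "(LINT x|M. s x * norm (F k x) powr p - p * t k * (s x * (pflux p (F k x) \<bullet> grad w x))) \<le> energy s u"
      unfolding p_energy_def
    proof (rule integral_mono_AE)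
      show "AE x in M. s x * norm (F k x) powr p - p * t k * (s x * (pflux p (F k x) \<bullet> grad w x)) \<le> s x * norm (grad u x) powr p"
        using bounded_conductivityD(5)[OF s]
      proof eventually_elim
        case (elim x)
        have "s x * (norm (F k x) powr p + p * (pflux p (F k x) \<bullet> (grad u x - F k x))) \<le> s x * norm (grad u x) powr p"
          using elim norm_powr_tangent[OF p_gt_1] by (intro mult_left_mono) auto
        moreover have "grad u x - F k x = - t k *\<^sub>R grad w x" by (simp add: F_def)
        ultimately show ?case by (simp add: algebra_simps)
      qed
    qed (use I weighted_integrable[OF s pu] in auto)
    then have "(LINT x|M. s x * norm (F k x) powr p) - p * t k * (LINT x|M. s x * (pflux p (F k x) \<bullet> grad w x)) \<le> energy s u"
      using I by simp
    with le have "0 \<le> p * t k * (LINT x|M. s x * (pflux p (F k x) \<bullet> grad w x))" by linarith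
    then show ?thesis using mult_pos_pos[OF p_pos t(1)[of k]] by (auto simp: zero_le_mult_iff)
  qed
  have "(\<lambda>k. LINT x|M. s x * (pflux p (F k x) \<bullet> grad w x)) \<longlonglongrightarrow> (LINT x|M. s x * (pflux p (grad u x) \<bullet> grad w x))"
  proof (rule integral_dominated_convergence)
    let ?b = "\<lambda>x. \<bar>C\<bar> * (2 powr p * (norm (grad u x) powr p + norm (grad w x) powr p) + norm (grad w x) powr p)"
    show "integrable M ?b" using p_integrableD(2)[OF pu] p_integrableD(2)[OF pw] by simp
    show "AE x in M. (\<lambda>k. s x * (pflux p (F k x) \<bullet> grad w x)) \<longlonglongrightarrow> s x * (pflux p (grad u x) \<bullet> grad w x)"
    proof (rule AE_I2)
      fix x
      have "(\<lambda>k. F k x) \<longlonglongrightarrow> grad u x + 0 *\<^sub>R grad w x" unfolding F_def by (intro tendsto_intros tlim)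
      then have "(\<lambda>k. F k x) \<longlonglongrightarrow> grad u x" by simp
      then have "(\<lambda>k. pflux p (F k x)) \<longlonglongrightarrow> pflux p (grad u x)" by (rule isCont_tendsto_compose[OF continuous_pflux[OF p_gt_1]])
      then show "(\<lambda>k. s x * (pflux p (F k x) \<bullet> grad w x)) \<longlonglongrightarrow> s x * (pflux p (grad u x) \<bullet> grad w x)"
        by (intro tendsto_intros)
    qed
    show "AE x in M. norm (s x * (pflux p (F k x) \<bullet> grad w x)) \<le> ?b x" for k
      using bounded_conductivityD(4)[OF s]
    proof eventually_elim
      case (elim x)
      have "norm (t k *\<^sub>R grad w x) powr p \<le> norm (grad w x) powr p"
        using t[of k] p_pos by (intro powr_mono2) (auto simp: mult_left_le_one_le)
      then have "2 powr p * (norm (grad u x) powr p + norm (t k *\<^sub>R grad w x) powr p)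
         \<le> 2 powr p * (norm (grad u x) powr p + norm (grad w x) powr p)"
        by (intro mult_left_mono) auto
      then have "\<bar>pflux p (F k x) \<bullet> grad w x\<bar> \<le> 2 powr p * (norm (grad u x) powr p + norm (grad w x) powr p) + norm (grad w x) powr p"
        using pflux_inner_bound[of "F k x" "grad w x"] norm_add_powr_le[OF p_pos, of "grad u x" "t k *\<^sub>R grad w x"]
        unfolding F_def by linarith
      then have "\<bar>s x\<bar> * \<bar>pflux p (F k x) \<bullet> grad w x\<bar> \<le> ?b x"
        using elim by (intro mult_mono) auto
      then show ?case by (simp add: abs_mult)
    qed
  qed (use borel_measurable_integrable[OF weighted_flux_integrable[OF s pF pw]]
        borel_measurable_integrable[OF weighted_flux_integrable[OF s pu pw]] in simp_all)
  then show ?thesis by (rule LIMSEQ_le_const) (use nonneg in auto)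
qed

lemma euler_lagrange:
  assumes f: "f \<in> boundary_space p \<Omega>" and s: "bounded_conductivity s c C"
    and u: "u \<in> f" "\<And>v. v \<in> f \<Longrightarrow> energy s u \<le> energy s v" and w: "w \<in> W0"
  shows "(LINT x|M. s x * (pflux p (grad u x) \<bullet> grad w x)) = 0"
proof -
  have uW: "u \<in> W" using u boundary_spaceD(2)[OF f] by blast
  have wW: "w \<in> W" by (rule sobolev_0_imp_sobolev[OF w])
  have n0: "(\<lambda>x. 0 - w x) \<in> W0" by (rule sobolev_0_diff[OF sobolev_0_zero w])
  have "AE x in M. grad (\<lambda>x. 0::real) x = 0"
    using C1_imp_sobolev(2)[of "\<lambda>x. 0" "\<lambda>x. 0"] by simp
  with sobolev_diff(2)[OF sobolev_0_imp_sobolev[OF sobolev_0_zero] wW]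
  have g: "AE x in M. grad (\<lambda>x. 0 - w x) x = (-1) *\<^sub>R grad w x" by eventually_elim simp
  have "0 \<le> (LINT x|M. s x * (pflux p (grad u x) \<bullet> grad (\<lambda>x. 0 - w x) x))"
    by (rule euler_lagrange_nonneg[OF f s u n0])
  also have "\<dots> = (LINT x|M. s x * (pflux p (grad u x) \<bullet> ((-1) *\<^sub>R grad w x)))"
    by (rule flux_cong_gradient[OF s sobolevD(2)[OF uW] sobolev_0_imp_sobolev[OF n0] p_integrable_scaleR[OF sobolevD(2)[OF wW]] g])
  also have "\<dots> = - (LINT x|M. s x * (pflux p (grad u x) \<bullet> grad w x))" by simp
  finally show ?thesis using euler_lagrange_nonneg[OF f s u w] by simp
qed

text \<open>The Euler--Lagrange equation is applied to \<open>v - u\<close>, which has zero boundary values. Hence the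
  pairing does not depend on the representative \<open>v\<close>, and \<open>v = u\<close> gives the energy.\<close>

lemma flux_pairing:
  assumes f: "f \<in> boundary_space p \<Omega>" and s: "bounded_conductivity s c C"
    and u: "u \<in> f" "\<And>v. v \<in> f \<Longrightarrow> energy s u \<le> energy s v" and v: "v \<in> f"
  shows "(LINT x|M. s x * (pflux p (grad u x) \<bullet> grad v x)) = energy s u"
proof -
  have W: "u \<in> W" "v \<in> W" using u v boundary_spaceD(2)[OF f] by blast+
  note pu = sobolevD(2)[OF W(1)] and pv = sobolevD(2)[OF W(2)]
  have w: "(\<lambda>x. v x - u x) \<in> W0" by (rule boundary_spaceD(3)[OF f u(1) v])
  have "0 = (LINT x|M. s x * (pflux p (grad u x) \<bullet> grad (\<lambda>x. v x - u x) x))"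
    using euler_lagrange[OF f s u w] by simp
  also have "\<dots> = (LINT x|M. s x * (pflux p (grad u x) \<bullet> (grad v x - grad u x)))"
    by (rule flux_cong_gradient[OF s pu sobolev_diff(1)[OF W(2,1)] p_integrable_diff[OF p_pos pv pu] sobolev_diff(2)[OF W(2,1)]])
  also have "\<dots> = (LINT x|M. s x * (pflux p (grad u x) \<bullet> grad v x)) - (LINT x|M. s x * (pflux p (grad u x) \<bullet> grad u x))"
    using weighted_flux_integrable[OF s pu pv] weighted_flux_integrable[OF s pu pu]
    by (simp add: inner_diff_right right_diff_distrib)
  also have "(LINT x|M. s x * (pflux p (grad u x) \<bullet> grad u x)) = energy s u"
    by (simp add: p_energy_def pflux_inner_self p_gt_1)
  finally show ?thesis by simp
qed

lemma DN_map_eq_energy: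
  assumes f: "f \<in> boundary_space p \<Omega>" and s: "bounded_conductivity s c C"
  shows "DN_map p \<Omega> s f f = energy s (dirichlet_solution p \<Omega> s f)"
proof -
  note sol = dirichlet_solution_minimizes[OF f s]
  have "(SOME v. v \<in> f) \<in> f" using boundary_spaceD(1)[OF f] by (simp add: some_in_eq)
  from flux_pairing[OF f s sol(1,2) this] show ?thesis
    by (simp add: DN_map_def Let_def pflux_def mult.assoc)
qed

lemma DN_map_set_eq:
  assumes f: "f \<in> boundary_space p \<Omega>" and B: "B \<in> sets lebesgue" "B \<subseteq> \<Omega>"
  shows "DN_map_set p \<Omega> B f f =
    (LINT x|M. indicator B x * norm (grad (u0 f) x) powr p)"
proof -
  let ?h = "\<lambda>x. norm (grad (u0 f) x) powr p"
  have "DN_map_set p \<Omega> B f f = (LINT x|lebesgue_on B. ?h x)"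
    by (simp add: DN_map_set_def powr_minus_two_mult_square p_gt_1)
  also have "\<dots> = (LINT x|lebesgue. indicator B x *\<^sub>R ?h x)"
    using B by (intro integral_restrict_space) simp
  also have "(\<lambda>x. indicator B x *\<^sub>R ?h x) = (\<lambda>x. indicator \<Omega> x *\<^sub>R (indicator B x * ?h x))"
    using B by (auto simp: fun_eq_iff indicator_def)
  also have "(LINT x|lebesgue. indicator \<Omega> x *\<^sub>R (indicator B x * ?h x)) = (LINT x|M. indicator B x * ?h x)"
    by (intro integral_restrict_space[symmetric]) simp
  finally show ?thesis .
qed

text \<open>The minimizer for the conductivity \<open>1\<close> competes in the minimization for \<open>s\<close>.\<close>

lemma DN_map_diff_le:
  assumes f: "f \<in> boundary_space p \<Omega>" and s: "bounded_conductivity s c C"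
  shows "DN_map p \<Omega> s f f - DN_map_0 p \<Omega> f f
     \<le> (LINT x|M. (s x - 1) * norm (grad (u0 f) x) powr p)"
proof -
  note sol = dirichlet_solution_minimizes[OF f s] and sol0 = dirichlet_solution_minimizes[OF f bounded_conductivity_1]
  let ?u = "u0 f"
  have "DN_map p \<Omega> s f f \<le> energy s ?u" unfolding DN_map_eq_energy[OF f s] by (rule sol(2)[OF sol0(1)])
  moreover have "DN_map_0 p \<Omega> f f = energy (\<lambda>x. 1) ?u"
    unfolding DN_map_0_def by (rule DN_map_eq_energy[OF f bounded_conductivity_1])
  moreover have "energy s ?u - energy (\<lambda>x. 1) ?u = (LINT x|M. (s x - 1) * norm (grad ?u x) powr p)"
    using weighted_integrable[OF s sobolevD(2)[OF sol0(3)]] p_integrableD(2)[OF sobolevD(2)[OF sol0(3)]]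
    by (simp add: p_energy_def left_diff_distrib)
  ultimately show ?thesis by simp
qed

lemma powr_conductivity_bound:
  assumes "bounded_conductivity s c C"
  shows "(\<lambda>x. s x powr (- 1 / (p - 1))) \<in> borel_measurable M" "AE x in M. \<bar>s x powr (- 1 / (p - 1))\<bar> \<le> c powr (- 1 / (p - 1))"
proof -
  note [measurable] = bounded_conductivityD(1)[OF assms]
  show "(\<lambda>x. s x powr (- 1 / (p - 1))) \<in> borel_measurable M" by measurable
  show "AE x in M. \<bar>s x powr (- 1 / (p - 1))\<bar> \<le> c powr (- 1 / (p - 1))"
    using bounded_conductivityD(3)[OF assms]
    by eventually_elim (use bounded_conductivityD(2)[OF assms] p_gt_1 in \<open>auto intro!: powr_mono2' simp: field_simps\<close>)
qed

text \<open>Young's inequality with weight \<open>s\<close> is applied to the flux of the minimizer for the conductivity \<open>1\<close>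
  and the gradient of the minimizer for \<open>s\<close>. Their pairing is the energy of the former, since both
  functions have the same boundary values.\<close>

lemma DN_map_diff_ge:
  assumes f: "f \<in> boundary_space p \<Omega>" and s: "bounded_conductivity s c C"
  shows "(p - 1) * (LINT x|M. (1 - s x powr (- 1 / (p - 1))) * norm (grad (u0 f) x) powr p)
     \<le> DN_map p \<Omega> s f f - DN_map_0 p \<Omega> f f"
proof -
  note sol = dirichlet_solution_minimizes[OF f s] and sol0 = dirichlet_solution_minimizes[OF f bounded_conductivity_1]
  let ?a = "grad (u0 f)" and ?b = "grad (dirichlet_solution p \<Omega> s f)"
  note pa = sobolevD(2)[OF sol0(3)] and pb = sobolevD(2)[OF sol(3)]
  have D0: "DN_map_0 p \<Omega> f f = (LINT x|M. norm (?a x) powr p)"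
    unfolding DN_map_0_def DN_map_eq_energy[OF f bounded_conductivity_1] by (simp add: p_energy_def)
  have pair: "(LINT x|M. pflux p (?a x) \<bullet> ?b x) = (LINT x|M. norm (?a x) powr p)"
    using flux_pairing[OF f bounded_conductivity_1 sol0(1,2) sol(1)] by (simp add: p_energy_def)
  have I: "integrable M (\<lambda>x. pflux p (?a x) \<bullet> ?b x)"
    using weighted_flux_integrable[OF bounded_conductivity_1 pa pb] by simp
  have Ia: "integrable M (\<lambda>x. norm (?a x) powr p)" using p_integrableD(2)[OF pa] .
  have Is: "integrable M (\<lambda>x. s x powr (- 1 / (p - 1)) * norm (?a x) powr p)"
    by (rule integrable_bounded_mult[OF Ia powr_conductivity_bound[OF s]])
  have "(LINT x|M. p * (pflux p (?a x) \<bullet> ?b x) - (p - 1) * (s x powr (- 1 / (p - 1)) * norm (?a x) powr p))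
      \<le> (LINT x|M. s x * norm (?b x) powr p)"
  proof (rule integral_mono_AE)
    show "AE x in M. p * (pflux p (?a x) \<bullet> ?b x) - (p - 1) * (s x powr (- 1 / (p - 1)) * norm (?a x) powr p)
        \<le> s x * norm (?b x) powr p"
      using bounded_conductivityD(3)[OF s]
    proof eventually_elim
      case (elim x)
      then have "0 < s x" using bounded_conductivityD(2)[OF s] by linarith
      from pflux_young[OF p_gt_1 this, of "?a x" "?b x"] show ?case by (simp add: mult.assoc)
    qed
  qed (use I Is weighted_integrable[OF s pb] in auto)
  then have "p * (LINT x|M. norm (?a x) powr p) - (p - 1) * (LINT x|M. s x powr (- 1 / (p - 1)) * norm (?a x) powr p) \<le> DN_map p \<Omega> s f f"
    using I Is pair unfolding DN_map_eq_energy[OF f s] p_energy_def by simp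
  moreover have "(LINT x|M. (1 - s x powr (- 1 / (p - 1))) * norm (?a x) powr p) =
     (LINT x|M. norm (?a x) powr p) - (LINT x|M. s x powr (- 1 / (p - 1)) * norm (?a x) powr p)"
    using Ia Is by (simp add: left_diff_distrib)
  moreover have "z = x - y \<Longrightarrow> p * x - (p - 1) * y \<le> d \<Longrightarrow> (p - 1) * z \<le> d - x" for x y z d :: real
    by hypsubst (simp add: algebra_simps)
  ultimately show ?thesis unfolding D0 by blast
qed

text \<open>By the tangent inequality a weak solution minimizes the energy. The midpoint of two minimizers is
  no better than either of them, so by uniform convexity their gradients agree.\<close>

lemma weak_solution_gradient:
  assumes f: "f \<in> boundary_space p \<Omega>" and u: "u \<in> f"
    and weak: "\<And>w. w \<in> W0 \<Longrightarrow> (LINT x|M. pflux p (grad u x) \<bullet> grad w x) = 0"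
  shows "AE x in M. grad (u0 f) x = grad u x"
proof -
  let ?s = "\<lambda>x::real^'n. 1::real"
  note sol = dirichlet_solution_minimizes[OF f bounded_conductivity_1]
  define v where "v = dirichlet_solution p \<Omega> ?s f"
  have uW: "u \<in> W" using u boundary_spaceD(2)[OF f] by blast
  note pu = sobolevD(2)[OF uW]
  have min: "energy ?s u \<le> energy ?s z" if z: "z \<in> f" for z
  proof -
    have zW: "z \<in> W" using z boundary_spaceD(2)[OF f] by blast
    note pz = sobolevD(2)[OF zW]
    have "0 = (LINT x|M. ?s x * (pflux p (grad u x) \<bullet> grad (\<lambda>x. z x - u x) x))"
      using weak[OF boundary_spaceD(3)[OF f u z]] by simp
    also have "\<dots> = (LINT x|M. ?s x * (pflux p (grad u x) \<bullet> (grad z x - grad u x)))"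
      by (rule flux_cong_gradient[OF bounded_conductivity_1 pu sobolev_diff(1)[OF zW uW] p_integrable_diff[OF p_pos pz pu] sobolev_diff(2)[OF zW uW]])
    finally have z0: "(LINT x|M. pflux p (grad u x) \<bullet> (grad z x - grad u x)) = 0" by simp
    have I: "integrable M (\<lambda>x. pflux p (grad u x) \<bullet> (grad z x - grad u x))"
      using weighted_flux_integrable[OF bounded_conductivity_1 pu p_integrable_diff[OF p_pos pz pu]] by simp
    have "(LINT x|M. norm (grad u x) powr p + p * (pflux p (grad u x) \<bullet> (grad z x - grad u x))) \<le> (LINT x|M. norm (grad z x) powr p)"
      using I p_integrableD(2)[OF pu] p_integrableD(2)[OF pz] norm_powr_tangent[OF p_gt_1]
      by (intro integral_mono) auto
    then show ?thesis using I z0 p_integrableD(2)[OF pu] by (simp add: p_energy_def)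
  qed
  have vf: "v \<in> f" and vW: "v \<in> W" using sol by (auto simp: v_def)
  have ev: "energy ?s v = energy ?s u" using sol(2)[OF u] min[OF vf] by (simp add: v_def)
  define A where "A = (LINT x|M. norm (grad v x - grad u x) powr p)"
  have mid: "energy ?s u \<le> energy ?s (\<lambda>x. v x + (1/2) * (u x - v x))"
    by (rule min, rule boundary_spaceD(4)[OF f vf boundary_spaceD(3)[OF f vf u]])
  have E0: "0 \<le> energy ?s u" by (rule energy_nonneg[OF bounded_conductivity_1])
  have "A \<le> 0 + e" if e: "0 < e" for e
  proof -
    define \<eta> where "\<eta> = e / (2 * energy ?s u + 1)"
    have \<eta>: "0 < \<eta>" using e E0 by (simp add: \<eta>_def)
    obtain K where K: "0 < K" "\<And>a b::real^'n. norm (a - b) powr p \<le> \<eta> * (norm a powr p + norm b powr p) + K * convexity_defect p a b"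
      using uniform_convexity[OF p_gt_1 \<eta>] by blast
    have "1 * A \<le> \<eta> * (energy ?s v + energy ?s u) + K * ((energy ?s v + energy ?s u) / 2 - energy ?s (\<lambda>x. v x + (1/2) * (u x - v x)))"
      unfolding A_def by (rule energy_uniform_convexity[OF bounded_conductivity_1 vW uW K(2)])
    also have "\<dots> \<le> \<eta> * (2 * energy ?s u) + K * 0"
      using mid K(1) ev \<eta> by (intro add_mono mult_left_mono) auto
    also have "\<dots> \<le> \<eta> * (2 * energy ?s u + 1)" using \<eta> by (simp add: algebra_simps)
    also have "\<dots> = e" using E0 by (simp add: \<eta>_def)
    finally show ?thesis by simp
  qed
  then have "A \<le> 0" by (rule field_le_epsilon)
  moreover have "0 \<le> A" by (simp add: A_def)
  ultimately have "A = 0" by simp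
  moreover have "integrable M (\<lambda>x. norm (grad v x - grad u x) powr p)"
    by (rule p_integrableD(2)[OF p_integrable_diff[OF p_pos sobolevD(2)[OF vW] pu]])
  ultimately have "AE x in M. norm (grad v x - grad u x) powr p = 0"
    unfolding A_def by (subst (asm) integral_nonneg_eq_0_iff_AE) auto
  then show ?thesis unfolding v_def by eventually_elim simp
qed

end

section \<open>Wolff's exponential solutions\<close>

text \<open>Expansion makes the inverse Lipschitz, hence continuous, and a continuous inverse is
  differentiable.\<close>

lemma real_inverse_of_expanding:
  fixes Z q :: "real \<Rightarrow> real"
  assumes der: "\<And>t. (Z has_real_derivative q t) (at t)" and m: "0 < m" "\<And>t. m \<le> q t"
  obtains g where "\<And>y. Z (g y) = y" "\<And>y. (g has_real_derivative inverse (q (g y))) (at y)"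
proof -
  have grow: "m * (b - a) \<le> Z b - Z a" if "a \<le> b" for a b
  proof (cases "a = b")
    case False
    then have "a < b" using that by simp
    then obtain z where "Z b - Z a = (b - a) * q z"
      using MVT2[of a b Z q] der by blast
    then show ?thesis using mult_right_mono[OF m(2)[of z], of "b - a"] that by (simp add: mult.commute)
  qed simp
  have cont: "isCont Z t" for t using der by (rule DERIV_isCont)
  have "\<exists>t. Z t = y" for y
  proof -
    define T where "T = \<bar>y - Z 0\<bar> / m"
    have T: "0 \<le> T" "m * T = \<bar>y - Z 0\<bar>" using m(1) by (auto simp: T_def)
    have "Z (- T) \<le> y" "y \<le> Z T" using grow[of "- T" 0] grow[of 0 T] T by auto
    then show ?thesis using IVT[of Z "- T" y T] cont T(1) by auto
  qed
  then obtain g where g: "\<And>y. Z (g y) = y" by metis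
  have lip: "\<bar>g x - g y\<bar> \<le> \<bar>x - y\<bar> / m" for x y
    using grow[of "g x" "g y"] grow[of "g y" "g x"] m(1) g
    by (cases "g x \<le> g y") (auto simp: field_simps)
  have gc: "isCont g y" for y
  proof -
    have "((\<lambda>x. \<bar>x - y\<bar> / m) \<longlongrightarrow> \<bar>y - y\<bar> / m) (at y)" by (intro tendsto_intros) (use m in auto)
    then have "((\<lambda>x. g x - g y) \<longlongrightarrow> 0) (at y)"
      by (intro Lim_null_comparison[of "\<lambda>x. g x - g y" "\<lambda>x. \<bar>x - y\<bar> / m"]) (auto simp: lip)
    then show ?thesis by (simp add: isCont_def LIM_zero_iff)
  qed
  have "(g has_real_derivative inverse (q (g y))) (at y)" for y
    by (rule DERIV_inverse_function[where f=Z and a="y - 1" and b="y + 1"])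
      (use der g gc m(1) m(2)[of "g y"] in auto)
  with g show ?thesis by (rule that)
qed

text \<open>The function \<open>exp (x \<bullet> r) w(x \<bullet> b)\<close>, with \<open>r\<close> and \<open>b\<close> orthogonal and of equal length, solves the
  \<open>p\<close>-Laplace equation if \<open>w\<close> solves a certain ordinary differential equation. In polar coordinates
  \<open>w = g cos \<theta>\<close>, \<open>w' = g sin \<theta>\<close> of the phase plane this equation decouples and is integrated
  explicitly: \<open>\<theta>' = - 1 / q(\<theta>)\<close> makes \<open>\<theta>\<close> the inverse of an elementary function, and \<open>g\<close> is a bounded
  function of \<open>\<theta>\<close>. The fourth property says that \<open>g sin \<theta>\<close> is indeed \<open>w'\<close>; the fifth is the
  differential equation, written for the two components of the flux.\<close>

lemma wolff_profile:
  fixes p :: real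
  assumes p: "1 < p"
  obtains g \<theta> c C where "0 < c" "\<And>y. c \<le> g y" "\<And>y. g y \<le> C"
    "\<And>y. ((\<lambda>y. g y * cos (\<theta> y)) has_real_derivative g y * sin (\<theta> y)) (at y)"
    "\<And>y. ((\<lambda>y. g y powr (p - 1) * sin (\<theta> y)) has_real_derivative - (p - 1) * (g y powr (p - 1) * cos (\<theta> y))) (at y)"
    "\<And>y. \<exists>D. (g has_real_derivative D) (at y)" "\<And>y. \<exists>D. (\<theta> has_real_derivative D) (at y)"
proof -
  define q where "q t = (sin t)\<^sup>2 + (cos t)\<^sup>2 / (p - 1)" for t
  define Z where "Z t = (p * t / 2 - (p - 2) * (sin t * cos t) / 2) / (p - 1)" for t
  have dZ: "(Z has_real_derivative q t) (at t)" for t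
  proof -
    have "(Z has_real_derivative (p / 2 - (p - 2) * (cos t * cos t + sin t * (- sin t)) / 2) / (p - 1)) (at t)"
      unfolding Z_def[abs_def] using p by (auto intro!: derivative_eq_intros)
    also have "(p / 2 - (p - 2) * (cos t * cos t + sin t * (- sin t)) / 2) / (p - 1) = q t"
    proof -
      have cc: "cos t * cos t = 1 - sin t * sin t"
        using sin_cos_squared_add[of t] by (simp add: power2_eq_square)
      have "p / 2 - (p - 2) * (cos t * cos t + sin t * (- sin t)) / 2 = (p - 1) * (sin t)\<^sup>2 + (cos t)\<^sup>2"
        unfolding power2_eq_square cc by (simp add: field_simps)
      also have "\<dots> = (p - 1) * q t" using p by (simp add: q_def field_simps)
      finally show ?thesis using p by simp
    qed
    finally show ?thesis .
  qed
  define m where "m = min 1 (1 / (p - 1))"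
  have m: "0 < m" "m \<le> q t" for t
  proof -
    show "0 < m" using p by (simp add: m_def)
    have "m * ((sin t)\<^sup>2 + (cos t)\<^sup>2) \<le> 1 * (sin t)\<^sup>2 + 1 / (p - 1) * (cos t)\<^sup>2"
      unfolding distrib_left by (intro add_mono mult_right_mono) (auto simp: m_def)
    then show "m \<le> q t" by (simp add: q_def)
  qed
  obtain h where h: "\<And>y. Z (h y) = y" "\<And>y. (h has_real_derivative inverse (q (h y))) (at y)"
    using real_inverse_of_expanding[OF dZ m] by blast
  define \<theta> where "\<theta> y = h (- y)" for y
  have d\<theta>: "(\<theta> has_real_derivative - inverse (q (\<theta> y))) (at y)" for y
  proof -
    have "((\<lambda>y. h (- y)) has_real_derivative inverse (q (h (- y))) * (- 1)) (at y)"
      by (rule DERIV_chain2[where f=h and g=uminus, OF h(2)]) (auto intro!: derivative_eq_intros)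
    then show ?thesis by (simp add: \<theta>_def[abs_def])
  qed
  have dexp: "((\<lambda>y. exp (- K / 2 * (cos (\<theta> y))\<^sup>2)) has_real_derivative
      - inverse (q (\<theta> y)) * (K * sin (\<theta> y) * cos (\<theta> y)) * exp (- K / 2 * (cos (\<theta> y))\<^sup>2)) (at y)" for K y
    using DERIV_fun_exp[OF DERIV_cmult[OF DERIV_power[OF DERIV_chain2[OF DERIV_cos d\<theta>], of 2]], of "- K / 2" y]
    by (simp add: algebra_simps)
  have q0: "q t \<noteq> 0" for t using m(1) m(2)[of t] by linarith
  define k where "k = (p - 2) / (p - 1)"
  define g where "g y = exp (- k / 2 * (cos (\<theta> y))\<^sup>2)" for y
  have dg: "(g has_real_derivative - inverse (q (\<theta> y)) * (k * sin (\<theta> y) * cos (\<theta> y)) * g y) (at y)" for y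
    unfolding g_def[abs_def] by (rule dexp)
  have kq: "1 - k * (cos t)\<^sup>2 = q t" for t
  proof -
    have "1 - k * (cos t)\<^sup>2 = ((sin t)\<^sup>2 + (cos t)\<^sup>2) - k * (cos t)\<^sup>2" by simp
    also have "\<dots> = (sin t)\<^sup>2 + (1 - k) * (cos t)\<^sup>2" by (simp add: algebra_simps del: sin_cos_squared_add)
    also have "1 - k = 1 / (p - 1)" using p by (simp add: k_def field_simps)
    finally show ?thesis by (simp add: q_def)
  qed
  have w: "((\<lambda>y. g y * cos (\<theta> y)) has_real_derivative g y * sin (\<theta> y)) (at y)" for y
  proof -
    have "((\<lambda>y. g y * cos (\<theta> y)) has_real_derivative
       - inverse (q (\<theta> y)) * (k * sin (\<theta> y) * cos (\<theta> y)) * g y * cos (\<theta> y) +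
       - sin (\<theta> y) * (- inverse (q (\<theta> y))) * g y) (at y)"
      by (rule DERIV_mult[OF dg DERIV_chain2[OF DERIV_cos d\<theta>]])
    also have "- inverse (q (\<theta> y)) * (k * sin (\<theta> y) * cos (\<theta> y)) * g y * cos (\<theta> y) +
       - sin (\<theta> y) * (- inverse (q (\<theta> y))) * g y = inverse (q (\<theta> y)) * (g y * sin (\<theta> y)) * (1 - k * (cos (\<theta> y))\<^sup>2)"
      by (simp add: power2_eq_square algebra_simps)
    also have "\<dots> = g y * sin (\<theta> y)" unfolding kq using q0[of "\<theta> y"] by simp
    finally show ?thesis .
  qed
  have gpow: "g y powr (p - 1) = exp (- (p - 2) / 2 * (cos (\<theta> y))\<^sup>2)" for y
  proof -
    have "(p - 1) * k = p - 2" using p by (simp add: k_def)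
    then have "(p - 1) * (- k / 2 * (cos (\<theta> y))\<^sup>2) = - (p - 2) / 2 * (cos (\<theta> y))\<^sup>2"
      by (simp add: mult.assoc[symmetric]) (simp add: algebra_simps)
    then show ?thesis unfolding g_def powr_def by simp
  qed
  have f: "((\<lambda>y. g y powr (p - 1) * sin (\<theta> y)) has_real_derivative - (p - 1) * (g y powr (p - 1) * cos (\<theta> y))) (at y)" for y
  proof -
    let ?G = "\<lambda>y. exp (- (p - 2) / 2 * (cos (\<theta> y))\<^sup>2)"
    have dG: "(?G has_real_derivative - inverse (q (\<theta> y)) * ((p - 2) * sin (\<theta> y) * cos (\<theta> y)) * ?G y) (at y)"
      by (rule dexp)
    have "((\<lambda>y. ?G y * sin (\<theta> y)) has_real_derivative
      - inverse (q (\<theta> y)) * ((p - 2) * sin (\<theta> y) * cos (\<theta> y)) * ?G y * sin (\<theta> y) +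
       cos (\<theta> y) * (- inverse (q (\<theta> y))) * ?G y) (at y)"
      by (rule DERIV_mult[OF dG DERIV_chain2[OF DERIV_sin d\<theta>]])
    also have "- inverse (q (\<theta> y)) * ((p - 2) * sin (\<theta> y) * cos (\<theta> y)) * ?G y * sin (\<theta> y) +
       cos (\<theta> y) * (- inverse (q (\<theta> y))) * ?G y
       = - inverse (q (\<theta> y)) * (?G y * cos (\<theta> y)) * (1 + (p - 2) * (sin (\<theta> y))\<^sup>2)"
      by (simp add: power2_eq_square algebra_simps)
    also have "1 + (p - 2) * (sin (\<theta> y))\<^sup>2 = (p - 1) * q (\<theta> y)"
    proof -
      have "1 + (p - 2) * (sin (\<theta> y))\<^sup>2 = ((sin (\<theta> y))\<^sup>2 + (cos (\<theta> y))\<^sup>2) + (p - 2) * (sin (\<theta> y))\<^sup>2" by simp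
      also have "\<dots> = (p - 1) * (sin (\<theta> y))\<^sup>2 + (cos (\<theta> y))\<^sup>2" by (simp add: algebra_simps del: sin_cos_squared_add)
      also have "\<dots> = (p - 1) * q (\<theta> y)" using p by (simp add: q_def field_simps)
      finally show ?thesis .
    qed
    also have "- inverse (q (\<theta> y)) * (?G y * cos (\<theta> y)) * ((p - 1) * q (\<theta> y)) = - (p - 1) * (?G y * cos (\<theta> y))"
    proof -
      have "- inverse a * X * ((p - 1) * a) = - (p - 1) * X" if "a \<noteq> 0" for a X :: real
        using that by (simp add: field_simps)
      then show ?thesis using q0 by blast
    qed
    finally show ?thesis unfolding gpow .
  qed
  have kc: "\<bar>k * (cos t)\<^sup>2 / 2\<bar> \<le> \<bar>k\<bar>" for t
  proof -
    have "(cos t)\<^sup>2 \<le> 1" by (simp add: abs_square_le_1)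
    then have "\<bar>k\<bar> * (cos t)\<^sup>2 \<le> \<bar>k\<bar>" by (simp add: mult_left_le)
    then show ?thesis using abs_ge_zero[of k] by (simp add: abs_mult)
  qed
  have c: "0 < exp (- \<bar>k\<bar>)" "exp (- \<bar>k\<bar>) \<le> g y" "g y \<le> exp \<bar>k\<bar>" for y
    using kc[of "\<theta> y"] by (auto simp: g_def)
  show ?thesis by (rule that[of "exp (- \<bar>k\<bar>)" g "exp \<bar>k\<bar>" \<theta>]) (use c w f dg d\<theta> in blast)+
qed

context bounded_domain
begin

text \<open>The vector field is bounded on the domain, so the identity extends from test functions to their
  closure.\<close>

lemma weak_solution_by_density:
  assumes V: "continuous_on UNIV V"
    and zero: "\<And>\<phi>. \<phi> \<in> test_functions \<Omega> \<Longrightarrow> (LINT x|M. V x \<bullet> (\<chi> i. partial_deriv i \<phi> x)) = 0"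
    and w: "w \<in> W0"
  shows "(LINT x|M. V x \<bullet> grad w x) = 0"
proof -
  obtain B where B: "\<And>x. x \<in> \<Omega> \<Longrightarrow> norm (V x) \<le> B" using continuous_imp_measurable_bounded(2)[OF V] by blast
  have Vm [measurable]: "V \<in> borel_measurable M" by (rule continuous_imp_measurable_bounded(1)[OF V])
  obtain \<phi> where \<phi>: "\<And>k. \<phi> k \<in> test_functions \<Omega>" "(\<lambda>k. sobolev_modulus (\<lambda>x. w x - \<phi> k x)) \<longlonglongrightarrow> 0"
    using sobolev_0_approx[OF w] by blast
  have wW: "w \<in> W" by (rule sobolev_0_imp_sobolev[OF w])
  note t = test_function_sobolev[OF \<phi>(1)]
  have VI: "integrable M (\<lambda>x. V x \<bullet> F x)" if F: "p_integrable p M F" for F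
  proof (rule Bochner_Integration.integrable_bound)
    note [measurable] = p_integrableD(1)[OF F]
    show "integrable M (\<lambda>x. B * norm (F x))" using p_integrable_imp_integrable[OF p_gt_1 finite_M F] by simp
    show "(\<lambda>x. V x \<bullet> F x) \<in> borel_measurable M" by measurable
    show "AE x in M. norm (V x \<bullet> F x) \<le> norm (B * norm (F x))"
    proof (rule AE_I2)
      fix x assume "x \<in> space M"
      then have x: "x \<in> \<Omega>" by simp
      have "\<bar>V x \<bullet> F x\<bar> \<le> norm (V x) * norm (F x)" by (rule Cauchy_Schwarz_ineq2)
      also have "\<dots> \<le> B * norm (F x)" using B[OF x] by (intro mult_right_mono) auto
      finally show "norm (V x \<bullet> F x) \<le> norm (B * norm (F x))" by simp
    qed
  qed
  have pd: "p_integrable p M (\<lambda>x. grad w x - grad (\<phi> k) x)" for k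
    by (rule p_integrable_diff[OF p_pos sobolevD(2)[OF wW] sobolevD(2)[OF t(1)]])
  have "(\<lambda>k. LINT x|M. norm (grad w x - grad (\<phi> k) x) powr p) \<longlonglongrightarrow> 0"
  proof (rule tendsto_sandwich[OF _ _ tendsto_const \<phi>(2)])
    show "eventually (\<lambda>k. (LINT x|M. norm (grad w x - grad (\<phi> k) x) powr p) \<le> sobolev_modulus (\<lambda>x. w x - \<phi> k x)) sequentially"
    proof (rule always_eventually, rule allI)
      fix k
      have "(LINT x|M. norm (grad w x - grad (\<phi> k) x) powr p) = (LINT x|M. norm (grad (\<lambda>x. w x - \<phi> k x) x) powr p)"
      proof (rule p_integral_cong_AE[OF pd sobolevD(2)[OF sobolev_diff(1)[OF wW t(1)]]])
        show "AE x in M. grad w x - grad (\<phi> k) x = grad (\<lambda>x. w x - \<phi> k x) x"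
          using sobolev_diff(2)[OF wW t(1), of k] by eventually_elim simp
      qed
      then show "(LINT x|M. norm (grad w x - grad (\<phi> k) x) powr p) \<le> sobolev_modulus (\<lambda>x. w x - \<phi> k x)"
        by (simp add: sobolev_modulus_def)
    qed
  qed simp
  from L1_tendsto_from_p_integral[OF p_gt_1 finite_M pd this]
  have "(\<lambda>k. B * (LINT x|M. norm (grad w x - grad (\<phi> k) x))) \<longlonglongrightarrow> B * 0" by (intro tendsto_intros)
  moreover have "\<bar>LINT x|M. V x \<bullet> grad w x\<bar> \<le> B * (LINT x|M. norm (grad w x - grad (\<phi> k) x))" for k
  proof -
    have "(LINT x|M. V x \<bullet> grad (\<phi> k) x) = (LINT x|M. V x \<bullet> (\<chi> i. partial_deriv i (\<phi> k) x))"
    proof (rule integral_cong_AE)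
      show "AE x in M. V x \<bullet> grad (\<phi> k) x = V x \<bullet> (\<chi> i. partial_deriv i (\<phi> k) x)"
        using t(2)[of k] by eventually_elim simp
      show "(\<lambda>x. V x \<bullet> grad (\<phi> k) x) \<in> borel_measurable M" using VI[OF sobolevD(2)[OF t(1)]] by blast
      have "continuous_on UNIV (\<lambda>x. V x \<bullet> (\<chi> i. partial_deriv i (\<phi> k) x))"
        using test_functionD(3)[OF \<phi>(1)] by (intro continuous_on_inner V continuous_on_vec_lambda)
      then show "(\<lambda>x. V x \<bullet> (\<chi> i. partial_deriv i (\<phi> k) x)) \<in> borel_measurable M"
        by (rule continuous_imp_measurable_bounded(1))
    qed
    then have "(LINT x|M. V x \<bullet> grad w x) = (LINT x|M. V x \<bullet> (grad w x - grad (\<phi> k) x))"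
      using zero[OF \<phi>(1)] VI[OF sobolevD(2)[OF wW]] VI[OF sobolevD(2)[OF t(1)]] by (simp add: inner_diff_right)
    also have "\<bar>\<dots>\<bar> \<le> (LINT x|M. \<bar>V x \<bullet> (grad w x - grad (\<phi> k) x)\<bar>)" by (rule integral_abs_bound)
    also have "\<dots> \<le> (LINT x|M. B * norm (grad w x - grad (\<phi> k) x))"
    proof (rule integral_mono)
      show "integrable M (\<lambda>x. \<bar>V x \<bullet> (grad w x - grad (\<phi> k) x)\<bar>)" by (rule integrable_abs[OF VI[OF pd]])
      show "integrable M (\<lambda>x. B * norm (grad w x - grad (\<phi> k) x))"
        using p_integrable_imp_integrable[OF p_gt_1 finite_M pd] by simp
      show "\<bar>V x \<bullet> (grad w x - grad (\<phi> k) x)\<bar> \<le> B * norm (grad w x - grad (\<phi> k) x)" if "x \<in> space M" for x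
        using Cauchy_Schwarz_ineq2[of "V x" "grad w x - grad (\<phi> k) x"]
          mult_right_mono[OF B[of x] norm_ge_zero[of "grad w x - grad (\<phi> k) x"]] that by auto
    qed
    finally show ?thesis by simp
  qed
  ultimately have "\<bar>LINT x|M. V x \<bullet> grad w x\<bar> \<le> B * 0"
    by (intro LIMSEQ_le_const) auto
  then show ?thesis by simp
qed

text \<open>The constants do not depend on \<open>r\<close>. Replacing \<open>r\<close> by a large multiple therefore concentrates the
  energy in the direction of \<open>r\<close> without loss in the bounds.\<close>

lemma exponential_solutions:
  assumes dim: "2 \<le> CARD('n)"
  obtains c C where "0 < c" "\<And>r::real^'n. r \<noteq> 0 \<Longrightarrow> \<exists>f\<in>boundary_space p \<Omega>.
     AE x in M. c * (norm r * exp (x \<bullet> r)) \<le> norm (grad (u0 f) x) \<and>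
       norm (grad (u0 f) x) \<le> C * (norm r * exp (x \<bullet> r))"
proof -
  obtain g \<theta> c C where c: "0 < c" "\<And>y. c \<le> g y" "\<And>y. g y \<le> C"
    and dw: "\<And>y. ((\<lambda>y. g y * cos (\<theta> y)) has_real_derivative g y * sin (\<theta> y)) (at y)"
    and dB: "\<And>y. ((\<lambda>y. g y powr (p - 1) * sin (\<theta> y)) has_real_derivative - (p - 1) * (g y powr (p - 1) * cos (\<theta> y))) (at y)"
    and dg: "\<And>y. \<exists>D. (g has_real_derivative D) (at y)" and d\<theta>: "\<And>y. \<exists>D. (\<theta> has_real_derivative D) (at y)"
    by (rule wolff_profile[OF p_gt_1]) (rule that; assumption)
  have g0: "0 < g y" for y using c(1) c(2)[of y] by linarith
  have cg: "continuous_on UNIV g" "continuous_on UNIV \<theta>"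
    using dg d\<theta> DERIV_isCont by (blast intro: continuous_at_imp_continuous_on)+
  have "\<exists>f\<in>boundary_space p \<Omega>.
     AE x in M. c * (norm r * exp (x \<bullet> r)) \<le> norm (grad (u0 f) x) \<and>
       norm (grad (u0 f) x) \<le> C * (norm r * exp (x \<bullet> r))" if r: "r \<noteq> 0" for r :: "real^'n"
  proof -
    obtain b0 :: "real^'n" where b0: "b0 \<noteq> 0" "orthogonal r b0"
      using orthogonal_to_vector_exists[of r] dim by auto
    define b where "b = (norm r / norm b0) *\<^sub>R b0"
    have rb: "r \<bullet> b = 0" "b \<bullet> r = 0" and bb: "b \<bullet> b = r \<bullet> r"
      using b0 by (auto simp: b_def orthogonal_def inner_commute dot_square_norm power2_eq_square)
    define u where "u x = exp (x \<bullet> r) * (g (x \<bullet> b) * cos (\<theta> (x \<bullet> b)))" for x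
    define G where "G x = (exp (x \<bullet> r) * g (x \<bullet> b)) *\<^sub>R (cos (\<theta> (x \<bullet> b)) *\<^sub>R r + sin (\<theta> (x \<bullet> b)) *\<^sub>R b)" for x
    have comp: "continuous_on UNIV (\<lambda>x. g (x \<bullet> b))" "continuous_on UNIV (\<lambda>x. \<theta> (x \<bullet> b))"
      using cg by (auto intro!: continuous_on_compose2[of UNIV g] continuous_on_compose2[of UNIV \<theta>] continuous_intros)
    have contG: "continuous_on UNIV G" unfolding G_def by (intro continuous_intros comp)
    have dchain: "((\<lambda>x. F (x \<bullet> v)) has_derivative (\<lambda>h. (h \<bullet> v) * D)) (at x)"
      if "(F has_real_derivative D) (at (x \<bullet> v))" for F D x and v :: "real^'n"
    proof -
      have "((\<lambda>x. x \<bullet> v) has_derivative (\<lambda>h. h \<bullet> v)) (at x)" by (auto intro!: derivative_eq_intros)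
      from has_derivative_compose[OF this has_field_derivative_imp_has_derivative[OF that]]
      show ?thesis by (simp add: mult.commute)
    qed
    have dexp: "((\<lambda>x. exp (k * (x \<bullet> r))) has_derivative (\<lambda>h. (h \<bullet> r) * (k * exp (k * (x \<bullet> r))))) (at x)" for k x
      by (rule dchain) (auto intro!: derivative_eq_intros)
    have du: "(u has_derivative (\<lambda>v. G x \<bullet> v)) (at x)" for x
    proof -
      have "(u has_derivative (\<lambda>h. exp (1 * (x \<bullet> r)) * ((h \<bullet> b) * (g (x \<bullet> b) * sin (\<theta> (x \<bullet> b))))
         + (h \<bullet> r) * (1 * exp (1 * (x \<bullet> r))) * (g (x \<bullet> b) * cos (\<theta> (x \<bullet> b))))) (at x)"
        using has_derivative_mult[OF dexp[of 1 x] dchain[OF dw[of "x \<bullet> b"]]] by (simp add: u_def[abs_def])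
      moreover have "(\<lambda>h. exp (1 * (x \<bullet> r)) * ((h \<bullet> b) * (g (x \<bullet> b) * sin (\<theta> (x \<bullet> b))))
         + (h \<bullet> r) * (1 * exp (1 * (x \<bullet> r))) * (g (x \<bullet> b) * cos (\<theta> (x \<bullet> b)))) = (\<lambda>v. G x \<bullet> v)"
        by (rule ext) (simp add: G_def inner_add_left inner_commute algebra_simps)
      ultimately show ?thesis by simp
    qed
    have uW: "u \<in> W" and gu: "AE x in M. grad u x = G x" by (rule C1_imp_sobolev[OF du contG])+
    have nG: "norm (G x) = norm r * (exp (x \<bullet> r) * g (x \<bullet> b))" for x
    proof -
      let ?e = "cos (\<theta> (x \<bullet> b)) *\<^sub>R r + sin (\<theta> (x \<bullet> b)) *\<^sub>R b"
      have "?e \<bullet> ?e = (r \<bullet> r) * (cos (\<theta> (x \<bullet> b)) * cos (\<theta> (x \<bullet> b)) + sin (\<theta> (x \<bullet> b)) * sin (\<theta> (x \<bullet> b)))"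
        by (simp add: inner_add_left inner_add_right rb bb algebra_simps del: sin_cos_squared_add3)
      then have "?e \<bullet> ?e = r \<bullet> r" by simp
      then have "norm ?e = norm r" by (simp add: norm_eq_sqrt_inner)
      then show ?thesis using g0[of "x \<bullet> b"] by (simp add: G_def abs_mult)
    qed
    \<comment> \<open>\<open>P\<close> and \<open>Q\<close> are, up to a constant, the components of the flux along \<open>r\<close> and \<open>b\<close>. Since \<open>r\<close> and \<open>b\<close>
      are orthogonal, the divergence involves only the derivatives of \<open>P\<close> along \<open>r\<close> and of \<open>Q\<close> along \<open>b\<close>,
      which cancel.\<close>
    define P where "P x = exp ((p - 1) * (x \<bullet> r)) * (g (x \<bullet> b) powr (p - 1) * cos (\<theta> (x \<bullet> b)))" for x
    define Q where "Q x = exp ((p - 1) * (x \<bullet> r)) * (g (x \<bullet> b) powr (p - 1) * sin (\<theta> (x \<bullet> b)))" for x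
    have flux: "pflux p (G x) = norm r powr (p - 2) *\<^sub>R (P x *\<^sub>R r + Q x *\<^sub>R b)" for x
    proof -
      define E where "E = exp (x \<bullet> r) * g (x \<bullet> b)"
      have E: "0 < E" using g0 by (simp add: E_def)
      have "E powr (p - 2) * E = E powr (p - 1)"
        using E powr_add[of E "p - 2" 1] by simp
      also have "\<dots> = exp ((p - 1) * (x \<bullet> r)) * g (x \<bullet> b) powr (p - 1)"
        using g0[of "x \<bullet> b"] by (simp add: E_def powr_mult exp_powr_real mult.commute)
      finally have Ep: "E powr (p - 2) * E = exp ((p - 1) * (x \<bullet> r)) * g (x \<bullet> b) powr (p - 1)" .
      have "pflux p (G x) = (norm r * E) powr (p - 2) *\<^sub>R (E *\<^sub>R (cos (\<theta> (x \<bullet> b)) *\<^sub>R r + sin (\<theta> (x \<bullet> b)) *\<^sub>R b))"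
        by (simp add: pflux_def nG E_def) (simp add: G_def)
      also have "\<dots> = norm r powr (p - 2) *\<^sub>R ((E powr (p - 2) * E) *\<^sub>R (cos (\<theta> (x \<bullet> b)) *\<^sub>R r + sin (\<theta> (x \<bullet> b)) *\<^sub>R b))"
        using E by (simp add: powr_mult)
      finally show ?thesis unfolding Ep P_def Q_def by (simp add: scaleR_add_right mult.assoc)
    qed
    have contPQ: "continuous_on UNIV P" "continuous_on UNIV Q"
      unfolding P_def Q_def using g0 by (intro continuous_intros comp; simp add: less_imp_neq[symmetric])+
    have dP: "\<exists>D. (P has_derivative D) (at x) \<and> D r = (p - 1) * (r \<bullet> r) * P x" for x
    proof -
      obtain D1 D2 where D: "(g has_real_derivative D1) (at (x \<bullet> b))" "(\<theta> has_real_derivative D2) (at (x \<bullet> b))" using dg d\<theta> by blast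
      have "\<exists>D. ((\<lambda>y. g y powr (p - 1) * cos (\<theta> y)) has_real_derivative D) (at (x \<bullet> b))"
      proof -
        have "(\<lambda>y. g y powr (p - 1) * cos (\<theta> y)) field_differentiable (at (x \<bullet> b))"
        proof -
          have "((\<lambda>y. g y powr (p - 1)) has_real_derivative (p - 1) * g (x \<bullet> b) powr (p - 1 - 1) * D1) (at (x \<bullet> b))"
            using DERIV_fun_powr[OF D(1) g0, of "p - 1"] by simp
          from DERIV_mult[OF this DERIV_chain2[OF DERIV_cos D(2)]] show ?thesis
            unfolding field_differentiable_def by blast
        qed
        then show ?thesis by (simp add: field_differentiable_def)
      qed
      then obtain D where "((\<lambda>y. g y powr (p - 1) * cos (\<theta> y)) has_real_derivative D) (at (x \<bullet> b))" by blast
      note X = has_derivative_mult[OF dexp[of "p - 1" x] dchain[OF this]]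
      show ?thesis unfolding P_def[abs_def] by (rule exI, rule conjI, rule X) (simp add: rb)
    qed
    then obtain P' where P': "\<And>x. (P has_derivative P' x) (at x)" "\<And>x. P' x r = (p - 1) * (r \<bullet> r) * P x" by metis
    have dQ: "\<exists>D. (Q has_derivative D) (at x) \<and> D b = - ((p - 1) * (r \<bullet> r) * P x)" for x
    proof -
      note X = has_derivative_mult[OF dexp[of "p - 1" x] dchain[OF dB[of "x \<bullet> b"]]]
      show ?thesis unfolding Q_def[abs_def] by (rule exI, rule conjI, rule X) (simp add: P_def rb bb algebra_simps)
    qed
    then obtain Q' where Q': "\<And>x. (Q has_derivative Q' x) (at x)" "\<And>x. Q' x b = - ((p - 1) * (r \<bullet> r) * P x)" by metis
    have weak: "(LINT x|M. pflux p (grad u x) \<bullet> grad w x) = 0" if w: "w \<in> W0" for w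
    proof -
      have "(LINT x|M. (pflux p (G x)) \<bullet> grad w x) = 0"
      proof (rule weak_solution_by_density[OF continuous_on_pflux[OF p_gt_1 contG] _ w])
        fix \<phi> assume \<phi>: "\<phi> \<in> test_functions \<Omega>"
        note t = test_functionD[OF \<phi>]
        let ?D = "\<lambda>x. \<chi> i. partial_deriv i \<phi> x"
        have cD: "continuous_on UNIV (\<lambda>x. ?D x \<bullet> v)" for v
          by (intro continuous_on_inner continuous_on_vec_lambda t continuous_on_const)
        have vD: "?D x \<bullet> v = 0" if "x \<notin> \<Omega>" for x v
          using t(10)[OF that] by (simp add: inner_vec_def)
        have cP': "continuous_on UNIV (\<lambda>x. P' x r)" "continuous_on UNIV (\<lambda>x. Q' x b)"
          unfolding P'(2) Q'(2) by (intro continuous_intros contPQ)+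
        note ip = integral_by_parts[OF domain_sets P'(1) cP'(1) frechet_derivative_eq_inner[OF t(2)] cD t(8,9) vD]
        note iq = integral_by_parts[OF domain_sets Q'(1) cP'(2) frechet_derivative_eq_inner[OF t(2)] cD t(8,9) vD]
        have "(LINT x|M. P x * (?D x \<bullet> r) + Q x * (?D x \<bullet> b)) = - (LINT x|M. P' x r * \<phi> x) + - (LINT x|M. Q' x b * \<phi> x)"
          using ip(1,2) iq(1,2) by simp
        also have "\<dots> = 0" unfolding P'(2) Q'(2) by simp
        finally have z: "(LINT x|M. P x * (?D x \<bullet> r) + Q x * (?D x \<bullet> b)) = 0" .
        have "(LINT x|M. pflux p (G x) \<bullet> ?D x) = (LINT x|M. norm r powr (p - 2) * (P x * (?D x \<bullet> r) + Q x * (?D x \<bullet> b)))"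
          unfolding flux by (simp add: inner_add_left inner_add_right inner_commute)
        also have "\<dots> = 0" using z by simp
        finally show "(LINT x|M. pflux p (G x) \<bullet> ?D x) = 0" .
      qed
      moreover have "(LINT x|M. pflux p (grad u x) \<bullet> grad w x) = (LINT x|M. pflux p (G x) \<bullet> grad w x)"
      proof (rule integral_cong_AE)
        note wW = sobolev_0_imp_sobolev[OF w]
        note [measurable] = p_integrableD(1)[OF sobolevD(2)[OF uW]] p_integrableD(1)[OF sobolevD(2)[OF wW]]
          continuous_imp_measurable_bounded(1)[OF contG]
        show "AE x in M. pflux p (grad u x) \<bullet> grad w x = pflux p (G x) \<bullet> grad w x"
          using gu by eventually_elim simp
        show "(\<lambda>x. pflux p (grad u x) \<bullet> grad w x) \<in> borel_measurable M" by measurable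
        show "(\<lambda>x. pflux p (G x) \<bullet> grad w x) \<in> borel_measurable M" by measurable
      qed
      ultimately show ?thesis by simp
    qed
    obtain f where f: "f \<in> boundary_space p \<Omega>" "u \<in> f" using boundary_class[OF uW] by blast
    have "AE x in M. grad (u0 f) x = grad u x"
      by (rule weak_solution_gradient[OF f weak])
    then have "AE x in M. c * (norm r * exp (x \<bullet> r)) \<le> norm (grad (u0 f) x) \<and>
       norm (grad (u0 f) x) \<le> C * (norm r * exp (x \<bullet> r))"
      using gu
    proof eventually_elim
      case (elim x)
      have "norm r * exp (x \<bullet> r) * c \<le> norm r * exp (x \<bullet> r) * g (x \<bullet> b)" using c(2) by (intro mult_left_mono) auto
      moreover have "norm r * exp (x \<bullet> r) * g (x \<bullet> b) \<le> norm r * exp (x \<bullet> r) * C" using c(3) by (intro mult_left_mono) auto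
      ultimately show ?case using elim nG[of x] by (simp add: mult.commute mult.left_commute)
    qed
    then show ?thesis using f(1) by blast
  qed
  then show ?thesis using c(1) by (intro that[of c C]) auto
qed

end

section \<open>Points of density\<close>

text \<open>If \<open>S\<close> is covered by balls in which a set \<open>B \<supseteq> S\<close> occupies at most a fixed fraction
  \<open>\<theta> < 1\<close>, then Vitali's theorem shows that the outer measure of \<open>S\<close> is at most \<open>\<theta>\<close> times
  itself.\<close>

lemma negligible_if_low_density:
  fixes S B :: "'a::euclidean_space set"
  assumes B: "B \<in> sets lebesgue" and S: "S \<subseteq> B" "bounded S" and \<theta>: "0 \<le> \<theta>" "\<theta> < 1"
    and low: "\<And>x d. x \<in> S \<Longrightarrow> 0 < d \<Longrightarrow>
      \<exists>r. 0 < r \<and> r < d \<and> measure lebesgue (B \<inter> ball x r) \<le> \<theta> * measure lebesgue (ball x r)"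
  shows "negligible S"
proof -
  let ?m = "measure lebesgue"
  define \<beta> where "\<beta> = Inf {?m T | T. S \<subseteq> T \<and> T \<in> lmeasurable}"
  have bdd: "bdd_below {?m T | T. S \<subseteq> T \<and> T \<in> lmeasurable}" by (rule bdd_belowI[of _ 0]) auto
  obtain R where "S \<subseteq> ball 0 R" using bounded_subset_ballD[OF S(2)] by blast
  then have ne: "{?m T | T. S \<subseteq> T \<and> T \<in> lmeasurable} \<noteq> {}"
    using lmeasurable_ball[of 0 R] by (auto simp del: lmeasurable_ball)
  have \<beta>_le: "\<beta> \<le> ?m T" if "S \<subseteq> T" "T \<in> lmeasurable" for T
    unfolding \<beta>_def using that by (intro cInf_lower bdd) blast
  have \<beta>0: "0 \<le> \<beta>" unfolding \<beta>_def using ne by (intro cInf_greatest) auto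
  have contr: "\<beta> \<le> \<theta> * (\<beta> + 2 * \<delta>)" if \<delta>: "0 < \<delta>" for \<delta>
  proof -
    obtain T where T: "S \<subseteq> T" "T \<in> lmeasurable" "?m T < \<beta> + \<delta>"
    proof -
      have "Inf {?m T | T. S \<subseteq> T \<and> T \<in> lmeasurable} < \<beta> + \<delta>" using \<delta> by (simp add: \<beta>_def[symmetric])
      from cInf_lessD[OF ne this] show ?thesis using that by blast
    qed
    obtain U where U: "open U" "T \<subseteq> U" "U - T \<in> lmeasurable" "emeasure lebesgue (U - T) < ennreal \<delta>"
      using sets_lebesgue_outer_open[OF fmeasurableD[OF T(2)] \<delta>] by blast
    have UT: "U = T \<union> (U - T)" using U(2) by blast
    have Um: "U \<in> lmeasurable" using fmeasurable.Un[OF T(2) U(3)] UT by simp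
    have "?m (U - T) < \<delta>"
      using U(3,4) \<delta> by (simp add: emeasure_eq_measure2 ennreal_less_iff)
    moreover have "?m U \<le> ?m T + ?m (U - T)"
      using measure_Un_le[of T lebesgue "U - T"] T(2) U(3) UT by (simp add: fmeasurableD)
    ultimately have mU: "?m U \<le> \<beta> + 2 * \<delta>" using T(3) by linarith
    define K where "K = {(x, r). x \<in> S \<and> 0 < r \<and> ball x r \<subseteq> U \<and> ?m (B \<inter> ball x r) \<le> \<theta> * ?m (ball x r)}"
    obtain C where C: "countable C" "C \<subseteq> K"
      "pairwise (\<lambda>i j. disjnt (ball (fst i) (snd i)) (ball (fst j) (snd j))) C"
      "negligible (S - (\<Union>i\<in>C. ball (fst i) (snd i)))"
    proof (rule Vitali_covering_theorem_balls[of S K fst snd])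
      fix x and d :: real assume x: "x \<in> S" and d: "0 < d"
      obtain k where k: "0 < k" "ball x k \<subseteq> U" using U(1,2) T(1) x by (meson open_contains_ball subsetD)
      obtain r where r: "0 < r" "r < min d k" "?m (B \<inter> ball x r) \<le> \<theta> * ?m (ball x r)"
        using low[OF x, of "min d k"] d k by auto
      then have "ball x r \<subseteq> U" using k(2) subset_ball[of r k x] by auto
      then have "(x, r) \<in> K" using x r by (simp add: K_def)
      then show "\<exists>i. i \<in> K \<and> x \<in> ball (fst i) (snd i) \<and> snd i < d" using r by (intro exI[of _ "(x, r)"]) auto
    qed
    define b where "b i = ball (fst i) (snd i)" for i :: "'a \<times> real"
    have disj: "disjoint_family_on b C" "disjoint_family_on (\<lambda>i. B \<inter> b i) C"
      using C(3) unfolding disjoint_family_on_def pairwise_def disjnt_def b_def by blast+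
    have bl: "b i \<in> lmeasurable" for i by (simp add: b_def)
    have bs: "b i \<in> sets lebesgue" for i using bl by (rule fmeasurableD)
    have em: "emeasure lebesgue (B \<inter> b i) \<le> ennreal \<theta> * emeasure lebesgue (b i)" if "i \<in> C" for i
    proof -
      have "?m (B \<inter> b i) \<le> \<theta> * ?m (b i)" using C(2) that by (auto simp: K_def b_def)
      moreover have "B \<inter> b i \<in> lmeasurable" using B bl by (subst Int_commute) (rule fmeasurable_Int_fmeasurable)
      ultimately show ?thesis using bl[of i] \<theta>(1)
        by (simp add: emeasure_eq_measure2 ennreal_mult[symmetric] ennreal_leI)
    qed
    have "emeasure lebesgue (\<Union>i\<in>C. B \<inter> b i) = (\<integral>\<^sup>+i. emeasure lebesgue (B \<inter> b i) \<partial>count_space C)"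
      using B bs by (intro emeasure_UN_countable C(1) disj) auto
    also have "\<dots> \<le> (\<integral>\<^sup>+i. ennreal \<theta> * emeasure lebesgue (b i) \<partial>count_space C)"
      using em by (intro nn_integral_mono) simp
    also have "\<dots> = ennreal \<theta> * emeasure lebesgue (\<Union>i\<in>C. b i)"
      using bs by (subst emeasure_UN_countable[OF _ C(1) disj(1)]) (auto simp: nn_integral_cmult)
    also have "\<dots> \<le> ennreal \<theta> * emeasure lebesgue U"
    proof (intro mult_left_mono emeasure_mono)
      have "b i \<subseteq> U" if "i \<in> C" for i
        using subsetD[OF C(2) that] by (cases i) (simp add: K_def b_def)
      then show "(\<Union>i\<in>C. b i) \<subseteq> U" by blast
      show "U \<in> sets lebesgue" using Um by (rule fmeasurableD)
    qed simp
    also have "\<dots> = ennreal (\<theta> * ?m U)" using Um \<theta>(1) by (simp add: emeasure_eq_measure2 ennreal_mult)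
    finally have e: "emeasure lebesgue (\<Union>i\<in>C. B \<inter> b i) \<le> ennreal (\<theta> * ?m U)" .
    let ?V = "\<Union>i\<in>C. B \<inter> b i"
    let ?Z = "S - (\<Union>i\<in>C. b i)"
    have Vs: "?V \<in> sets lebesgue" using B bs C(1) by (intro sets.countable_UN') auto
    have Vm: "?V \<in> lmeasurable" using Vs e by (intro fmeasurableI) (auto simp: le_less_trans[OF _ ennreal_less_top])
    have mV: "?m ?V \<le> \<theta> * ?m U" using e Vm \<theta>(1) by (simp add: emeasure_eq_measure2)
    have Z: "negligible ?Z" using C(4) by (simp add: b_def)
    have "S \<subseteq> ?V \<union> ?Z" using S(1) by auto
    moreover have "?V \<union> ?Z \<in> lmeasurable" using Vm negligible_imp_measurable[OF Z] by (rule fmeasurable.Un)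
    ultimately have "\<beta> \<le> ?m (?V \<union> ?Z)" by (rule \<beta>_le)
    also have "\<dots> \<le> ?m ?V + ?m ?Z" using Vm negligible_imp_measurable[OF Z] by (intro measure_Un_le) auto
    also have "?m ?Z = 0" using Z by (rule negligible_imp_measure0)
    finally have "\<beta> \<le> \<theta> * ?m U" using mV by simp
    also have "\<dots> \<le> \<theta> * (\<beta> + 2 * \<delta>)" using mU \<theta>(1) by (intro mult_left_mono)
    finally show ?thesis .
  qed
  have "\<beta> = 0"
  proof (rule ccontr)
    assume "\<beta> \<noteq> 0"
    then have pos: "0 < \<beta> * (1 - \<theta>)" using \<beta>0 \<theta>(2) by simp
    define \<delta> where "\<delta> = \<beta> * (1 - \<theta>) / 4"
    have \<delta>: "0 < \<delta>" using pos by (simp add: \<delta>_def)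
    have "\<beta> * (1 - \<theta>) \<le> \<theta> * (2 * \<delta>)" using contr[OF \<delta>] by (simp add: algebra_simps)
    also have "\<dots> \<le> 1 * (2 * \<delta>)" using \<theta>(2) \<delta> by (intro mult_right_mono) auto
    also have "\<dots> < \<beta> * (1 - \<theta>)" using pos by (simp add: \<delta>_def)
    finally show False by simp
  qed
  show ?thesis
    unfolding negligible_outer_le
  proof (intro allI impI)
    fix e :: real assume "0 < e"
    then have "Inf {?m T | T. S \<subseteq> T \<and> T \<in> lmeasurable} < e" using \<open>\<beta> = 0\<close> by (simp only: \<beta>_def)
    from cInf_lessD[OF ne this] obtain T where "S \<subseteq> T" "T \<in> lmeasurable" "?m T < e" by blast
    then show "\<exists>T. S \<subseteq> T \<and> T \<in> lmeasurable \<and> ?m T \<le> e" by (meson less_imp_le)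
  qed
qed

text \<open>Lebesgue's density theorem: a point of \<open>B\<close> that is not a point of density belongs to one of
  countably many sets of low density.\<close>

lemma negligible_diff_measure_interior:
  fixes B :: "(real^'n::finite) set"
  assumes B: "B \<in> sets lebesgue"
  shows "negligible (B - measure_interior B)"
proof -
  let ?m = "measure lebesgue"
  define N where "N k = {x \<in> B. \<forall>d>0. \<exists>r. 0 < r \<and> r < d \<and> ?m (B \<inter> ball x r) \<le> (1 - 1 / real (Suc k)) * ?m (ball x r)}" for k
  have "negligible (N k)" for k
  proof -
    have "negligible (N k \<inter> ball 0 (real j))" for j
    proof (rule negligible_if_low_density[OF B, of _ "1 - 1 / real (Suc k)"])
      show "N k \<inter> ball 0 (real j) \<subseteq> B" by (auto simp: N_def)
    qed (auto simp: N_def bounded_Int)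
    then have "negligible (\<Union>j. N k \<inter> ball 0 (real j))" by (intro negligible_Union_nat) auto
    moreover have "N k \<subseteq> (\<Union>j. N k \<inter> ball 0 (real j))"
    proof
      fix x assume "x \<in> N k"
      moreover obtain j :: nat where "norm x < real j" using reals_Archimedean2 by blast
      ultimately show "x \<in> (\<Union>j. N k \<inter> ball 0 (real j))" by auto
    qed
    ultimately show ?thesis by (rule negligible_subset)
  qed
  then have "negligible (\<Union>k. N k)" by (intro negligible_Union_nat)
  moreover have "B - measure_interior B \<subseteq> (\<Union>k. N k)"
  proof (rule subsetI, rule ccontr)
    fix x assume x: "x \<in> B - measure_interior B" and nx: "x \<notin> (\<Union>k. N k)"
    have le: "?m (B \<inter> ball x r) \<le> ?m (ball x r)" for r
      using B by (intro measure_mono_fmeasurable) auto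
    have "((\<lambda>r. ?m (B \<inter> ball x r) / ?m (ball x r)) \<longlongrightarrow> 1) (at_right 0)"
    proof (rule tendstoI)
      fix e :: real assume "0 < e"
      obtain k where k: "1 / real (Suc k) < e" using \<open>0 < e\<close> by (metis nat_approx_posE)
      have "x \<notin> N k" using nx by blast
      then obtain d where d: "0 < d" "\<And>r. 0 < r \<Longrightarrow> r < d \<Longrightarrow> ?m (B \<inter> ball x r) > (1 - 1 / real (Suc k)) * ?m (ball x r)"
        using x by (auto simp: N_def not_le)
      have "dist (?m (B \<inter> ball x r) / ?m (ball x r)) 1 < e" if r: "0 < r" "r < d" for r
      proof -
        have p: "0 < ?m (ball x r)" using r(1) by (simp add: content_ball_pos)
        have "1 - 1 / real (Suc k) < ?m (B \<inter> ball x r) / ?m (ball x r)"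
          using d(2)[OF r] p by (simp only: pos_less_divide_eq)
        moreover have "?m (B \<inter> ball x r) / ?m (ball x r) \<le> 1" using le[of r] p by simp
        ultimately show ?thesis using k unfolding dist_real_def by linarith
      qed
      then show "eventually (\<lambda>r. dist (?m (B \<inter> ball x r) / ?m (ball x r)) 1 < e) (at_right 0)"
        using d(1) by (auto simp: eventually_at_right_field)
    qed
    then show False using x by (simp add: measure_interior_def)
  qed
  ultimately show ?thesis by (rule negligible_subset)
qed

section \<open>Test sets and the support of the perturbation\<close>

context bounded_domain
begin

lemma DN_map_set_le_integral:
  assumes B: "B \<in> sets lebesgue" "B \<subseteq> \<Omega>" and "0 \<le> \<kappa>"
    and h: "h \<in> borel_measurable M" "AE x in M. \<bar>h x\<bar> \<le> K" "AE x in M. \<kappa> * indicator B x \<le> h x"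
    and f: "f \<in> boundary_space p \<Omega>"
  shows "\<kappa> * DN_map_set p \<Omega> B f f \<le> (LINT x|M. h x * norm (grad (u0 f) x) powr p)"
proof -
  let ?u = "u0 f"
  have W: "?u \<in> W" by (rule dirichlet_solution_minimizes(3)[OF f bounded_conductivity_1])
  have Ia: "integrable M (\<lambda>x. norm (grad ?u x) powr p)" by (rule p_integrableD(2)[OF sobolevD(2)[OF W]])
  have Bm: "(indicator B :: _ \<Rightarrow> real) \<in> borel_measurable M"
    using B(1) by (intro measurable_restrict_space1 borel_measurable_indicator)
  have IB: "integrable M (\<lambda>x. indicator B x * norm (grad ?u x) powr p)"
    by (rule integrable_bounded_mult[OF Ia Bm, of 1]) (auto simp: indicator_def)
  have "\<kappa> * DN_map_set p \<Omega> B f f = (LINT x|M. \<kappa> * (indicator B x * norm (grad ?u x) powr p))"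
    unfolding DN_map_set_eq[OF f B] by simp
  also have "\<dots> \<le> (LINT x|M. h x * norm (grad ?u x) powr p)"
  proof (rule integral_mono_AE)
    show "AE x in M. \<kappa> * (indicator B x * norm (grad ?u x) powr p) \<le> h x * norm (grad ?u x) powr p"
      using h(3)
    proof eventually_elim
      case (elim x)
      from mult_right_mono[OF this, of "norm (grad ?u x) powr p"] show ?case by (simp add: mult.assoc)
    qed
    show "integrable M (\<lambda>x. h x * norm (grad ?u x) powr p)" by (rule integrable_bounded_mult[OF Ia h(1,2)])
  qed (use IB in simp)
  finally show ?thesis .
qed

text \<open>On the superlevel set the factor \<open>1 - \<sigma> x powr (- 1 / (p - 1))\<close> of the lower monotonicity bound is
  bounded below by a positive constant, and elsewhere it is nonnegative.\<close>

lemma superlevel_test_set: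
  assumes \<sigma>: "bounded_conductivity \<sigma> c C" and ge: "AE x in M. 1 \<le> \<sigma> x" and \<delta>: "0 < \<delta>"
  shows "{x \<in> \<Omega>. 1 + \<delta> \<le> \<sigma> x} \<in> test_sets p \<Omega> \<sigma>"
proof -
  let ?B = "{x \<in> \<Omega>. 1 + \<delta> \<le> \<sigma> x}"
  note [measurable] = bounded_conductivityD(1)[OF \<sigma>]
  have "{x \<in> space M. 1 + \<delta> \<le> \<sigma> x} \<in> sets M" by measurable
  then have B: "?B \<in> sets lebesgue" "?B \<subseteq> \<Omega>" by (auto simp: sets_restrict_space_iff)
  let ?e = "- 1 / (p - 1)"
  define k where "k = 1 - (1 + \<delta>) powr ?e"
  have e: "?e < 0" using p_gt_1 by (simp add: field_simps)
  have "(1 + \<delta>) powr ?e < 1 powr ?e" using \<delta> e by (intro powr_less_mono2_neg) auto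
  then have k: "0 < k" by (simp add: k_def)
  define \<alpha> where "\<alpha> = (p - 1) * k"
  have \<alpha>: "0 < \<alpha>" using k p_gt_1 by (simp add: \<alpha>_def)
  have hk: "AE x in M. k * indicator ?B x \<le> 1 - \<sigma> x powr ?e"
    using ge
  proof eventually_elim
    case (elim x)
    show ?case
    proof (cases "x \<in> ?B")
      case True
      then have "\<sigma> x powr ?e \<le> (1 + \<delta>) powr ?e" using \<delta> e by (intro powr_mono2') auto
      then show ?thesis using True by (simp add: k_def)
    next
      case False
      have "\<sigma> x powr ?e \<le> 1 powr ?e" using elim e by (intro powr_mono2') auto
      then show ?thesis using False by simp
    qed
  qed
  have hb: "AE x in M. \<bar>1 - \<sigma> x powr ?e\<bar> \<le> 1 + c powr ?e"
    using powr_conductivity_bound(2)[OF \<sigma>] by eventually_elim linarith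
  have hm: "(\<lambda>x. 1 - \<sigma> x powr ?e) \<in> borel_measurable M"
    using powr_conductivity_bound(1)[OF \<sigma>] by (intro borel_measurable_diff) auto
  have "boundary_map_le p \<Omega> (\<lambda>f g. DN_map_0 p \<Omega> f g + \<alpha> * DN_map_set p \<Omega> ?B f g) (DN_map p \<Omega> \<sigma>)"
    unfolding boundary_map_le_def
  proof
    fix f assume f: "f \<in> boundary_space p \<Omega>"
    have "\<alpha> * DN_map_set p \<Omega> ?B f f \<le> (p - 1) *
        (LINT x|M. (1 - \<sigma> x powr ?e) * norm (grad (u0 f) x) powr p)"
      using DN_map_set_le_integral[OF B less_imp_le[OF k] hm hb hk f] p_gt_1 unfolding \<alpha>_def
      by (simp add: mult.assoc)
    also have "\<dots> \<le> DN_map p \<Omega> \<sigma> f f - DN_map_0 p \<Omega> f f" by (rule DN_map_diff_ge[OF f \<sigma>])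
    finally show "0 \<le> DN_map p \<Omega> \<sigma> f f - (DN_map_0 p \<Omega> f f + \<alpha> * DN_map_set p \<Omega> ?B f f)" by simp
  qed
  then show ?thesis using B \<alpha> unfolding test_sets_def by blast
qed

text \<open>Here the upper monotonicity bound is used: its factor \<open>\<sigma> x - 1\<close> is at most \<open>- \<delta>\<close> on the sublevel
  set and nonpositive elsewhere.\<close>

lemma sublevel_test_set:
  assumes \<sigma>: "bounded_conductivity \<sigma> c C" and le: "AE x in M. \<sigma> x \<le> 1" and \<delta>: "0 < \<delta>"
  shows "{x \<in> \<Omega>. \<sigma> x \<le> 1 - \<delta>} \<in> test_sets p \<Omega> \<sigma>"
proof -
  let ?B = "{x \<in> \<Omega>. \<sigma> x \<le> 1 - \<delta>}"
  note [measurable] = bounded_conductivityD(1)[OF \<sigma>]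
  have "{x \<in> space M. \<sigma> x \<le> 1 - \<delta>} \<in> sets M" by measurable
  then have B: "?B \<in> sets lebesgue" "?B \<subseteq> \<Omega>" by (auto simp: sets_restrict_space_iff)
  have hk: "AE x in M. \<delta> * indicator ?B x \<le> 1 - \<sigma> x"
    using le by eventually_elim (auto simp: indicator_def)
  have hb: "AE x in M. \<bar>1 - \<sigma> x\<bar> \<le> 1 + C"
    using bounded_conductivityD(4)[OF \<sigma>] by eventually_elim linarith
  have hm: "(\<lambda>x. 1 - \<sigma> x) \<in> borel_measurable M" by measurable
  have "boundary_map_le p \<Omega> (DN_map p \<Omega> \<sigma>) (\<lambda>f g. DN_map_0 p \<Omega> f g - \<delta> * DN_map_set p \<Omega> ?B f g)"
    unfolding boundary_map_le_def
  proof
    fix f assume f: "f \<in> boundary_space p \<Omega>"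
    let ?a = "\<lambda>x. norm (grad (u0 f) x) powr p"
    have "\<delta> * DN_map_set p \<Omega> ?B f f \<le> (LINT x|M. (1 - \<sigma> x) * ?a x)"
      by (rule DN_map_set_le_integral[OF B less_imp_le[OF \<delta>] hm hb hk f])
    also have "\<dots> = (LINT x|M. - ((\<sigma> x - 1) * ?a x))" by (intro Bochner_Integration.integral_cong) (auto simp: algebra_simps)
    also have "\<dots> = - (LINT x|M. (\<sigma> x - 1) * ?a x)" by simp
    also have "\<dots> \<le> DN_map_0 p \<Omega> f f - DN_map p \<Omega> \<sigma> f f" using DN_map_diff_le[OF f \<sigma>] by simp
    finally show "0 \<le> DN_map_0 p \<Omega> f f - \<delta> * DN_map_set p \<Omega> ?B f f - DN_map p \<Omega> \<sigma> f f" by simp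
  qed
  then show ?thesis using B \<delta> unfolding test_sets_def by blast
qed

text \<open>The exponential solutions with direction \<open>\<tau> r\<close> have energy density comparable to
  \<open>\<tau>\<^sup>p exp (p \<tau> x \<bullet> r)\<close>. For large \<open>\<tau>\<close>, any mass of \<open>B\<close> beyond the hyperplane \<open>x \<bullet> r = t\<close> therefore
  outweighs whatever happens in the half-space \<open>x \<bullet> r \<le> t\<close>.\<close>

lemma negligible_beyond_hyperplane:
  assumes dim: "2 \<le> CARD('n)" and B: "B \<in> sets lebesgue" "B \<subseteq> \<Omega>" and \<alpha>: "0 < \<alpha>" and r: "r \<noteq> 0"
    and h: "h \<in> borel_measurable M" "AE x in M. \<bar>h x\<bar> \<le> K" "AE x in M. t < x \<bullet> r \<longrightarrow> h x = 0"
    and le: "\<And>f. f \<in> boundary_space p \<Omega> \<Longrightarrow> \<alpha> * DN_map_set p \<Omega> B f f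
       \<le> (LINT x|M. h x * norm (grad (u0 f) x) powr p)"
  shows "negligible (B \<inter> {x. t < x \<bullet> r})"
proof -
  interpret fm: finite_measure M by (rule finite_M)
  obtain c C where c: "0 < c" and sol: "\<And>r::real^'n. r \<noteq> 0 \<Longrightarrow> \<exists>f\<in>boundary_space p \<Omega>.
     AE x in M. c * (norm r * exp (x \<bullet> r)) \<le> norm (grad (u0 f) x) \<and>
       norm (grad (u0 f) x) \<le> C * (norm r * exp (x \<bullet> r))"
    using exponential_solutions[OF dim] by blast
  have "negligible (B \<inter> {x. s < x \<bullet> r})" if s: "t < s" for s
  proof -
    let ?E = "B \<inter> {x. s < x \<bullet> r}"
    have "open {x. s < x \<bullet> r}" by (intro open_Collect_less continuous_intros)
    from borel_open[OF this] have "{x. s < x \<bullet> r} \<in> sets lebesgue" by (intro sets_completionI_sets) simp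
    then have E: "?E \<in> sets lebesgue" by (rule sets.Int[OF B(1)])
    have E\<Omega>: "?E \<inter> \<Omega> = ?E" using B(2) by blast
    then have EM: "?E \<in> sets M" using E by (subst sets_restrict_space_iff) auto
    define mE where "mE = measure M ?E"
    define A1 where "A1 = \<alpha> * c powr p * mE"
    define A2 where "A2 = \<bar>K\<bar> * \<bar>C\<bar> powr p * measure M \<Omega>"
    have key: "A1 * exp (p * \<tau> * (s - t)) \<le> A2" if \<tau>: "0 < \<tau>" for \<tau>
    proof -
      have "\<tau> *\<^sub>R r \<noteq> 0" using \<tau> r by simp
      from sol[OF this] obtain f where f: "f \<in> boundary_space p \<Omega>" and
        bd: "AE x in M. c * (norm (\<tau> *\<^sub>R r) * exp (x \<bullet> (\<tau> *\<^sub>R r))) \<le> norm (grad (u0 f) x) \<and>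
          norm (grad (u0 f) x) \<le> C * (norm (\<tau> *\<^sub>R r) * exp (x \<bullet> (\<tau> *\<^sub>R r)))" by blast
      define a where "a x = norm (grad (u0 f) x) powr p" for x
      define L where "L = (\<tau> * norm r) powr p"
      have L: "0 < L" using \<tau> r by (simp add: L_def)
      have pw: "(d * (norm (\<tau> *\<^sub>R r) * exp (x \<bullet> (\<tau> *\<^sub>R r)))) powr p = d powr p * L * exp (p * \<tau> * (x \<bullet> r))" if "0 \<le> d" for d x
        using that \<tau> by (simp add: L_def powr_mult exp_powr_real mult_ac)
      have bd': "AE x in M. c powr p * L * exp (p * \<tau> * (x \<bullet> r)) \<le> a x \<and> a x \<le> \<bar>C\<bar> powr p * L * exp (p * \<tau> * (x \<bullet> r))"
        using bd
      proof eventually_elim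
        case (elim x)
        let ?X = "norm (\<tau> *\<^sub>R r) * exp (x \<bullet> (\<tau> *\<^sub>R r))"
        have "(c * ?X) powr p \<le> a x" unfolding a_def using elim c p_pos by (intro powr_mono2) auto
        moreover have "norm (grad (u0 f) x) \<le> \<bar>C\<bar> * ?X"
        proof -
          have "C * ?X \<le> \<bar>C\<bar> * ?X" by (intro mult_right_mono) auto
          then show ?thesis using elim by linarith
        qed
        then have "a x \<le> (\<bar>C\<bar> * ?X) powr p" unfolding a_def using p_pos by (intro powr_mono2) auto
        ultimately show ?case using pw[of c x] pw[of "\<bar>C\<bar>" x] c by simp
      qed
      have W: "u0 f \<in> W" by (rule dirichlet_solution_minimizes(3)[OF f bounded_conductivity_1])
      have Ia: "integrable M a" unfolding a_def by (rule p_integrableD(2)[OF sobolevD(2)[OF W]])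
      have Bm: "(indicator B :: _ \<Rightarrow> real) \<in> borel_measurable M"
        using B(1) by (intro measurable_restrict_space1 borel_measurable_indicator)
      have IB: "integrable M (\<lambda>x. indicator B x * a x)"
        by (rule integrable_bounded_mult[OF Ia Bm, of 1]) (auto simp: indicator_def)
      have lower: "c powr p * L * exp (p * \<tau> * s) * mE \<le> DN_map_set p \<Omega> B f f"
      proof -
        have "c powr p * L * exp (p * \<tau> * s) * mE = (LINT x|M. c powr p * L * exp (p * \<tau> * s) * indicator ?E x)"
          using EM E\<Omega> by (simp add: mE_def)
        also have "\<dots> \<le> (LINT x|M. indicator B x * a x)"
        proof (rule integral_mono_AE)
          show "integrable M (\<lambda>x. c powr p * L * exp (p * \<tau> * s) * indicator ?E x)"
            using EM by (intro integrable_mult_right integrable_real_indicator) (auto simp: fm.emeasure_finite less_top[symmetric])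
          show "AE x in M. c powr p * L * exp (p * \<tau> * s) * indicator ?E x \<le> indicator B x * a x"
            using bd'
          proof eventually_elim
            case (elim x)
            show ?case
            proof (cases "x \<in> ?E")
              case True
              have "exp (p * \<tau> * s) \<le> exp (p * \<tau> * (x \<bullet> r))" using True \<tau> p_pos by simp
              then have "c powr p * L * exp (p * \<tau> * s) \<le> c powr p * L * exp (p * \<tau> * (x \<bullet> r))"
                using L by (intro mult_left_mono) auto
              then show ?thesis using elim True by simp
            qed (simp add: indicator_def a_def)
          qed
        qed (rule IB)
        finally show ?thesis unfolding DN_map_set_eq[OF f B] a_def .
      qed
      have upper: "(LINT x|M. h x * a x) \<le> \<bar>K\<bar> * (\<bar>C\<bar> powr p * L * exp (p * \<tau> * t)) * measure M \<Omega>"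
      proof -
        have "(LINT x|M. h x * a x) \<le> (LINT x|M. \<bar>K\<bar> * (\<bar>C\<bar> powr p * L * exp (p * \<tau> * t)))"
        proof (rule integral_mono_AE)
          show "integrable M (\<lambda>x. h x * a x)" by (rule integrable_bounded_mult[OF Ia h(1,2)])
          show "AE x in M. h x * a x \<le> \<bar>K\<bar> * (\<bar>C\<bar> powr p * L * exp (p * \<tau> * t))"
            using bd' h(2,3)
          proof eventually_elim
            case (elim x)
            show ?case
            proof (cases "t < x \<bullet> r")
              case True
              then show ?thesis using elim L by simp
            next
              case False
              then have "exp (p * \<tau> * (x \<bullet> r)) \<le> exp (p * \<tau> * t)" using \<tau> p_pos by simp
              then have "\<bar>C\<bar> powr p * L * exp (p * \<tau> * (x \<bullet> r)) \<le> \<bar>C\<bar> powr p * L * exp (p * \<tau> * t)"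
                using L by (intro mult_left_mono) auto
              with elim have "a x \<le> \<bar>C\<bar> powr p * L * exp (p * \<tau> * t)" by linarith
              moreover have "h x \<le> \<bar>K\<bar>" using elim by linarith
              moreover have "0 \<le> a x" by (simp add: a_def)
              ultimately show ?thesis by (intro mult_mono) auto
            qed
          qed
        qed simp
        also have "\<dots> = \<bar>K\<bar> * (\<bar>C\<bar> powr p * L * exp (p * \<tau> * t)) * measure M \<Omega>" by simp
        finally show ?thesis .
      qed
      have "\<alpha> * (c powr p * L * exp (p * \<tau> * s) * mE) \<le> \<alpha> * DN_map_set p \<Omega> B f f"
        using lower \<alpha> by (intro mult_left_mono) auto
      also have "\<dots> \<le> (LINT x|M. h x * a x)" unfolding a_def by (rule le[OF f])
      also note upper
      finally have "L * (A1 * exp (p * \<tau> * s)) \<le> L * (A2 * exp (p * \<tau> * t))"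
        by (simp add: A1_def A2_def mult_ac)
      then have "A1 * exp (p * \<tau> * s) \<le> A2 * exp (p * \<tau> * t)" using L by simp
      moreover have "exp (p * \<tau> * s) = exp (p * \<tau> * (s - t)) * exp (p * \<tau> * t)"
        by (simp add: exp_add[symmetric] algebra_simps)
      ultimately show ?thesis by simp
    qed
    have "mE = 0"
    proof (rule ccontr)
      assume "mE \<noteq> 0"
      then have "0 < mE" by (simp add: mE_def zero_less_measure_iff)
      then have A1: "0 < A1" using \<alpha> c by (simp add: A1_def)
      define \<tau> where "\<tau> = (\<bar>A2\<bar> / A1 + 1) / (p * (s - t))"
      have ps: "0 < p * (s - t)" using p_pos s by simp
      have "0 < \<bar>A2\<bar> / A1 + 1" using A1 by (intro add_nonneg_pos) auto
      then have \<tau>: "0 < \<tau>" using ps by (simp add: \<tau>_def)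
      have pt: "p * \<tau> * (s - t) = \<bar>A2\<bar> / A1 + 1" using ps p_pos s by (simp add: \<tau>_def)
      have "A2 \<le> A1 * (\<bar>A2\<bar> / A1)" using A1 by simp
      also have "\<dots> < A1 * exp (p * \<tau> * (s - t))"
        unfolding pt using A1 exp_ge_add_one_self[of "\<bar>A2\<bar> / A1 + 1"] by (intro mult_strict_left_mono) auto
      finally show False using key[OF \<tau>] by simp
    qed
    then have "measure lebesgue ?E = 0"
      using EM E B(2) unfolding mE_def by (subst (asm) measure_restrict_space) auto
    moreover have "?E \<in> lmeasurable"
      using bounded_domain B(2) E by (intro bounded_set_imp_lmeasurable) (auto intro: bounded_subset)
    ultimately show ?thesis by (simp add: negligible_iff_measure0)
  qed
  then have "negligible (\<Union>n. B \<inter> {x. t + 1 / real (Suc n) < x \<bullet> r})"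
    by (intro negligible_Union_nat) simp
  moreover have "B \<inter> {x. t < x \<bullet> r} \<subseteq> (\<Union>n. B \<inter> {x. t + 1 / real (Suc n) < x \<bullet> r})"
  proof
    fix x assume x: "x \<in> B \<inter> {x. t < x \<bullet> r}"
    then obtain n where "1 / real (Suc n) < x \<bullet> r - t" using nat_approx_posE[of "x \<bullet> r - t"] by auto
    then have "t + 1 / real (Suc n) < x \<bullet> r" by linarith
    then show "x \<in> (\<Union>n. B \<inter> {x. t + 1 / real (Suc n) < x \<bullet> r})" using x by blast
  qed
  ultimately show ?thesis by (rule negligible_subset)
qed

text \<open>Combined with the monotonicity bounds, either operator inequality in the definition of a test set
  bounds the energy in \<open>B\<close> by an integral over the half-space in which \<open>\<sigma>\<close> may differ from \<open>1\<close>.\<close>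

lemma test_set_negligible_beyond_hyperplane:
  assumes dim: "2 \<le> CARD('n)" and \<sigma>: "bounded_conductivity \<sigma> c C" and B: "B \<in> test_sets p \<Omega> \<sigma>"
    and r: "r \<noteq> 0" and one: "AE x in M. t < x \<bullet> r \<longrightarrow> \<sigma> x = 1"
  shows "negligible (B \<inter> {x. t < x \<bullet> r})"
proof -
  obtain \<alpha> where Bs: "B \<in> sets lebesgue" "B \<subseteq> \<Omega>" and \<alpha>: "0 < \<alpha>" and disj:
     "boundary_map_le p \<Omega> (\<lambda>f g. DN_map_0 p \<Omega> f g + \<alpha> * DN_map_set p \<Omega> B f g) (DN_map p \<Omega> \<sigma>) \<or>
     boundary_map_le p \<Omega> (DN_map p \<Omega> \<sigma>) (\<lambda>f g. DN_map_0 p \<Omega> f g - \<alpha> * DN_map_set p \<Omega> B f g)"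
    using B unfolding test_sets_def by blast
  note sm [measurable] = bounded_conductivityD(1)[OF \<sigma>]
  from disj show ?thesis
  proof
    assume A: "boundary_map_le p \<Omega> (\<lambda>f g. DN_map_0 p \<Omega> f g + \<alpha> * DN_map_set p \<Omega> B f g) (DN_map p \<Omega> \<sigma>)"
    show ?thesis
    proof (rule negligible_beyond_hyperplane[OF dim Bs \<alpha> r, of "\<lambda>x. \<sigma> x - 1" "C + 1"])
      show "(\<lambda>x. \<sigma> x - 1) \<in> borel_measurable M" by measurable
      show "AE x in M. \<bar>\<sigma> x - 1\<bar> \<le> C + 1"
        using bounded_conductivityD(4)[OF \<sigma>] by eventually_elim linarith
      show "AE x in M. t < x \<bullet> r \<longrightarrow> \<sigma> x - 1 = 0" using one by eventually_elim simp
      show "\<alpha> * DN_map_set p \<Omega> B f f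
       \<le> (LINT x|M. (\<sigma> x - 1) * norm (grad (u0 f) x) powr p)"
        if f: "f \<in> boundary_space p \<Omega>" for f
      proof -
        have "0 \<le> DN_map p \<Omega> \<sigma> f f - (DN_map_0 p \<Omega> f f + \<alpha> * DN_map_set p \<Omega> B f f)"
          using A f unfolding boundary_map_le_def by blast
        then show ?thesis using DN_map_diff_le[OF f \<sigma>] by linarith
      qed
    qed
  next
    assume A: "boundary_map_le p \<Omega> (DN_map p \<Omega> \<sigma>) (\<lambda>f g. DN_map_0 p \<Omega> f g - \<alpha> * DN_map_set p \<Omega> B f g)"
    let ?e = "- 1 / (p - 1)"
    show ?thesis
    proof (rule negligible_beyond_hyperplane[OF dim Bs \<alpha> r, of "\<lambda>x. (p - 1) * (\<sigma> x powr ?e - 1)" "(p - 1) * (c powr ?e + 1)"])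
      show "(\<lambda>x. (p - 1) * (\<sigma> x powr ?e - 1)) \<in> borel_measurable M"
        by (intro borel_measurable_times borel_measurable_diff powr_conductivity_bound(1)[OF \<sigma>]) auto
      show "AE x in M. \<bar>(p - 1) * (\<sigma> x powr ?e - 1)\<bar> \<le> (p - 1) * (c powr ?e + 1)"
        using powr_conductivity_bound(2)[OF \<sigma>]
      proof eventually_elim
        case (elim x)
        then have "\<bar>\<sigma> x powr ?e - 1\<bar> \<le> c powr ?e + 1" by linarith
        then have "(p - 1) * \<bar>\<sigma> x powr ?e - 1\<bar> \<le> (p - 1) * (c powr ?e + 1)" using p_gt_1 by (intro mult_left_mono) auto
        then show ?case using p_gt_1 by (simp add: abs_mult)
      qed
      show "AE x in M. t < x \<bullet> r \<longrightarrow> (p - 1) * (\<sigma> x powr ?e - 1) = 0" using one by eventually_elim simp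
      show "\<alpha> * DN_map_set p \<Omega> B f f
       \<le> (LINT x|M. (p - 1) * (\<sigma> x powr ?e - 1) * norm (grad (u0 f) x) powr p)"
        if f: "f \<in> boundary_space p \<Omega>" for f
      proof -
        let ?a = "\<lambda>x. norm (grad (u0 f) x) powr p"
        have "0 \<le> (DN_map_0 p \<Omega> f f - \<alpha> * DN_map_set p \<Omega> B f f) - DN_map p \<Omega> \<sigma> f f"
          using A f unfolding boundary_map_le_def by blast
        then have "\<alpha> * DN_map_set p \<Omega> B f f \<le> - ((p - 1) * (LINT x|M. (1 - \<sigma> x powr ?e) * ?a x))"
          using DN_map_diff_ge[OF f \<sigma>] by linarith
        also have "\<dots> = (LINT x|M. - ((p - 1) * ((1 - \<sigma> x powr ?e) * ?a x)))" by simp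
        also have "\<dots> = (LINT x|M. (p - 1) * (\<sigma> x powr ?e - 1) * ?a x)"
          by (intro Bochner_Integration.integral_cong) (auto simp: algebra_simps)
        finally show ?thesis .
      qed
    qed
  qed
qed

end

lemma measure_interior_empty_if_negligible:
  fixes B V :: "(real^'n::finite) set"
  assumes "negligible (B \<inter> V)" "open V" shows "measure_interior B \<inter> V = {}"
proof (rule equals0I)
  fix x assume x: "x \<in> measure_interior B \<inter> V"
  obtain d where d: "0 < d" "ball x d \<subseteq> V" using x assms(2) by (meson IntD2 open_contains_ball)
  have "measure lebesgue (B \<inter> ball x \<epsilon>) / measure lebesgue (ball x \<epsilon>) = 0" if "0 < \<epsilon>" "\<epsilon> < d" for \<epsilon>
  proof -
    have "B \<inter> ball x \<epsilon> \<subseteq> B \<inter> V" using d(2) subset_ball[of \<epsilon> d x] that by auto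
    then have "negligible (B \<inter> ball x \<epsilon>)" by (rule negligible_subset[OF assms(1)])
    then show ?thesis by (simp add: negligible_imp_measure0)
  qed
  then have "eventually (\<lambda>\<epsilon>. measure lebesgue (B \<inter> ball x \<epsilon>) / measure lebesgue (ball x \<epsilon>) = 0) (at_right 0)"
    using d(1) by (auto simp: eventually_at_right_field)
  then have "((\<lambda>\<epsilon>. measure lebesgue (B \<inter> ball x \<epsilon>) / measure lebesgue (ball x \<epsilon>)) \<longlongrightarrow> 0) (at_right 0)"
    by (rule tendsto_eventually)
  moreover have "((\<lambda>\<epsilon>. measure lebesgue (B \<inter> ball x \<epsilon>) / measure lebesgue (ball x \<epsilon>)) \<longlongrightarrow> 1) (at_right 0)"
    using x by (simp add: measure_interior_def)
  ultimately have "(0::real) = 1" by (intro tendsto_unique) auto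
  then show False by simp
qed

text \<open>By Lindelof's theorem, countably many of the open sets in the definition of the support cover its
  complement.\<close>

lemma AE_zero_outside_ess_support:
  fixes \<Omega> :: "(real^'n::finite) set"
  assumes "open \<Omega>"
  shows "AE x in lebesgue. x \<in> \<Omega> \<longrightarrow> x \<notin> ess_support \<Omega> f \<longrightarrow> f x = 0"
proof -
  define F where "F = {U. open U \<and> U \<subseteq> \<Omega> \<and> (AE x in lebesgue_on U. f x = 0)}"
  obtain F' where F': "F' \<subseteq> F" "countable F'" "\<Union>F' = \<Union>F"
    using Lindelof[of F] unfolding F_def by auto
  have "AE x in lebesgue. x \<in> U \<longrightarrow> f x = 0" if "U \<in> F'" for U
    using F'(1) that by (auto simp: F_def AE_restrict_space_iff borel_open)
  then have "AE x in lebesgue. \<forall>U\<in>F'. x \<in> U \<longrightarrow> f x = 0"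
    using F'(2) by (intro AE_ball_countable[THEN iffD2] ballI)
  then show ?thesis
  proof eventually_elim
    case (elim x)
    then show ?case using F'(3) unfolding ess_support_def F_def[symmetric] by blast
  qed
qed

lemma ess_support_disjoint:
  fixes \<Omega> V :: "(real^'n::finite) set"
  assumes "open \<Omega>" "open V" "AE x in lebesgue. x \<in> \<Omega> \<longrightarrow> x \<in> V \<longrightarrow> f x = 0"
  shows "ess_support \<Omega> f \<inter> V = {}"
proof -
  have o: "open (\<Omega> \<inter> V)" using assms by blast
  have "AE x in lebesgue_on (\<Omega> \<inter> V). f x = 0"
  proof -
    have "AE x in lebesgue. x \<in> \<Omega> \<inter> V \<longrightarrow> f x = 0" using assms(3) by eventually_elim simp
    then show ?thesis using o by (subst AE_restrict_space_iff) (simp_all add: borel_open)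
  qed
  then show ?thesis using o unfolding ess_support_def by blast
qed

lemma ess_convex_hull_mono:
  assumes "\<And>\<rho> t. B - {x. x \<bullet> \<rho> \<le> t} \<in> null_sets lebesgue \<Longrightarrow> A - {x. x \<bullet> \<rho> \<le> t} \<in> null_sets lebesgue"
  shows "ess_convex_hull A \<subseteq> ess_convex_hull B"
  using assms unfolding ess_convex_hull_def by blast

theorem corollary3p2:
  fixes p :: real and \<Omega> :: "(real^'n::finite) set" and \<sigma> :: "real^'n \<Rightarrow> real"
  assumes "CARD('n) \<ge> 2" and "1 < p"
    and "open \<Omega>" and "bounded \<Omega>"
    and "\<sigma> \<in> L_infinity_plus \<Omega>"
    and "(AE x in lebesgue_on \<Omega>. \<sigma> x \<ge> 1) \<or> (AE x in lebesgue_on \<Omega>. \<sigma> x \<le> 1)"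
  shows "ess_convex_hull (ess_support \<Omega> (\<lambda>x. \<bar>\<sigma> x - 1\<bar>)) =
         ess_convex_hull (\<Union>B\<in>test_sets p \<Omega> \<sigma>. measure_interior B)"
proof (rule subset_antisym)
  interpret bounded_domain p \<Omega> by unfold_locales fact+
  obtain c C where \<sigma>: "bounded_conductivity \<sigma> c C"
    using L_infinity_plus_bounded_conductivity[OF assms(5)] by blast
  let ?S = "ess_support \<Omega> (\<lambda>x. \<bar>\<sigma> x - 1\<bar>)" and ?I = "\<Union>B\<in>test_sets p \<Omega> \<sigma>. measure_interior B"
  have openV: "open {x::real^'n. t < x \<bullet> \<rho>}" for \<rho> t by (intro open_Collect_less continuous_intros)
  have compl: "A - {x. x \<bullet> \<rho> \<le> t} = A \<inter> {x. t < x \<bullet> \<rho>}" for A and \<rho> :: "real^'n" and t by auto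
  have AE_M: "(AE x in M. P x) \<longleftrightarrow> (AE x in lebesgue. x \<in> \<Omega> \<longrightarrow> P x)" for P
    by (simp add: AE_restrict_space_iff)
  show "ess_convex_hull ?S \<subseteq> ess_convex_hull ?I"
  proof (rule ess_convex_hull_mono)
    fix \<rho> :: "real^'n" and t assume null: "?I - {x. x \<bullet> \<rho> \<le> t} \<in> null_sets lebesgue"
    let ?V = "{x. t < x \<bullet> \<rho>}"
    \<comment> \<open>Together these test sets exhaust the set where \<open>\<sigma>\<close> differs from \<open>1\<close>, up to a null set.\<close>
    define B where "B k = (if AE x in M. 1 \<le> \<sigma> x then {x \<in> \<Omega>. 1 + 1 / real (Suc k) \<le> \<sigma> x}
       else {x \<in> \<Omega>. \<sigma> x \<le> 1 - 1 / real (Suc k)})" for k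
    have BT: "B k \<in> test_sets p \<Omega> \<sigma>" for k
      using superlevel_test_set[OF \<sigma>, of "1 / real (Suc k)"] sublevel_test_set[OF \<sigma>, of "1 / real (Suc k)"] assms(6)
      by (auto simp: B_def)
    have AEB: "AE x in lebesgue. x \<in> B k \<longrightarrow> x \<notin> ?V" for k
    proof -
      have "B k \<in> sets lebesgue" using BT[of k] by (simp add: test_sets_def)
      then have "B k - measure_interior (B k) \<in> null_sets lebesgue"
        using negligible_diff_measure_interior by (simp add: negligible_iff_null_sets)
      then have "AE x in lebesgue. x \<notin> B k - measure_interior (B k)" by (rule AE_not_in)
      moreover have "AE x in lebesgue. x \<notin> ?I - {x. x \<bullet> \<rho> \<le> t}" using null by (rule AE_not_in)
      ultimately show ?thesis
      proof eventually_elim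
        case (elim x)
        show ?case
        proof
          assume "x \<in> B k"
          then have "x \<in> ?I" using elim(1) BT[of k] by blast
          then show "x \<notin> ?V" using elim(2) by auto
        qed
      qed
    qed
    have "AE x in lebesgue. \<forall>k. x \<in> B k \<longrightarrow> x \<notin> ?V" by (intro AE_all_countable[THEN iffD2] allI AEB)
    moreover have "AE x in lebesgue. x \<in> \<Omega> \<longrightarrow> \<sigma> x \<noteq> 1 \<longrightarrow> (\<exists>k. x \<in> B k)"
    proof (cases "AE x in M. 1 \<le> \<sigma> x")
      case True
      then have "AE x in lebesgue. x \<in> \<Omega> \<longrightarrow> 1 \<le> \<sigma> x" by (simp add: AE_M)
      then show ?thesis
      proof eventually_elim
        case (elim x)
        show ?case
        proof (intro impI)
          assume x: "x \<in> \<Omega>" "\<sigma> x \<noteq> 1"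
          then have "0 < \<sigma> x - 1" using elim by simp
          then obtain k where "1 / real (Suc k) < \<sigma> x - 1" by (rule nat_approx_posE)
          then have "1 + 1 / real (Suc k) \<le> \<sigma> x" by linarith
          then show "\<exists>k. x \<in> B k" using x True unfolding B_def by auto
        qed
      qed
    next
      case False
      then have "AE x in lebesgue. x \<in> \<Omega> \<longrightarrow> \<sigma> x \<le> 1" using assms(6) by (simp add: AE_M)
      then show ?thesis
      proof eventually_elim
        case (elim x)
        show ?case
        proof (intro impI)
          assume x: "x \<in> \<Omega>" "\<sigma> x \<noteq> 1"
          then have "0 < 1 - \<sigma> x" using elim by simp
          then obtain k where "1 / real (Suc k) < 1 - \<sigma> x" by (rule nat_approx_posE)
          then have "\<sigma> x \<le> 1 - 1 / real (Suc k)" by linarith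
          then show "\<exists>k. x \<in> B k" using x False unfolding B_def by auto
        qed
      qed
    qed
    ultimately have "AE x in lebesgue. x \<in> \<Omega> \<longrightarrow> x \<in> ?V \<longrightarrow> \<bar>\<sigma> x - 1\<bar> = 0"
      by eventually_elim auto
    then have "?S \<inter> ?V = {}" by (rule ess_support_disjoint[OF assms(3) openV])
    then show "?S - {x. x \<bullet> \<rho> \<le> t} \<in> null_sets lebesgue" unfolding compl by simp
  qed
  show "ess_convex_hull ?I \<subseteq> ess_convex_hull ?S"
  proof (rule ess_convex_hull_mono)
    fix \<rho> :: "real^'n" and t assume null: "?S - {x. x \<bullet> \<rho> \<le> t} \<in> null_sets lebesgue"
    have one: "AE x in M. t < x \<bullet> \<rho> \<longrightarrow> \<sigma> x = 1"
      unfolding AE_M using AE_zero_outside_ess_support[OF assms(3), of "\<lambda>x. \<bar>\<sigma> x - 1\<bar>"] AE_not_in[OF null]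
      by eventually_elim auto
    have "measure_interior B \<inter> {x. t < x \<bullet> \<rho>} = {}" if B: "B \<in> test_sets p \<Omega> \<sigma>" for B
    proof -
      have "negligible (B \<inter> {x. t < x \<bullet> \<rho>})"
      proof (cases "\<rho> = 0")
        case False
        then show ?thesis by (rule test_set_negligible_beyond_hyperplane[OF assms(1) \<sigma> B _ one])
      next
        case True
        \<comment> \<open>Such a half-space is the whole space or empty. In the latter case \<open>\<sigma> = 1\<close> almost everywhere,
          and any half-space disjoint from \<open>\<Omega>\<close> serves instead.\<close>
        show ?thesis
        proof (cases "t < 0")
          case neg: True
          obtain r :: "real^'n" where r: "r \<noteq> 0" using nonzero_Basis nonempty_Basis by blast
          obtain R where R: "\<And>x. x \<in> \<Omega> \<Longrightarrow> norm x < R" using bounded_domain bounded_pos_less by metis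
          define s where "s = - (R * norm r)"
          have sub: "\<Omega> \<subseteq> {x. s < x \<bullet> r}"
          proof
            fix x assume "x \<in> \<Omega>"
            then have "norm x * norm r < R * norm r" using R r by simp
            moreover have "\<bar>x \<bullet> r\<bar> \<le> norm x * norm r" by (rule Cauchy_Schwarz_ineq2)
            ultimately show "x \<in> {x. s < x \<bullet> r}" unfolding s_def by simp
          qed
          have "AE x in M. s < x \<bullet> r \<longrightarrow> \<sigma> x = 1" using one by eventually_elim (use True neg in simp)
          from test_set_negligible_beyond_hyperplane[OF assms(1) \<sigma> B r this]
          show ?thesis by (rule negligible_subset) (use B sub in \<open>auto simp: test_sets_def\<close>)
        qed (use True in simp)
      qed
      then show ?thesis by (rule measure_interior_empty_if_negligible[OF _ openV])
    qed
    then have "?I \<inter> {x. t < x \<bullet> \<rho>} = {}" by blast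
    then show "?I - {x. x \<bullet> \<rho> \<le> t} \<in> null_sets lebesgue" unfolding compl by simp
  qed
qed

end
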